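(* Let $a,b>0$, $\Omega_{\mathbf x}=(0,a)\times(0,a)$, $\Omega=\Omega_{\mathbf x}\times(0,b)$ and $\Gamma=\{(\mathbf x,z)\;|\;\mathbf x\in\Omega_{\mathbf x},\ z=0\text{ or }z=b\}$. Assume that $u_0\in H^2(\Omega)$, $u_0|_{\partial\Omega}=0$, $u_0>0$ in $\Omega$, and that $\psi_0\in H^3(\Omega)$ satisfies $$\psi|_{\partial\Omega\setminus\Gamma}=0,\qquad\psi_z|_\Gamma=0. \qquad(\ast)$$ Let $(u,\psi)$ be the solution of $$u_t=2u\psi_z,\qquad-\Delta\psi_t=(u^2)_z\qquad\text{in }\Omega,$$ with $\psi$ satisfying the boundary condition $(\ast)$ and with initial data $u|_{t=0}=u_0$, $\psi|_{t=0}=\psi_0$. Let $$\phi(\mathbf x,z)=\frac{e^{-\alpha(z-b)}-e^{\alpha(z-b)}}{2}\sin\frac{\pi x_1}{a}\sin\frac{\pi x_2}{a},\qquad\alpha=\frac\pi a,$$ and $$A=\int_\Omega(\log u_0)\phi\,d\mathbf x\,dz,\qquad B=2\int_\Omega\psi_{0z}\phi\,d\mathbf x\,dz,$$ $$r(t)=\frac{2\left(\frac\pi a\right)^2(e^{\alpha b}-e^{-\alpha b})}{2\left(\frac\pi a\right)^2-\alpha^2}\int_{\Omega_{\mathbf x}}(\psi-\psi_0)|_{z=0}\sin\frac{\pi x_1}{a}\sin\frac{\pi x_2}{a}\,d\mathbf x.$$ If $A>0$, $B>0$ and $r(t)\le\frac B2$ as long as $u,\psi$ remain regular, then the solution $(u,\psi)$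 develops a finite time singularity in the $H^2$ norm.
   Context: Here $\mathbf x=(x_1,x_2)$, $\Delta=\partial_{x_1}^2+\partial_{x_2}^2+\partial_z^2$, and subscripts $t,z$ denote partial derivatives ($\psi_{0z}=\partial_z\psi_0$). "Regular" refers to the class $u\in C^1([0,T);H^2(\Omega))$, $\psi\in C^1([0,T);H^3(\Omega))$. "Develops a finite time singularity in the $H^2$ norm" means that the largest time $T_b$ for which there is a solution in this class on $[0,T_b)$ is finite. *)

theory Defs
  imports "HOL-Analysis.Analysis"
begin

section \<open>Weak derivatives and the Sobolev spaces \<open>H\<^sup>k\<close>\<close>

text \<open>Derivatives of higher order are indexed by lists of basis vectors,
  \<open>[e\<^sub>1, \<dots>, e\<^sub>m]\<close> standing for the operator of order \<open>m\<close> that differentiates along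
  \<open>e\<^sub>m\<close> first and along \<open>e\<^sub>1\<close> last.\<close>

fun iter_deriv :: "'a::euclidean_space list \<Rightarrow> ('a \<Rightarrow> real) \<Rightarrow> 'a \<Rightarrow> real" where
  "iter_deriv [] f = f"
| "iter_deriv (e # es) f = (\<lambda>x. frechet_derivative (iter_deriv es f) (at x) e)"

definition smooth :: "('a::euclidean_space \<Rightarrow> real) \<Rightarrow> bool" where
  "smooth f \<longleftrightarrow> (\<forall>es. set es \<subseteq> Basis \<longrightarrow> iter_deriv es f differentiable_on UNIV)"

definition test_function :: "'a::euclidean_space set \<Rightarrow> ('a \<Rightarrow> real) \<Rightarrow> bool" where
  "test_function \<Omega> \<eta> \<longleftrightarrow> smooth \<eta> \<and> (\<exists>K. compact K \<and> K \<subseteq> \<Omega> \<and> (\<forall>x. x \<notin> K \<longrightarrow> \<eta> x = 0))"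

definition locally_integrable :: "'a::euclidean_space set \<Rightarrow> ('a \<Rightarrow> real) \<Rightarrow> bool" where
  "locally_integrable \<Omega> f \<longleftrightarrow> (\<forall>K. compact K \<and> K \<subseteq> \<Omega> \<longrightarrow> integrable (lebesgue_on K) f)"

definition has_weak_deriv ::
  "'a::euclidean_space set \<Rightarrow> 'a list \<Rightarrow> ('a \<Rightarrow> real) \<Rightarrow> ('a \<Rightarrow> real) \<Rightarrow> bool" where
  "has_weak_deriv \<Omega> es f g \<longleftrightarrow>
     locally_integrable \<Omega> f \<and> locally_integrable \<Omega> g \<and>
     (\<forall>\<eta>. test_function \<Omega> \<eta> \<longrightarrow>
        (LINT x|lebesgue_on \<Omega>. f x * iter_deriv es \<eta> x) =
        (-1) ^ length es * (LINT x|lebesgue_on \<Omega>. g x * \<eta> x))"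

definition L2_space :: "'a::euclidean_space set \<Rightarrow> ('a \<Rightarrow> real) set" where
  "L2_space \<Omega> = {f. f \<in> borel_measurable (lebesgue_on \<Omega>) \<and>
                    integrable (lebesgue_on \<Omega>) (\<lambda>x. (f x)\<^sup>2)}"

definition derivs_upto :: "nat \<Rightarrow> 'a::euclidean_space list set" where
  "derivs_upto k = {es. set es \<subseteq> Basis \<and> length es \<le> k}"

text \<open>Elements of \<open>H\<^sup>k\<close> are represented by functions; two functions that agree almost
  everywhere on \<open>\<Omega>\<close> represent the same element.\<close>

definition sobolev :: "nat \<Rightarrow> 'a::euclidean_space set \<Rightarrow> ('a \<Rightarrow> real) set" where
  "sobolev k \<Omega> = {f \<in> L2_space \<Omega>.
     \<forall>es \<in> derivs_upto k. \<exists>g \<in> L2_space \<Omega>. has_weak_deriv \<Omega> es f g}"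

text \<open>A weak derivative is determined up to a null set, so every use below is
  independent of the choice.\<close>

definition weak_deriv :: "'a::euclidean_space set \<Rightarrow> 'a list \<Rightarrow> ('a \<Rightarrow> real) \<Rightarrow> 'a \<Rightarrow> real" where
  "weak_deriv \<Omega> es f = (SOME g. g \<in> L2_space \<Omega> \<and> has_weak_deriv \<Omega> es f g)"

text \<open>The square of this norm is the sum over \<open>j \<le> k\<close> of the squared \<open>L\<^sup>2\<close> norms of the full
  derivative tensors of order \<open>j\<close>.\<close>

definition sobolev_norm :: "nat \<Rightarrow> 'a::euclidean_space set \<Rightarrow> ('a \<Rightarrow> real) \<Rightarrow> real" where
  "sobolev_norm k \<Omega> f =
     sqrt (\<Sum>es\<in>derivs_upto k. LINT x|lebesgue_on \<Omega>. (weak_deriv \<Omega> es f x)\<^sup>2)"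

definition weak_laplacian :: "'a::euclidean_space set \<Rightarrow> ('a \<Rightarrow> real) \<Rightarrow> 'a \<Rightarrow> real" where
  "weak_laplacian \<Omega> f x = (\<Sum>e\<in>Basis. weak_deriv \<Omega> [e, e] f x)"

section \<open>Pointwise and boundary values\<close>

text \<open>On a box in dimension three \<open>H\<^sup>2\<close> embeds into the continuous functions on the closed
  box. Pointwise values and boundary values of \<open>u\<close>, \<open>\<psi>\<close> and \<open>\<psi>\<^sub>z\<close> are those of the
  continuous representative, which is unique on \<open>closure \<Omega>\<close> for open \<open>\<Omega>\<close>; on the boundary
  they agree with the trace.\<close>

definition is_cont_rep :: "'a::euclidean_space set \<Rightarrow> ('a \<Rightarrow> real) \<Rightarrow> ('a \<Rightarrow> real) \<Rightarrow> bool" where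
  "is_cont_rep \<Omega> f g \<longleftrightarrow>
     continuous_on (closure \<Omega>) g \<and> (AE x in lebesgue_on \<Omega>. f x = g x)"

definition cont_rep :: "'a::euclidean_space set \<Rightarrow> ('a \<Rightarrow> real) \<Rightarrow> 'a \<Rightarrow> real" where
  "cont_rep \<Omega> f = (SOME g. is_cont_rep \<Omega> f g)"

definition vanishes_on :: "'a::euclidean_space set \<Rightarrow> ('a \<Rightarrow> real) \<Rightarrow> 'a set \<Rightarrow> bool" where
  "vanishes_on \<Omega> f S \<longleftrightarrow> (\<exists>g. is_cont_rep \<Omega> f g \<and> (\<forall>x\<in>S. g x = 0))"

section \<open>Continuously differentiable curves in \<open>H\<^sup>k\<close>\<close>

text \<open>The half-open time interval from \<open>0\<close> to \<open>T\<close>, where \<open>T = \<infinity>\<close> is allowed.\<close>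

definition time_interval :: "ereal \<Rightarrow> real set" where
  "time_interval T = {t. 0 \<le> t \<and> ereal t < T}"

text \<open>\<open>v\<close> is the time derivative of \<open>u\<close>; at \<open>t = 0\<close> it is one-sided.\<close>

definition C1_curve ::
  "nat \<Rightarrow> 'a::euclidean_space set \<Rightarrow> ereal \<Rightarrow> (real \<Rightarrow> 'a \<Rightarrow> real) \<Rightarrow> (real \<Rightarrow> 'a \<Rightarrow> real) \<Rightarrow> bool"
where
  "C1_curve k \<Omega> T u v \<longleftrightarrow>
     (\<forall>t \<in> time_interval T.
        u t \<in> sobolev k \<Omega> \<and> v t \<in> sobolev k \<Omega> \<and>
        ((\<lambda>s. sobolev_norm k \<Omega> (\<lambda>x. (u s x - u t x) / (s - t) - v t x)) \<longlongrightarrow> 0)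
           (at t within time_interval T) \<and>
        ((\<lambda>s. sobolev_norm k \<Omega> (\<lambda>x. v s x - v t x)) \<longlongrightarrow> 0) (at t within time_interval T))"

section \<open>The initial-boundary value problem\<close>

text \<open>A point is \<open>(\<bold>x, z) = ((x\<^sub>1, x\<^sub>2), z)\<close>.\<close>

type_synonym point = "(real \<times> real) \<times> real"

definition Omega_x :: "real \<Rightarrow> (real \<times> real) set" where
  "Omega_x a = {0<..<a} \<times> {0<..<a}"

definition Omega :: "real \<Rightarrow> real \<Rightarrow> point set" where
  "Omega a b = Omega_x a \<times> {0<..<b}"

definition Gam :: "real \<Rightarrow> real \<Rightarrow> point set" where
  "Gam a b = Omega_x a \<times> {0, b}"

definition e_z :: point where
  "e_z = ((0, 0), 1)"

definition boundary_condition :: "real \<Rightarrow> real \<Rightarrow> (point \<Rightarrow> real) \<Rightarrow> bool" where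
  "boundary_condition a b \<psi> \<longleftrightarrow>
     vanishes_on (Omega a b) \<psi> (frontier (Omega a b) - Gam a b) \<and>
     vanishes_on (Omega a b) (weak_deriv (Omega a b) [e_z] \<psi>) (Gam a b)"

text \<open>In the second equation the right-hand side \<open>(u\<^sup>2)\<^sub>z\<close> is a weak derivative, so the
  equation says that \<open>-\<Delta>\<psi>\<^sub>t\<close> is the weak \<open>z\<close>-derivative of \<open>u\<^sup>2\<close>.\<close>

definition regular_solution ::
  "real \<Rightarrow> real \<Rightarrow> (point \<Rightarrow> real) \<Rightarrow> (point \<Rightarrow> real) \<Rightarrow> ereal \<Rightarrow>
   (real \<Rightarrow> point \<Rightarrow> real) \<Rightarrow> (real \<Rightarrow> point \<Rightarrow> real) \<Rightarrow> bool" where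
  "regular_solution a b u0 \<psi>0 T u \<psi> \<longleftrightarrow>
     (\<exists>ut \<psi>t.
        C1_curve 2 (Omega a b) T u ut \<and>
        C1_curve 3 (Omega a b) T \<psi> \<psi>t \<and>
        (\<forall>t \<in> time_interval T.
           (AE x in lebesgue_on (Omega a b).
              ut t x = 2 * u t x * weak_deriv (Omega a b) [e_z] (\<psi> t) x) \<and>
           has_weak_deriv (Omega a b) [e_z] (\<lambda>x. (u t x)\<^sup>2)
             (\<lambda>x. - weak_laplacian (Omega a b) (\<psi>t t) x) \<and>
           boundary_condition a b (\<psi> t))) \<and>
     (AE x in lebesgue_on (Omega a b). u 0 x = u0 x) \<and>
     (AE x in lebesgue_on (Omega a b). \<psi> 0 x = \<psi>0 x)"

definition largest_time ::
  "real \<Rightarrow> real \<Rightarrow> (point \<Rightarrow> real) \<Rightarrow> (point \<Rightarrow> real) \<Rightarrow> ereal \<Rightarrow> bool" where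
  "largest_time a b u0 \<psi>0 T \<longleftrightarrow>
     0 < T \<and> (\<exists>u \<psi>. regular_solution a b u0 \<psi>0 T u \<psi>) \<and>
     (\<forall>T'. (\<exists>u \<psi>. regular_solution a b u0 \<psi>0 T' u \<psi>) \<longrightarrow> T' \<le> T)"

definition finite_time_singularity ::
  "real \<Rightarrow> real \<Rightarrow> (point \<Rightarrow> real) \<Rightarrow> (point \<Rightarrow> real) \<Rightarrow> bool" where
  "finite_time_singularity a b u0 \<psi>0 \<longleftrightarrow> (\<exists>T. largest_time a b u0 \<psi>0 T \<and> T < \<infinity>)"

section \<open>The weight and the functionals of the blow-up criterion\<close>

definition alp :: "real \<Rightarrow> real" where
  "alp a = pi / a"

definition phi :: "real \<Rightarrow> real \<Rightarrow> point \<Rightarrow> real" where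
  "phi a b = (\<lambda>((x1, x2), z).
     (exp (- alp a * (z - b)) - exp (alp a * (z - b))) / 2 * sin (pi * x1 / a) * sin (pi * x2 / a))"

text \<open>The integrand is bounded above, so in the extended sense the integral is finite or
  \<open>-\<infinity>\<close>. In the latter case the value below is \<open>0\<close>; hence positivity has its usual meaning.\<close>

definition A_const :: "real \<Rightarrow> real \<Rightarrow> (point \<Rightarrow> real) \<Rightarrow> real" where
  "A_const a b u0 = (LINT p|lebesgue_on (Omega a b). ln (u0 p) * phi a b p)"

definition B_const :: "real \<Rightarrow> real \<Rightarrow> (point \<Rightarrow> real) \<Rightarrow> real" where
  "B_const a b \<psi>0 =
     2 * (LINT p|lebesgue_on (Omega a b). weak_deriv (Omega a b) [e_z] \<psi>0 p * phi a b p)"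

definition r_fun ::
  "real \<Rightarrow> real \<Rightarrow> (point \<Rightarrow> real) \<Rightarrow> (real \<Rightarrow> point \<Rightarrow> real) \<Rightarrow> real \<Rightarrow> real" where
  "r_fun a b \<psi>0 \<psi> t =
     2 * (pi / a)\<^sup>2 * (exp (alp a * b) - exp (- alp a * b)) / (2 * (pi / a)\<^sup>2 - (alp a)\<^sup>2) *
     (LINT x|lebesgue_on (Omega_x a).
        cont_rep (Omega a b) (\<lambda>p. \<psi> t p - \<psi>0 p) (x, 0) *
        sin (pi * fst x / a) * sin (pi * snd x / a))"

end

theory Submission
  imports Defs
begin

text \<open>Suppose the regular solution is global. Put \<open>F(t) = \<integral> u\<^sup>2 \<phi>\<close> and \<open>P(t) = 2 \<integral> \<psi>\<^sub>z \<phi>\<close>.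
  Green's formula against \<open>\<phi>\<^sub>z\<close> turns \<open>-\<Delta>\<psi>\<^sub>t = (u\<^sup>2)\<^sub>z\<close> into \<open>P \<ge> B + 2 \<integral>\<^sub>0\<^sup>t F - r\<close>, so \<open>P \<ge> B/2 + 2 \<integral>\<^sub>0\<^sup>t F\<close>,
  while \<open>(ln u)\<^sub>t = 2\<psi>\<^sub>z\<close> and Jensen's inequality give \<open>F \<ge> m exp (2 (A + \<integral>\<^sub>0\<^sup>t P) / m)\<close> with \<open>m = \<integral> \<phi>\<close>.
  These two inequalities lead to blow-up in finite time.

  Two points need care. The trace of \<open>u\<close> on \<open>z = 0\<close> stays zero because \<open>u\<^sub>t = 2 u \<psi>\<^sub>z\<close> with \<open>\<psi>\<^sub>z = 0\<close> there;
  on \<open>z = b\<close> the boundary term of \<open>u\<^sup>2\<close> has the favourable sign, so nothing is needed. The logarithm is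
  replaced by \<open>ln (u\<^sup>2 + \<delta>) / 2\<close>: the bound obtained for it, uniform in \<open>\<delta>\<close>, shows \<open>u \<noteq> 0\<close> almost
  everywhere, and then \<open>\<delta> \<rightarrow> 0\<close>. All boundary terms are computed as limits of
  integrals against derivatives of smooth cutoff functions; no Sobolev embedding is used.\<close>

section \<open>Smooth cutoff functions\<close>

text \<open>Boundary data come in three strengths: \<open>\<psi>\<close> and its vertical derivative
  have continuous representatives with prescribed zeros at every time, \<open>u\<close> has one at
  time 0 only, and the time derivatives have none. Hence Green's formula is applied to
  \<open>\<psi>\<close> alone, and its pairing with the weight is differentiated in time afterwards;
  the zero trace of \<open>u\<close> on z = 0 is carried along in weak form, as the validity of
  integration by parts for test functions that vanish on z = b only. The derivative of a box cutoff
  is a difference of two nonnegative kernels that concentrate on opposite faces. A boundary term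
  tends to zero for one of two reasons: the integrand is bounded by an integrable function times the
  distance to the face, or it is uniformly small near the face. The weight is a product of two sines
  and sinh (\<alpha> (b - z)), so its z-derivative is an eigenfunction of the Laplacian with
  eigenvalue -2 \<alpha>^2 + \<alpha>^2; since it vanishes at z = b, boundary values of
  \<open>\<psi>\<close> enter through z = 0 only.\<close>

text \<open>The class is closed under partial derivatives, which gives \<open>smooth\<close> without computing higher derivatives.\<close>

inductive smooth_term :: "('a::euclidean_space \<Rightarrow> real) \<Rightarrow> bool" where
  const: "smooth_term (\<lambda>x. c)"
| atom: "(\<And>n y. (F n has_real_derivative F (Suc n) y) (at y)) \<Longrightarrow> smooth_term (\<lambda>x. F (0::nat) (x \<bullet> b))"
| add: "smooth_term f \<Longrightarrow> smooth_term g \<Longrightarrow> smooth_term (\<lambda>x. f x + g x)"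
| mult: "smooth_term f \<Longrightarrow> smooth_term g \<Longrightarrow> smooth_term (\<lambda>x. f x * g x)"

text \<open>The chain \<open>F\<close> in \<open>atom\<close> carries all its derivatives, so the
  chain shifted by one is an atom again; sums and products follow from linearity and the Leibniz
  rule.\<close>

lemma smooth_term_has_derivative:
  assumes "smooth_term f"
  obtains f' where "\<And>x. (f has_derivative f' x) (at x)" "\<And>e. smooth_term (\<lambda>x. f' x e)"
proof -
  from assms have "\<exists>f'. (\<forall>x. (f has_derivative f' x) (at x)) \<and> (\<forall>e. smooth_term (\<lambda>x. f' x e))"
  proof induction
    case (const c)
    show ?case
      by (rule exI[of _ "\<lambda>x e. 0"]) (auto intro: smooth_term.const)
  next
    case (atom F b)
    have "((\<lambda>x. F 0 (x \<bullet> b)) has_derivative (\<lambda>e. F 1 (x \<bullet> b) * (e \<bullet> b))) (at x)" for x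
    proof -
      have "((\<lambda>x. x \<bullet> b) has_derivative (\<lambda>e. e \<bullet> b)) (at x)" by (auto intro!: derivative_eq_intros)
      from DERIV_compose_FDERIV[where g = "\<lambda>x. x \<bullet> b", OF atom[of 0 "x \<bullet> b"] this]
      show ?thesis by (simp add: mult.commute)
    qed
    moreover have "smooth_term (\<lambda>x. F 1 (x \<bullet> b) * (e \<bullet> b))" for e
      using smooth_term.mult[OF smooth_term.atom[of "\<lambda>n. F (Suc n)" b] smooth_term.const] atom
      by simp
    ultimately show ?case by (intro exI[of _ "\<lambda>x e. F 1 (x \<bullet> b) * (e \<bullet> b)"]) auto
  next
    case (add f g)
    then obtain f' g' where "\<And>x. (f has_derivative f' x) (at x)" "\<And>e. smooth_term (\<lambda>x. f' x e)"
      "\<And>x. (g has_derivative g' x) (at x)" "\<And>e. smooth_term (\<lambda>x. g' x e)" by blast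
    then show ?case
      by (intro exI[of _ "\<lambda>x e. f' x e + g' x e"])
        (auto intro!: derivative_eq_intros smooth_term.add)
  next
    case (mult f g)
    then obtain f' g' where "\<And>x. (f has_derivative f' x) (at x)" "\<And>e. smooth_term (\<lambda>x. f' x e)"
      "\<And>x. (g has_derivative g' x) (at x)" "\<And>e. smooth_term (\<lambda>x. g' x e)" by blast
    then show ?case using mult(1,2)
      by (intro exI[of _ "\<lambda>x e. f x * g' x e + f' x e * g x"])
        (auto intro!: derivative_eq_intros smooth_term.add smooth_term.mult)
  qed
  with that show thesis by blast
qed

lemma smooth_term_differentiable:
  "smooth_term f \<Longrightarrow> f differentiable (at x)"
  by (metis smooth_term_has_derivative differentiable_def)

lemma smooth_term_iter_deriv: "smooth_term f \<Longrightarrow> smooth_term (iter_deriv es f)"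
proof (induction es)
  case (Cons e es)
  then have "smooth_term (iter_deriv es f)" by simp
  then obtain f' where f': "\<And>x. (iter_deriv es f has_derivative f' x) (at x)" "\<And>e. smooth_term (\<lambda>x. f' x e)"
    by (rule smooth_term_has_derivative) blast
  have "frechet_derivative (iter_deriv es f) (at x) = f' x" for x
    using f'(1) frechet_derivative_at by metis
  then show ?case using f'(2) by simp
qed simp

lemma smooth_term_imp_smooth: "smooth_term f \<Longrightarrow> smooth f"
  unfolding smooth_def
  by (auto intro!: differentiable_at_imp_differentiable_on smooth_term_differentiable smooth_term_iter_deriv)

lemma smooth_term_continuous: "smooth_term f \<Longrightarrow> continuous_on S f"
  by (meson continuous_at_imp_continuous_on differentiable_imp_continuous_within smooth_term_differentiable)

lemma smooth_term_prod:
  "(\<And>i. i \<in> I \<Longrightarrow> smooth_term (f i)) \<Longrightarrow> smooth_term (\<lambda>x. \<Prod>i\<in>I. f i x)"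
  by (induction I rule: infinite_finite_induct) (auto intro: smooth_term.intros)

text \<open>A smooth term is Frechet differentiable, so its derivative in direction \<open>e\<close>
  can be read off from a function of one real variable, without computing a gradient.\<close>

lemma iter_deriv_1_eq:
  assumes "smooth_term f" "((\<lambda>s. f (x + s *\<^sub>R e)) has_real_derivative D) (at 0)"
  shows "iter_deriv [e] f x = D"
proof -
  obtain f' where f': "(f has_derivative f') (at x)"
    using assms(1) by (meson smooth_term_has_derivative)
  have "((\<lambda>s. f (x + s *\<^sub>R e)) has_derivative (\<lambda>s. f' (s *\<^sub>R e))) (at 0)"
  proof -
    have "((\<lambda>s. x + s *\<^sub>R e) has_derivative (\<lambda>s. s *\<^sub>R e)) (at 0)" by (auto intro!: derivative_eq_intros)
    from has_derivative_compose[OF this, of f f'] f' show ?thesis by simp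
  qed
  then have "(\<lambda>s. f' (s *\<^sub>R e)) = (\<lambda>s. D * s)"
    using assms(2) unfolding has_field_derivative_def by (rule has_derivative_unique)
  from fun_cong[OF this, of 1] have "f' e = D" by simp
  then show ?thesis using frechet_derivative_at[OF f'] by simp
qed

lemma iter_deriv_1_mult:
  assumes "smooth_term f" "smooth_term g"
  shows "iter_deriv [e] (\<lambda>x. f x * g x) x = iter_deriv [e] f x * g x + f x * iter_deriv [e] g x"
proof -
  obtain f' where f': "(f has_derivative f') (at x)"
    using assms(1) by (meson smooth_term_has_derivative)
  obtain g' where g': "(g has_derivative g') (at x)"
    using assms(2) by (meson smooth_term_has_derivative)
  have "((\<lambda>x. f x * g x) has_derivative (\<lambda>h. f x * g' h + f' h * g x)) (at x)"
    by (rule has_derivative_mult[OF f' g'])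
  from fun_cong[OF frechet_derivative_at[OF this], of e] frechet_derivative_at[OF f'] frechet_derivative_at[OF g']
  show ?thesis by simp
qed

text \<open>\<open>sigp 1\<close> is the function \<open>exp (-1/y)\<close> extended by zero; the polynomial factor in \<open>1/y\<close> is what
  differentiation produces.\<close>

definition sigp :: "real poly \<Rightarrow> real \<Rightarrow> real" where
  "sigp p y = (if 0 < y then poly p (1 / y) * exp (- (1 / y)) else 0)"

lemma poly_exp_tendsto_0: "((\<lambda>v. poly p v * exp (- v)) \<longlongrightarrow> (0::real)) at_top"
proof -
  have "((\<lambda>v. \<Sum>i\<le>degree p. coeff p i * (v ^ i / exp v)) \<longlongrightarrow> (\<Sum>i\<le>degree p. coeff p i * 0)) at_top"
    by (intro tendsto_intros tendsto_power_div_exp_0)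
  then show ?thesis
    by (simp add: poly_altdef exp_minus sum_distrib_right divide_inverse mult.assoc)
qed

lemma sigp_tendsto_0: "(sigp p \<longlongrightarrow> 0) (at 0)"
proof -
  have "((\<lambda>y. poly p (1 / y) * exp (- (1 / y))) \<longlongrightarrow> 0) (at_right (0::real))"
    using poly_exp_tendsto_0[of p] filterlim_inverse_at_top_right
    by (auto intro: filterlim_compose simp: divide_inverse)
  then have "(sigp p \<longlongrightarrow> 0) (at_right 0)"
    by (rule Lim_transform_eventually) (auto simp: sigp_def eventually_at_right_less eventually_at_filter)
  moreover have "(sigp p \<longlongrightarrow> 0) (at_left 0)"
    by (rule Lim_transform_eventually[OF tendsto_const]) (auto simp: sigp_def eventually_at_filter)
  ultimately show ?thesis by (simp add: filterlim_split_at)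
qed

text \<open>With v = 1/y one has dv/dy = -v^2, hence p(v) exp(-v) has derivative v^2 (p(v) - p'(v))
  exp(-v), and \<open>[:0, 0, 1:]\<close> is v^2. At the origin the difference quotient is
  \<open>sigp\<close> of v p(v), which tends to zero.\<close>

lemma sigp_deriv:
  "(sigp p has_real_derivative sigp ([:0, 0, 1:] * (p - pderiv p)) y) (at y)"
proof -
  consider "y > 0" | "y = 0" | "y < 0" by linarith
  then show ?thesis
  proof cases
    case 1
    have "((\<lambda>y. poly p (1 / y) * exp (- (1 / y))) has_real_derivative
       sigp ([:0, 0, 1:] * (p - pderiv p)) y) (at y)"
      using 1 by (auto intro!: derivative_eq_intros simp: sigp_def field_simps power2_eq_square)
    then show ?thesis
      by (rule has_field_derivative_transform_within_open[of _ _ _ "{0<..}"]) (auto simp: sigp_def 1)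
  next
    case 3
    have "((\<lambda>y. 0) has_real_derivative sigp ([:0, 0, 1:] * (p - pderiv p)) y) (at y)"
      using 3 by (auto simp: sigp_def)
    then show ?thesis
      by (rule has_field_derivative_transform_within_open[of _ _ _ "{..<0}"]) (auto simp: sigp_def 3)
  next
    case 2
    have "((\<lambda>h. sigp ([:0, 1:] * p) h) \<longlongrightarrow> 0) (at 0)" by (rule sigp_tendsto_0)
    then have "((\<lambda>h. (sigp p (0 + h) - sigp p 0) / h) \<longlongrightarrow> 0) (at 0)"
      by (rule Lim_transform_eventually) (auto simp: sigp_def eventually_at_filter field_simps)
    then show ?thesis using 2 by (simp add: DERIV_def sigp_def)
  qed
qed

text \<open>The explicit forms of \<open>sigp 1\<close> and of its derivative serve the estimates;
  smoothness is inherited from \<open>sigp\<close>.\<close>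

definition sig :: "real \<Rightarrow> real" where "sig y = (if 0 < y then exp (- (1 / y)) else 0)"
definition sig' :: "real \<Rightarrow> real" where "sig' y = (if 0 < y then exp (- (1 / y)) / y\<^sup>2 else 0)"

lemma sig_sigp: "sig = sigp 1" and sig'_sigp: "sig' = sigp [:0, 0, 1:]"
  by (auto simp: sig_def sig'_def sigp_def fun_eq_iff power2_eq_square field_simps)

lemma sig_deriv: "(sig has_real_derivative sig' y) (at y)"
  using sigp_deriv[of 1 y] by (simp add: sig_sigp sig'_sigp)

lemma sig_nonneg [simp]: "0 \<le> sig y" and sig_le_1 [simp]: "sig y \<le> 1"
  and sig'_nonneg [simp]: "0 \<le> sig' y"
  by (auto simp: sig_def sig'_def)

lemma sig_eq_0: "y \<le> 0 \<Longrightarrow> sig y = 0" and sig'_eq_0: "y \<le> 0 \<Longrightarrow> sig' y = 0"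
  by (auto simp: sig_def sig'_def)

lemma sig'_bound: "sig' y \<le> 1 / y\<^sup>2"
  by (auto simp: sig'_def divide_simps)

text \<open>With v = 1/y the left side is (v + v^2) exp(-v), and exp v dominates 1 + v + v^2/2. The
  factor y + 1 is chosen for the argument n y - 1 of the kernels, where it becomes n y.\<close>

lemma sig'_bound2: "(y + 1) * sig' y \<le> 2"
proof (cases "0 < y")
  case True
  define v where "v = 1 / y"
  have v: "v > 0" using True by (simp add: v_def)
  have "1 + v + v\<^sup>2 / 2 \<le> exp v" using exp_lower_Taylor_quadratic v by simp
  then have "v + v\<^sup>2 \<le> 2 * exp v" using v by (auto simp: power2_eq_square)
  then have "(v + v\<^sup>2) * exp (- v) \<le> 2"
    by (simp add: exp_minus field_simps)
  moreover have "(y + 1) * sig' y = (v + v\<^sup>2) * exp (- v)"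
    using True by (simp add: sig'_def v_def field_simps power2_eq_square)
  ultimately show ?thesis by simp
qed (simp add: sig'_def)

lemma continuous_on_sig: "continuous_on S sig" and continuous_on_sig': "continuous_on S sig'"
  by (metis DERIV_isCont continuous_at_imp_continuous_on sig_deriv,
      metis DERIV_isCont continuous_at_imp_continuous_on sigp_deriv sig'_sigp)

lemma sig_measurable [measurable]: "sig \<in> borel_measurable borel"
  and sig'_measurable [measurable]: "sig' \<in> borel_measurable borel"
  by (auto intro: borel_measurable_continuous_onI continuous_on_sig continuous_on_sig')

lemma sig_tendsto_1: "(sig \<longlongrightarrow> 1) at_top"
proof -
  have "((\<lambda>y. exp (- (1 / y))) \<longlongrightarrow> exp (- 0)) (at_top :: real filter)"
    by (intro tendsto_intros tendsto_divide_0[OF tendsto_const]) (simp add: filterlim_at_top_imp_at_infinity filterlim_ident)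
  then show ?thesis
    by (rule Lim_transform_eventually[THEN tendsto_eq_rhs])
      (auto simp: sig_def intro: eventually_mono[OF eventually_gt_at_top[of 0]])
qed

lemma smooth_term_affine:
  assumes "\<And>n y. (F n has_real_derivative F (Suc n) y) (at y)"
  shows "smooth_term (\<lambda>x. F (0::nat) (k * (x \<bullet> b) + m))"
proof -
  have "smooth_term (\<lambda>x. (\<lambda>n y. k ^ n * F n (k * y + m)) 0 (x \<bullet> b))"
  proof (rule smooth_term.atom)
    fix n y
    have "((\<lambda>y. F n (k * y + m)) has_real_derivative F (Suc n) (k * y + m) * k) (at y)"
      by (rule DERIV_chain2[OF assms]) (auto intro!: derivative_eq_intros)
    from DERIV_cmult[OF this, of "k ^ n"]
    show "((\<lambda>y. k ^ n * F n (k * y + m)) has_real_derivative k ^ Suc n * F (Suc n) (k * y + m)) (at y)"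
      by (simp add: mult_ac)
  qed
  then show ?thesis by simp
qed

lemma smooth_term_sig: "smooth_term (\<lambda>x. sig (k * (x \<bullet> b) + m))"
proof -
  \<comment> \<open>Iterating p -> v^2 (p - p') from the constant 1 lists the polynomials of all
    derivatives of \<open>sig\<close>.\<close>
  have "smooth_term (\<lambda>x. (\<lambda>n. sigp (((\<lambda>p. [:0, 0, 1:] * (p - pderiv p)) ^^ n) 1)) 0 (k * (x \<bullet> b) + m))"
    by (rule smooth_term_affine) (simp del: mult_pCons_left, rule sigp_deriv)
  then show ?thesis by (simp add: sig_sigp)
qed

text \<open>The shift by 1 makes the cutoff vanish within distance 1/n of both ends, so that
  products of such functions have compact support in the open box, while pointwise inside the
  interval the values still tend to 1.\<close>

definition cut :: "nat \<Rightarrow> real \<Rightarrow> real \<Rightarrow> real \<Rightarrow> real" where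
  "cut n c d x = sig (real n * (x - c) - 1) * sig (real n * (d - x) - 1)"

definition boxcut :: "nat \<Rightarrow> 'a::euclidean_space \<Rightarrow> 'a \<Rightarrow> 'a \<Rightarrow> real" where
  "boxcut n c d x = (\<Prod>e\<in>Basis. cut n (c \<bullet> e) (d \<bullet> e) (x \<bullet> e))"

lemma cut_nonneg [simp]: "0 \<le> cut n c d x" and cut_le_1 [simp]: "cut n c d x \<le> 1"
  by (auto simp: cut_def mult_le_one)

lemma boxcut_nonneg [simp]: "0 \<le> boxcut n c d x" and boxcut_le_1 [simp]: "boxcut n c d x \<le> 1"
  by (auto simp: boxcut_def intro: prod_nonneg prod_le_1)

lemma smooth_term_cut: "smooth_term (\<lambda>x. cut n c d (x \<bullet> b))"
proof -
  have "smooth_term (\<lambda>x. sig (real n * (x \<bullet> b) + (- real n * c - 1)) * sig (- real n * (x \<bullet> b) + (real n * d - 1)))"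
    by (intro smooth_term.mult smooth_term_sig)
  then show ?thesis by (simp add: cut_def algebra_simps)
qed

lemma smooth_term_boxcut: "smooth_term (boxcut n c d)"
  unfolding boxcut_def[abs_def] by (intro smooth_term_prod smooth_term_cut)

lemma sig_scaled_tendsto:
  assumes "y > 0" shows "(\<lambda>n. sig (real n * y - 1)) \<longlonglongrightarrow> 1"
proof -
  have "filterlim (\<lambda>n. y * real n) at_top sequentially"
    by (rule filterlim_tendsto_pos_mult_at_top[OF tendsto_const assms filterlim_real_sequentially])
  then have "filterlim (\<lambda>n. - 1 + y * real n) at_top sequentially"
    by (rule filterlim_tendsto_add_at_top[OF tendsto_const])
  from filterlim_compose[OF sig_tendsto_1 this] show ?thesis by (simp add: mult.commute)
qed

lemma boxcut_tendsto:
  assumes "x \<in> box c d" shows "(\<lambda>n. boxcut n c d x) \<longlonglongrightarrow> 1"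
proof -
  have "(\<lambda>n. boxcut n c d x) \<longlonglongrightarrow> (\<Prod>e\<in>(Basis::'a set). 1 * 1)"
    unfolding boxcut_def cut_def using assms
    by (intro tendsto_prod tendsto_mult sig_scaled_tendsto) (auto simp: mem_box)
  then show ?thesis by simp
qed

lemma boxcut_support:
  assumes "0 < n" "x \<notin> cbox (c + (1 / real n) *\<^sub>R One) (d - (1 / real n) *\<^sub>R One)"
  shows "boxcut n c d x = 0"
proof -
  obtain e where e: "e \<in> Basis" "x \<bullet> e < c \<bullet> e + 1 / n \<or> x \<bullet> e > d \<bullet> e - 1 / n"
    using assms(2) by (auto simp: mem_box inner_simps not_le)
  then have "real n * (x \<bullet> e - c \<bullet> e) - 1 \<le> 0 \<or> real n * (d \<bullet> e - x \<bullet> e) - 1 \<le> 0"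
    using assms(1) by (auto simp: field_simps)
  then have "cut n (c \<bullet> e) (d \<bullet> e) (x \<bullet> e) = 0" by (auto simp: cut_def sig_eq_0)
  then show ?thesis using e by (auto simp: boxcut_def)
qed

lemma boxcut_test_function:
  assumes "0 < n" "smooth_term h" "box c d \<subseteq> \<Omega>"
  shows "test_function \<Omega> (\<lambda>x. h x * boxcut n c d x)"
proof -
  let ?K = "cbox (c + (1 / real n) *\<^sub>R One) (d - (1 / real n) *\<^sub>R One)"
  have "x \<in> box c d" if "x \<in> ?K" for x
  proof -
    have "0 < 1 / real n" using assms by simp
    moreover have "c \<bullet> i + 1 / real n \<le> x \<bullet> i \<and> x \<bullet> i \<le> d \<bullet> i - 1 / real n" if "i \<in> Basis" for i
      using \<open>x \<in> ?K\<close> that unfolding mem_box by (auto simp: inner_simps)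
    ultimately show ?thesis unfolding mem_box by (smt (verit))
  qed
  then have "compact ?K \<and> ?K \<subseteq> \<Omega>" using assms by auto
  then show ?thesis
    unfolding test_function_def
    by (intro conjI smooth_term_imp_smooth smooth_term.mult smooth_term_boxcut assms exI[of _ ?K])
      (use assms in \<open>auto simp: boxcut_support\<close>)
qed

definition othercut :: "'a::euclidean_space \<Rightarrow> nat \<Rightarrow> 'a \<Rightarrow> 'a \<Rightarrow> 'a \<Rightarrow> real" where
  "othercut e n c d x = (\<Prod>b\<in>Basis - {e}. cut n (c \<bullet> b) (d \<bullet> b) (x \<bullet> b))"

text \<open>The part of the derivative of the box cutoff along \<open>e\<close> that comes from the
  lower face, with its sign removed in \<open>upcut\<close> for the upper face. Integrating against
  these kernels and letting n grow replaces the trace on the face.\<close>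

definition locut :: "'a::euclidean_space \<Rightarrow> nat \<Rightarrow> 'a \<Rightarrow> 'a \<Rightarrow> 'a \<Rightarrow> real" where
  "locut e n c d x = real n * sig' (real n * (x \<bullet> e - c \<bullet> e) - 1)
     * (sig (real n * (d \<bullet> e - x \<bullet> e) - 1) * othercut e n c d x)"

definition upcut :: "'a::euclidean_space \<Rightarrow> nat \<Rightarrow> 'a \<Rightarrow> 'a \<Rightarrow> 'a \<Rightarrow> real" where
  "upcut e n c d x = real n * sig' (real n * (d \<bullet> e - x \<bullet> e) - 1)
     * (sig (real n * (x \<bullet> e - c \<bullet> e) - 1) * othercut e n c d x)"

lemma othercut_nonneg [simp]: "0 \<le> othercut e n c d x" and othercut_le_1 [simp]: "othercut e n c d x \<le> 1"
  by (auto simp: othercut_def intro: prod_nonneg prod_le_1)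

lemma locut_nonneg [simp]: "0 \<le> locut e n c d x" and upcut_nonneg [simp]: "0 \<le> upcut e n c d x"
  by (auto simp: locut_def upcut_def)

lemma locut_le: "locut e n c d x \<le> real n * sig' (real n * (x \<bullet> e - c \<bullet> e) - 1)"
  and upcut_le: "upcut e n c d x \<le> real n * sig' (real n * (d \<bullet> e - x \<bullet> e) - 1)"
  unfolding locut_def upcut_def by (simp_all add: mult_left_le mult_le_one)

lemma boxcut_deriv:
  assumes e: "e \<in> Basis"
  shows "iter_deriv [e] (boxcut n c d) x = locut e n c d x - upcut e n c d x"
proof (rule iter_deriv_1_eq[OF smooth_term_boxcut])
  have eq: "boxcut n c d (x + s *\<^sub>R e) = cut n (c \<bullet> e) (d \<bullet> e) (x \<bullet> e + s) * othercut e n c d x" for s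
  proof -
    have "boxcut n c d (x + s *\<^sub>R e) = cut n (c \<bullet> e) (d \<bullet> e) ((x + s *\<^sub>R e) \<bullet> e)
       * (\<Prod>b\<in>Basis - {e}. cut n (c \<bullet> b) (d \<bullet> b) ((x + s *\<^sub>R e) \<bullet> b))"
      unfolding boxcut_def using e by (simp add: prod.remove[of Basis e])
    also have "(\<Prod>b\<in>Basis - {e}. cut n (c \<bullet> b) (d \<bullet> b) ((x + s *\<^sub>R e) \<bullet> b)) = othercut e n c d x"
      unfolding othercut_def using e by (intro prod.cong) (auto simp: inner_simps inner_Basis)
    finally show ?thesis using e by (simp add: inner_simps)
  qed
  have d1: "((\<lambda>s. sig (real n * (x \<bullet> e + s - c \<bullet> e) - 1)) has_real_derivative
      sig' (real n * (x \<bullet> e + 0 - c \<bullet> e) - 1) * real n) (at 0)"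
    by (rule DERIV_chain2[OF sig_deriv]) (auto intro!: derivative_eq_intros)
  have d2: "((\<lambda>s. sig (real n * (d \<bullet> e - (x \<bullet> e + s)) - 1)) has_real_derivative
      sig' (real n * (d \<bullet> e - (x \<bullet> e + 0)) - 1) * - real n) (at 0)"
    by (rule DERIV_chain2[OF sig_deriv]) (auto intro!: derivative_eq_intros)
  show "((\<lambda>s. boxcut n c d (x + s *\<^sub>R e)) has_real_derivative locut e n c d x - upcut e n c d x) (at 0)"
    unfolding eq cut_def locut_def upcut_def
    by (rule DERIV_cong[OF DERIV_cmult_right[OF DERIV_mult[OF d1 d2]]])
      (simp only: add_0_right ring_distribs mult_ac mult_minus_left mult_minus_right diff_conv_add_uminus)
qed

section \<open>Square-integrable functions and weak derivatives on bounded open sets\<close>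

lemma abs_mult_le_squares: "\<bar>a * b :: real\<bar> \<le> a\<^sup>2 + b\<^sup>2"
proof -
  have "2 * \<bar>a\<bar> * \<bar>b\<bar> \<le> \<bar>a\<bar>\<^sup>2 + \<bar>b\<bar>\<^sup>2" by (rule sum_squares_bound)
  moreover have "0 \<le> \<bar>a\<bar> * \<bar>b\<bar>" by simp
  ultimately show ?thesis unfolding abs_mult by (simp only: power2_abs)
qed

lemma boxcut_eq_0:
  assumes "x \<notin> box c d" shows "boxcut n c d x = 0"
proof -
  obtain e where e: "e \<in> Basis" "x \<bullet> e - c \<bullet> e \<le> 0 \<or> d \<bullet> e - x \<bullet> e \<le> 0"
    using assms by (force simp: mem_box)
  from e(2) have "sig (real n * (x \<bullet> e - c \<bullet> e) - 1) = 0 \<or> sig (real n * (d \<bullet> e - x \<bullet> e) - 1) = 0"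
  proof
    assume "x \<bullet> e - c \<bullet> e \<le> 0"
    from mult_nonneg_nonpos[OF of_nat_0_le_iff this, of n] show ?thesis by (simp add: sig_eq_0)
  next
    assume "d \<bullet> e - x \<bullet> e \<le> 0"
    from mult_nonneg_nonpos[OF of_nat_0_le_iff this, of n] show ?thesis by (simp add: sig_eq_0)
  qed
  then have "cut n (c \<bullet> e) (d \<bullet> e) (x \<bullet> e) = 0" by (auto simp: cut_def)
  then show ?thesis using e(1) by (auto simp: boxcut_def)
qed

lemma has_weak_derivD:
  "has_weak_deriv \<Omega> es f g \<Longrightarrow> test_function \<Omega> \<eta> \<Longrightarrow>
    (LINT x|lebesgue_on \<Omega>. f x * iter_deriv es \<eta> x) = (-1) ^ length es * (LINT x|lebesgue_on \<Omega>. g x * \<eta> x)"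
  by (simp add: has_weak_deriv_def)

section \<open>Integrability and square integrability on a bounded open set\<close>

locale bounded_domain =
  fixes \<Omega> :: "'a::euclidean_space set"
  assumes open_domain: "open \<Omega>" and bounded_domain: "bounded \<Omega>"
begin

abbreviation "M \<equiv> lebesgue_on \<Omega>"

lemma domain_sets [simp, measurable]: "\<Omega> \<in> sets lebesgue"
  using open_domain by auto

lemma domain_lmeasurable: "\<Omega> \<in> lmeasurable"
  using bounded_domain open_domain by (simp add: lmeasurable_open)

sublocale finite_measure M
  by (rule finite_measure_lebesgue_on[OF domain_lmeasurable])

lemma borel_on: "f \<in> borel_measurable borel \<Longrightarrow> f \<in> borel_measurable M"
  by (intro measurable_restrict_space1 measurable_completion) simp

lemma continuous_on_borel: "continuous_on UNIV f \<Longrightarrow> f \<in> borel_measurable M"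
  for f :: "'a \<Rightarrow> real"
  by (intro borel_on borel_measurable_continuous_onI)

lemma integrable_mult_bounded:
  assumes "integrable M f" "h \<in> borel_measurable M" "\<And>x. x \<in> \<Omega> \<Longrightarrow> \<bar>h x\<bar> \<le> B"
  shows "integrable M (\<lambda>x. f x * h x :: real)"
proof (rule Bochner_Integration.integrable_bound[of _ "\<lambda>x. B * f x"])
  show "AE x in M. norm (f x * h x) \<le> norm (B * f x)"
  proof (rule AE_I2)
    fix x assume "x \<in> space M"
    then have "\<bar>h x\<bar> \<le> \<bar>B\<bar>" using assms(3)[of x] by auto
    then show "norm (f x * h x) \<le> norm (B * f x)"
      using mult_right_mono[of "\<bar>h x\<bar>" "\<bar>B\<bar>" "\<bar>f x\<bar>"] by (simp add: abs_mult mult.commute)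
  qed
qed (use assms in \<open>auto intro!: borel_measurable_times dest: borel_measurable_integrable\<close>)

lemma integrable_bounded:
  assumes "h \<in> borel_measurable M" "\<And>x. x \<in> \<Omega> \<Longrightarrow> \<bar>h x\<bar> \<le> B"
  shows "integrable M (h :: 'a \<Rightarrow> real)"
  using integrable_mult_bounded[of "\<lambda>x. 1", OF _ assms] by simp

lemma continuous_bounded:
  assumes "continuous_on (closure \<Omega>) (f :: 'a \<Rightarrow> real)"
  obtains B where "B > 0" "\<And>x. x \<in> closure \<Omega> \<Longrightarrow> \<bar>f x\<bar> \<le> B"
proof -
  have "compact (f ` closure \<Omega>)"
    using bounded_domain assms by (simp add: compact_closure compact_continuous_image)
  then obtain B where "B > 0" "\<forall>y\<in>f ` closure \<Omega>. norm y \<le> B"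
    using bounded_pos compact_imp_bounded by blast
  then show thesis by (intro that[of B]) auto
qed

lemma L2_measurable: "f \<in> L2_space \<Omega> \<Longrightarrow> f \<in> borel_measurable M"
  and L2_square: "f \<in> L2_space \<Omega> \<Longrightarrow> integrable M (\<lambda>x. (f x)\<^sup>2)"
  by (auto simp: L2_space_def)

lemma L2_mult_integrable:
  assumes "f \<in> L2_space \<Omega>" "g \<in> L2_space \<Omega>"
  shows "integrable M (\<lambda>x. f x * g x)"
proof (rule Bochner_Integration.integrable_bound[of _ "\<lambda>x. (f x)\<^sup>2 + (g x)\<^sup>2"])
  show "AE x in M. norm (f x * g x) \<le> norm ((f x)\<^sup>2 + (g x)\<^sup>2)"
    using abs_mult_le_squares by (auto intro!: AE_I2)
qed (use assms in \<open>auto intro!: borel_measurable_times dest: L2_measurable L2_square\<close>)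

lemma L2_bounded:
  assumes "h \<in> borel_measurable M" "\<And>x. x \<in> \<Omega> \<Longrightarrow> \<bar>h x\<bar> \<le> B"
  shows "h \<in> L2_space \<Omega>"
  unfolding L2_space_def
proof safe
  show "integrable M (\<lambda>x. (h x)\<^sup>2)"
  proof (rule integrable_bounded)
    show "\<bar>(h x)\<^sup>2\<bar> \<le> B\<^sup>2" if "x \<in> \<Omega>" for x
      using power_mono[OF assms(2)[OF that], of 2] by simp
  qed (use assms in measurable)
qed (rule assms)

lemma L2_integrable: "f \<in> L2_space \<Omega> \<Longrightarrow> integrable M f"
  using L2_mult_integrable[of f "\<lambda>x. 1"] L2_bounded[of "\<lambda>x. 1" 1] by simp

lemma L2_lincomb:
  assumes "f \<in> L2_space \<Omega>" "g \<in> L2_space \<Omega>"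
  shows "(\<lambda>x. a * f x + b * g x) \<in> L2_space \<Omega>"
  unfolding L2_space_def
proof safe
  have "integrable M (\<lambda>x. a\<^sup>2 * (f x)\<^sup>2 + 2 * a * b * (f x * g x) + b\<^sup>2 * (g x)\<^sup>2)"
    using assms by (intro Bochner_Integration.integrable_add integrable_mult_right L2_square L2_mult_integrable)
  then show "integrable M (\<lambda>x. (a * f x + b * g x)\<^sup>2)"
    by (simp add: power2_sum power_mult_distrib algebra_simps)
qed (use assms in \<open>auto intro!: borel_measurable_add borel_measurable_times dest: L2_measurable\<close>)

lemma L2_cong_AE:
  assumes "f \<in> L2_space \<Omega>" "g \<in> borel_measurable M" "AE x in M. f x = g x"
  shows "g \<in> L2_space \<Omega>"
  unfolding L2_space_def
proof safe
  show "integrable M (\<lambda>x. (g x)\<^sup>2)"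
    proof (rule integrable_cong_AE_imp[OF L2_square[OF assms(1)]])
    show "AE x in M. (f x)\<^sup>2 = (g x)\<^sup>2" using assms(3) by eventually_elim simp
  qed (use assms(2) in measurable)
qed (rule assms)

lemma integrable_locally: "integrable M f \<Longrightarrow> locally_integrable \<Omega> f"
  unfolding locally_integrable_def
proof safe
  fix K assume f: "integrable M f" and K: "compact K" "K \<subseteq> \<Omega>"
  have [simp]: "K \<in> sets lebesgue" using K by (simp add: compact_imp_closed borel_closed)
  have "integrable lebesgue (\<lambda>x. indicat_real \<Omega> x *\<^sub>R f x)"
    using f by (simp add: integrable_restrict_space)
  from integrable_mult_indicator[OF _ this, of K]
  have "integrable lebesgue (\<lambda>x. indicat_real K x *\<^sub>R indicat_real \<Omega> x *\<^sub>R f x)" by simp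
  also have "(\<lambda>x. indicat_real K x *\<^sub>R indicat_real \<Omega> x *\<^sub>R f x) = (\<lambda>x. indicat_real K x *\<^sub>R f x)"
    using K by (auto simp: indicator_def fun_eq_iff of_bool_def)
  finally show "integrable (lebesgue_on K) f"
    by (simp add: integrable_restrict_space)
qed

section \<open>Test functions and uniqueness of weak derivatives\<close>

lemma test_function_continuous:
  assumes "test_function \<Omega> \<eta>" "set es \<subseteq> Basis"
  shows "continuous_on S (iter_deriv es \<eta>)"
  using assms unfolding test_function_def smooth_def
  by (meson continuous_on_subset differentiable_imp_continuous_on subset_UNIV)

lemma integrable_mult_test:
  assumes "test_function \<Omega> \<eta>" "set es \<subseteq> Basis" "integrable M f"
  shows "integrable M (\<lambda>x. f x * iter_deriv es \<eta> x)"
proof -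
  obtain B where "\<And>x. x \<in> closure \<Omega> \<Longrightarrow> \<bar>iter_deriv es \<eta> x\<bar> \<le> B"
    using continuous_bounded[OF test_function_continuous[OF assms(1,2)]] by blast
  moreover have "iter_deriv es \<eta> \<in> borel_measurable M"
    by (rule continuous_on_borel[OF test_function_continuous[OF assms(1,2)]])
  ultimately show ?thesis
    using assms closure_subset[of \<Omega>] by (intro integrable_mult_bounded[of _ _ B]) auto
qed

text \<open>As n grows the cutoffs become indicators of open boxes, so \<open>f\<close> has integral
  zero over every closed box in the domain, and Lebesgue differentiation over shrinking cubes gives
  \<open>f = 0\<close>. Testing with plain cutoffs only is what \<open>vertical_bound\<close> can
  afford: there the integrals are computed for these.\<close>

lemma AE_zero_of_boxcut:
  assumes f: "integrable M f"
    and zero: "\<And>c d n. cbox c d \<subseteq> \<Omega> \<Longrightarrow> 0 < n \<Longrightarrow> (LINT x|M. f x * boxcut n c d x) = 0"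
  shows "AE x in M. f x = 0"
proof -
  \<comment> \<open>Extension by zero, so that the differentiation theorem can be applied on the
    whole space.\<close>
  define f0 where "f0 x = (if x \<in> \<Omega> then f x else 0)" for x
  have f0: "integrable lebesgue f0"
    unfolding f0_def by (rule Lebesgue_Measure.integrable_restrict_UNIV[OF domain_sets, THEN iffD2, OF f])
  have int0: "integral (cbox c d) f0 = 0" if cd: "cbox c d \<subseteq> \<Omega>" for c d
  proof -
    have "(\<lambda>n. LINT x|M. f x * boxcut (Suc n) c d x) \<longlonglongrightarrow> (LINT x|M. f x * indicat_real (box c d) x)"
    proof (rule integral_dominated_convergence[where w = "\<lambda>x. \<bar>f x\<bar>"])
      show "AE x in M. (\<lambda>n. f x * boxcut (Suc n) c d x) \<longlonglongrightarrow> f x * indicat_real (box c d) x"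
      proof (rule AE_I2, rule tendsto_mult_left)
        fix x
        show "(\<lambda>n. boxcut (Suc n) c d x) \<longlonglongrightarrow> indicat_real (box c d) x"
        proof (cases "x \<in> box c d")
          case True then show ?thesis using LIMSEQ_Suc[OF boxcut_tendsto] by simp
        next
          case False
          then have "boxcut n c d x = 0" for n by (rule boxcut_eq_0)
          then show ?thesis using False by simp
        qed
      qed
      show "AE x in M. norm (f x * boxcut (Suc n) c d x) \<le> \<bar>f x\<bar>" for n
        by (auto simp: abs_mult intro!: mult_left_le)
      have "boxcut (Suc n) c d \<in> borel_measurable M" for n
        by (rule continuous_on_borel[OF smooth_term_continuous[OF smooth_term_boxcut]])
      then show "(\<lambda>x. f x * boxcut (Suc n) c d x) \<in> borel_measurable M" for n
        using f by measurable
      show "(\<lambda>x. f x * indicat_real (box c d) x) \<in> borel_measurable M"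
        by (rule borel_measurable_times[OF borel_measurable_integrable[OF f] borel_on]) simp
    qed (use f in auto)
    moreover have "(LINT x|M. f x * boxcut (Suc n) c d x) = 0" for n
      by (rule zero[OF cd]) simp
    ultimately have "(LINT x|M. f x * indicat_real (box c d) x) = 0"
      by (simp add: LIMSEQ_const_iff)
    also have "(LINT x|M. f x * indicat_real (box c d) x) = (LINT x|M. (if x \<in> box c d then f x else 0))"
      by (intro Bochner_Integration.integral_cong) auto
    also have "\<dots> = (LINT x|lebesgue_on (box c d). f x)"
      using cd box_subset_cbox by (subst Lebesgue_Measure.integral_restrict) auto
    also have "\<dots> = (LINT x|lebesgue_on (box c d). f0 x)"
      using cd box_subset_cbox by (intro Bochner_Integration.integral_cong) (auto simp: f0_def)
    also have "\<dots> = integral (box c d) f0"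
      using f0 by (intro lebesgue_integral_eq_integral integrable_restrict_space[THEN iffD2] integrable_mult_indicator) auto
    finally show ?thesis by (simp add: integral_open_interval)
  qed
  have "f0 integrable_on cbox c d" for c d
    using f0 integrable_on_lebesgue integrable_on_subcbox by (metis subset_UNIV)
  then obtain N where N: "negligible N"
    "\<And>x e. \<lbrakk>x \<notin> N; 0 < e\<rbrakk> \<Longrightarrow> \<exists>d>0. \<forall>h. 0 < h \<and> h < d \<longrightarrow>
        norm (integral (cbox x (x + h *\<^sub>R One)) f0 /\<^sub>R h ^ DIM('a) - f0 x) < e"
    by (rule integrable_ccontinuous_explicit) blast
  have "f x = 0" if x: "x \<in> \<Omega>" "x \<notin> N" for x
  proof -
    obtain r where r: "r > 0" "ball x r \<subseteq> \<Omega>" using open_domain x openE by blast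
    have "norm (f0 x) < e" if "e > 0" for e
    proof -
      obtain d where d: "d > 0" "\<And>h. 0 < h \<Longrightarrow> h < d \<Longrightarrow>
        norm (integral (cbox x (x + h *\<^sub>R One)) f0 /\<^sub>R h ^ DIM('a) - f0 x) < e"
        using N(2)[OF x(2) \<open>e > 0\<close>] by blast
      \<comment> \<open>The side is small enough for the differentiation estimate and, through the
        l1 bound of the norm, for the cube to stay inside the ball of radius
        \<open>r\<close>.\<close>
      define h where "h = min (d / 2) (r / (2 * DIM('a)))"
      have h: "0 < h" "h < d" "h * DIM('a) < r"
        using d(1) r(1) by (auto simp: h_def min_def field_simps)
      have "cbox x (x + h *\<^sub>R One) \<subseteq> ball x r"
      proof
        fix y assume y: "y \<in> cbox x (x + h *\<^sub>R One)"
        have "norm (y - x) \<le> (\<Sum>b\<in>Basis. \<bar>(y - x) \<bullet> b\<bar>)" by (rule norm_le_l1)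
        also have "\<dots> \<le> (\<Sum>b\<in>(Basis::'a set). h)"
          using y by (intro sum_mono) (auto simp: mem_box inner_simps abs_le_iff algebra_simps)
        finally show "y \<in> ball x r" using h(3) by (simp add: dist_norm norm_minus_commute mult.commute)
      qed
      then have "integral (cbox x (x + h *\<^sub>R One)) f0 = 0" using r(2) by (intro int0) auto
      with d(2)[OF h(1,2)] show ?thesis by simp
    qed
    then have "f0 x = 0" by (metis less_irrefl zero_less_norm_iff)
    then show ?thesis using x by (simp add: f0_def)
  qed
  then have "{x \<in> \<Omega>. f x \<noteq> 0} \<subseteq> N" by blast
  then have "negligible {x \<in> \<Omega>. f x \<noteq> 0}" using N(1) negligible_subset by blast
  then show ?thesis
    by (simp add: AE_restrict_space_iff eventually_ae_filter_negligible) blast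
qed

lemma AE_zero_of_test:
  assumes "integrable M f" and "\<And>\<eta>. test_function \<Omega> \<eta> \<Longrightarrow> (LINT x|M. f x * \<eta> x) = 0"
  shows "AE x in M. f x = 0"
proof (rule AE_zero_of_boxcut[OF assms(1)])
  fix c d :: 'a and n :: nat assume "cbox c d \<subseteq> \<Omega>" "0 < n"
  then have "box c d \<subseteq> \<Omega>" using box_subset_cbox by blast
  with boxcut_test_function[OF \<open>0 < n\<close> smooth_term.const[of 1], of c d \<Omega>]
  show "(LINT x|M. f x * boxcut n c d x) = 0" by (intro assms(2)) simp
qed

lemma weak_deriv_AE_unique:
  assumes "has_weak_deriv \<Omega> es f g" "has_weak_deriv \<Omega> es f g'" "integrable M g" "integrable M g'"
  shows "AE x in M. g x = g' x"
proof -
  have "AE x in M. g x - g' x = 0"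
  proof (rule AE_zero_of_test)
    fix \<eta> assume \<eta>: "test_function \<Omega> \<eta>"
    have "(-1) ^ length es * (LINT x|M. g x * \<eta> x) = (-1) ^ length es * (LINT x|M. g' x * \<eta> x)"
      by (simp only: has_weak_derivD[OF assms(1) \<eta>, symmetric] has_weak_derivD[OF assms(2) \<eta>, symmetric])
    then show "(LINT x|M. (g x - g' x) * \<eta> x) = 0"
      using integrable_mult_test[OF \<eta>, of "[]"] assms(3,4) by (simp add: left_diff_distrib)
  qed (use assms in simp)
  then show ?thesis by simp
qed

lemma has_weak_deriv_lincomb:
  assumes "has_weak_deriv \<Omega> es f g" "has_weak_deriv \<Omega> es f' g'"
    and "integrable M f" "integrable M g" "integrable M f'" "integrable M g'" "set es \<subseteq> Basis"
  shows "has_weak_deriv \<Omega> es (\<lambda>x. a * f x + b * f' x) (\<lambda>x. a * g x + b * g' x)"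
  unfolding has_weak_deriv_def
proof (intro conjI allI impI integrable_locally)
  fix \<eta> assume \<eta>: "test_function \<Omega> \<eta>"
  note int = integrable_mult_test[OF \<eta> assms(7)] integrable_mult_test[OF \<eta>, of "[]", simplified]
  have "(LINT x|M. (a * f x + b * f' x) * iter_deriv es \<eta> x)
    = a * (LINT x|M. f x * iter_deriv es \<eta> x) + b * (LINT x|M. f' x * iter_deriv es \<eta> x)"
    using int assms by (simp add: distrib_right mult.assoc)
  also have "\<dots> = a * ((-1) ^ length es * (LINT x|M. g x * \<eta> x)) + b * ((-1) ^ length es * (LINT x|M. g' x * \<eta> x))"
    by (simp only: has_weak_derivD[OF assms(1) \<eta>] has_weak_derivD[OF assms(2) \<eta>])
  also have "\<dots> = (-1) ^ length es * (LINT x|M. (a * g x + b * g' x) * \<eta> x)"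
  proof -
    have "(LINT x|M. (a * g x + b * g' x) * \<eta> x) = a * (LINT x|M. g x * \<eta> x) + b * (LINT x|M. g' x * \<eta> x)"
      using int assms by (simp add: distrib_right mult.assoc)
    then show ?thesis by (simp only: ring_distribs mult_ac)
  qed
  finally show "(LINT x|M. (a * f x + b * f' x) * iter_deriv es \<eta> x) = (-1) ^ length es * (LINT x|M. (a * g x + b * g' x) * \<eta> x)" .
qed (use assms in auto)

lemma has_weak_deriv_cong_AE:
  assumes "has_weak_deriv \<Omega> es f g" "integrable M f" "f' \<in> borel_measurable M" "AE x in M. f x = f' x" "set es \<subseteq> Basis"
  shows "has_weak_deriv \<Omega> es f' g"
proof -
  have f': "integrable M f'" by (rule integrable_cong_AE_imp[OF assms(2-4)])
  have "(LINT x|M. f' x * iter_deriv es \<eta> x) = (LINT x|M. f x * iter_deriv es \<eta> x)" if "test_function \<Omega> \<eta>" for \<eta>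
  proof (rule integral_cong_AE)
    show "AE x in M. f' x * iter_deriv es \<eta> x = f x * iter_deriv es \<eta> x"
      using assms(4) by eventually_elim simp
  qed (rule borel_measurable_integrable[OF integrable_mult_test[OF that assms(5)]], rule f' assms(2))+
  with assms(1) integrable_locally[OF f'] show ?thesis
    unfolding has_weak_deriv_def by simp
qed

section \<open>The chosen weak derivatives of Sobolev functions\<close>

lemma has_weak_deriv_Nil: "f \<in> L2_space \<Omega> \<Longrightarrow> has_weak_deriv \<Omega> [] f f"
  by (simp add: has_weak_deriv_def integrable_locally L2_integrable)

lemma sobolev_L2: "f \<in> sobolev k \<Omega> \<Longrightarrow> f \<in> L2_space \<Omega>"
  by (simp add: sobolev_def)

lemma weak_deriv_props:
  assumes "f \<in> sobolev k \<Omega>" "es \<in> derivs_upto k"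
  shows weak_deriv_L2: "weak_deriv \<Omega> es f \<in> L2_space \<Omega>"
    and weak_deriv_weak: "has_weak_deriv \<Omega> es f (weak_deriv \<Omega> es f)"
proof -
  have "\<exists>g. g \<in> L2_space \<Omega> \<and> has_weak_deriv \<Omega> es f g" using assms by (auto simp: sobolev_def)
  from someI_ex[OF this]
  show "weak_deriv \<Omega> es f \<in> L2_space \<Omega>" "has_weak_deriv \<Omega> es f (weak_deriv \<Omega> es f)"
    by (auto simp: weak_deriv_def)
qed

lemma weak_deriv_AE_eq:
  assumes "has_weak_deriv \<Omega> es f g" "g \<in> L2_space \<Omega>"
  shows "AE x in M. weak_deriv \<Omega> es f x = g x"
proof -
  have "\<exists>g. g \<in> L2_space \<Omega> \<and> has_weak_deriv \<Omega> es f g" using assms by blast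
  from someI_ex[OF this] show ?thesis
    using assms L2_integrable unfolding weak_deriv_def by (intro weak_deriv_AE_unique[of es f]) auto
qed

text \<open>\<open>weak_deriv\<close> is a choice among functions that agree almost everywhere, so
  its linearity is available only up to null sets.\<close>

lemma sobolev_lincomb:
  assumes f: "f \<in> sobolev k \<Omega>" and g: "g \<in> sobolev k \<Omega>"
  shows "(\<lambda>x. a * f x + b * g x) \<in> sobolev k \<Omega>"
    and "es \<in> derivs_upto k \<Longrightarrow>
      AE x in M. weak_deriv \<Omega> es (\<lambda>x. a * f x + b * g x) x = a * weak_deriv \<Omega> es f x + b * weak_deriv \<Omega> es g x"
proof -
  have *: "has_weak_deriv \<Omega> es (\<lambda>x. a * f x + b * g x) (\<lambda>x. a * weak_deriv \<Omega> es f x + b * weak_deriv \<Omega> es g x)"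
    "(\<lambda>x. a * weak_deriv \<Omega> es f x + b * weak_deriv \<Omega> es g x) \<in> L2_space \<Omega>"
    if es: "es \<in> derivs_upto k" for es
  proof -
    have "set es \<subseteq> Basis" using es by (simp add: derivs_upto_def)
    then show "has_weak_deriv \<Omega> es (\<lambda>x. a * f x + b * g x) (\<lambda>x. a * weak_deriv \<Omega> es f x + b * weak_deriv \<Omega> es g x)"
      by (intro has_weak_deriv_lincomb weak_deriv_weak[OF f es] weak_deriv_weak[OF g es] L2_integrable
          weak_deriv_L2[OF f es] weak_deriv_L2[OF g es] sobolev_L2[OF f] sobolev_L2[OF g])
    show "(\<lambda>x. a * weak_deriv \<Omega> es f x + b * weak_deriv \<Omega> es g x) \<in> L2_space \<Omega>"
      by (rule L2_lincomb[OF weak_deriv_L2[OF f es] weak_deriv_L2[OF g es]])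
  qed
  show "(\<lambda>x. a * f x + b * g x) \<in> sobolev k \<Omega>"
    using * L2_lincomb[OF sobolev_L2[OF f] sobolev_L2[OF g]] by (auto simp: sobolev_def)
  show "es \<in> derivs_upto k \<Longrightarrow>
      AE x in M. weak_deriv \<Omega> es (\<lambda>x. a * f x + b * g x) x = a * weak_deriv \<Omega> es f x + b * weak_deriv \<Omega> es g x"
    by (rule weak_deriv_AE_eq[OF *])
qed

lemma weak_deriv_cong_AE:
  assumes "f \<in> sobolev k \<Omega>" "f' \<in> L2_space \<Omega>" "AE x in M. f x = f' x" "es \<in> derivs_upto k"
  shows "AE x in M. weak_deriv \<Omega> es f' x = weak_deriv \<Omega> es f x"
proof (rule weak_deriv_AE_eq[OF has_weak_deriv_cong_AE])
  show "has_weak_deriv \<Omega> es f (weak_deriv \<Omega> es f)" "weak_deriv \<Omega> es f \<in> L2_space \<Omega>"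
    using assms by (auto intro: weak_deriv_weak weak_deriv_L2)
  show "integrable M f" "f' \<in> borel_measurable M" "set es \<subseteq> Basis"
    using assms sobolev_L2 L2_integrable L2_measurable by (auto simp: derivs_upto_def)
qed (rule assms)

lemma weak_deriv_Nil_AE: "f \<in> L2_space \<Omega> \<Longrightarrow> AE x in M. weak_deriv \<Omega> [] f x = f x"
  by (intro weak_deriv_AE_eq has_weak_deriv_Nil)

lemma finite_derivs_upto: "finite (derivs_upto k :: 'a list set)"
  unfolding derivs_upto_def by (rule finite_lists_length_le) simp

lemma weak_deriv_le_sobolev_norm:
  assumes "es \<in> derivs_upto k"
  shows "(LINT x|M. (weak_deriv \<Omega> es f x)\<^sup>2) \<le> (sobolev_norm k \<Omega> f)\<^sup>2"
proof -
  have "(LINT x|M. (weak_deriv \<Omega> es f x)\<^sup>2) \<le> (\<Sum>es\<in>derivs_upto k. LINT x|M. (weak_deriv \<Omega> es f x)\<^sup>2)"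
    by (rule member_le_sum[OF assms]) (auto simp: finite_derivs_upto)
  also have "\<dots> = (sobolev_norm k \<Omega> f)\<^sup>2"
    unfolding sobolev_norm_def by (subst real_sqrt_pow2) (auto intro: sum_nonneg)
  finally show ?thesis .
qed

lemma iter_deriv_append: "iter_deriv es (iter_deriv es' f) = iter_deriv (es @ es') f"
  by (induction es) simp_all

lemma test_function_iter_deriv:
  assumes "test_function \<Omega> \<eta>" "e \<in> Basis"
  shows "test_function \<Omega> (iter_deriv [e] \<eta>)"
proof -
  obtain K where K: "compact K" "K \<subseteq> \<Omega>" "\<And>x. x \<notin> K \<Longrightarrow> \<eta> x = 0"
    using assms by (auto simp: test_function_def)
  have "smooth (iter_deriv [e] \<eta>)"
    using assms unfolding test_function_def smooth_def iter_deriv_append by simp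
  moreover have "iter_deriv [e] \<eta> x = 0" if "x \<notin> K" for x
  proof -
    have "(\<eta> has_derivative (\<lambda>h. 0)) (at x)"
      by (rule has_derivative_transform_within_open[of "\<lambda>x. 0" _ _ _ "- K"])
        (use that K compact_imp_closed in auto)
    from frechet_derivative_at[OF this, symmetric] show ?thesis by simp
  qed
  ultimately show ?thesis using K by (auto simp: test_function_def)
qed

text \<open>The derivative of a test function is again a test function; using it in the relation for
  \<open>f'\<close> shows that the second derivative of \<open>f\<close> is a first derivative of
  \<open>f'\<close>. Second-order terms can then be integrated by parts one order at a time.\<close>

lemma has_weak_deriv_step:
  assumes fg: "has_weak_deriv \<Omega> [e, e] f g" and f': "has_weak_deriv \<Omega> [e] f f'" and e: "e \<in> Basis"
  shows "has_weak_deriv \<Omega> [e] f' g"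
  unfolding has_weak_deriv_def
proof (intro conjI allI impI)
  show "locally_integrable \<Omega> f'" "locally_integrable \<Omega> g"
    using fg f' by (auto simp: has_weak_deriv_def)
  fix \<eta> assume \<eta>: "test_function \<Omega> \<eta>"
  have "(LINT x|M. f x * iter_deriv [e] (iter_deriv [e] \<eta>) x) = - (LINT x|M. f' x * iter_deriv [e] \<eta> x)"
    using has_weak_derivD[OF f' test_function_iter_deriv[OF \<eta> e]] by simp
  moreover have "(LINT x|M. f x * iter_deriv [e, e] \<eta> x) = (LINT x|M. g x * \<eta> x)"
    using has_weak_derivD[OF fg \<eta>] by simp
  ultimately show "(LINT x|M. f' x * iter_deriv [e] \<eta> x) = (-1) ^ length [e] * (LINT x|M. g x * \<eta> x)"
    unfolding iter_deriv_append by simp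
qed

section \<open>Continuous representatives\<close>

lemma is_cont_rep_cont_rep: "is_cont_rep \<Omega> f g \<Longrightarrow> is_cont_rep \<Omega> f (cont_rep \<Omega> f)"
  unfolding cont_rep_def by (rule someI[of "is_cont_rep \<Omega> f"])

text \<open>The subset of the domain where the two differ is open and null, hence empty, and
  equality extends to the closure by continuity. Boundary values therefore do not depend on the
  representative that a hypothesis happens to supply.\<close>

lemma cont_rep_unique:
  assumes g: "is_cont_rep \<Omega> f g" and g': "is_cont_rep \<Omega> f g'" and x: "x \<in> closure \<Omega>"
  shows "g x = g' x"
proof -
  have c: "continuous_on (closure \<Omega>) (\<lambda>x. g x - g' x)"
    using g g' by (auto simp: is_cont_rep_def intro: continuous_on_diff)
  have "AE x in M. g x = g' x"
    using g g' unfolding is_cont_rep_def by (auto elim: eventually_elim2)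
  then obtain N where N: "negligible N" "{x \<in> \<Omega>. g x - g' x \<noteq> 0} \<subseteq> N"
    by (simp add: AE_restrict_space_iff eventually_ae_filter_negligible) blast
  define S where "S = \<Omega> \<inter> (\<lambda>x. g x - g' x) -` (- {0})"
  have "open S"
    unfolding S_def by (rule continuous_open_preimage[OF continuous_on_subset[OF c closure_subset] open_domain]) auto
  moreover have "S \<subseteq> N" using N(2) by (auto simp: S_def)
  then have "negligible S" using N(1) negligible_subset by blast
  ultimately have "S = {}" using open_not_negligible by auto
  then have "\<Omega> \<subseteq> {x \<in> closure \<Omega>. g x - g' x = 0}" using closure_subset[of \<Omega>] by (auto simp: S_def)
  then have "closure \<Omega> \<subseteq> {x \<in> closure \<Omega>. g x - g' x = 0}"
    by (intro closure_minimal continuous_closed_preimage_constant[OF c]) auto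
  then show ?thesis using x by auto
qed

end

section \<open>Integration by parts on a box\<close>

lemma smooth_term_borel: "smooth_term h \<Longrightarrow> h \<in> borel_measurable borel"
  by (intro borel_measurable_continuous_onI smooth_term_continuous)

text \<open>This is \<open>sig'_bound2\<close> at n y - 1: for positive \<open>y\<close> the kernel
  is at most 2 / y, uniformly in n, which is what dominated convergence needs.\<close>

lemma kernel_bound: "y * (real n * sig' (real n * y - 1)) \<le> 2"
  using sig'_bound2[of "real n * y - 1"] by (simp add: mult_ac)

lemma kernel_tendsto_0:
  assumes "y > 0" shows "(\<lambda>n. real n * sig' (real n * y - 1)) \<longlonglongrightarrow> 0"
proof (rule real_tendsto_sandwich[where f = "\<lambda>n. 0" and h = "\<lambda>n. 4 / y\<^sup>2 * (1 / real n)"])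
  show "\<forall>\<^sub>F n in sequentially. real n * sig' (real n * y - 1) \<le> 4 / y\<^sup>2 * (1 / real n)"
  \<comment> \<open>Beyond n = 2 / y one has n y - 1 >= n y / 2, so \<open>sig'_bound\<close> gives
    decay of order 1 / n.\<close>
  proof (rule eventually_mono[OF eventually_gt_at_top[of "nat \<lceil>2 / y\<rceil>"]])
    fix n assume "nat \<lceil>2 / y\<rceil> < n"
    then have "2 / y < real n" by linarith
    then have n: "2 < real n * y" using assms by (simp add: field_simps)
    then have "n > 0" by (cases n) auto
    have "sig' (real n * y - 1) \<le> 1 / (real n * y - 1)\<^sup>2" by (rule sig'_bound)
    also have "\<dots> \<le> 1 / (real n * y / 2)\<^sup>2"
    proof (rule divide_left_mono)
      show "(real n * y / 2)\<^sup>2 \<le> (real n * y - 1)\<^sup>2" by (intro power_mono) (use n in \<open>linarith, simp\<close>)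
      have "0 < real n * y - 1" "0 < real n * y / 2" using n by auto
      then show "0 < (real n * y - 1)\<^sup>2 * (real n * y / 2)\<^sup>2" by (intro mult_pos_pos zero_less_power)
    qed simp
    finally have "real n * sig' (real n * y - 1) \<le> real n * (1 / (real n * y / 2)\<^sup>2)"
      by (intro mult_left_mono) auto
    also have "\<dots> = 4 / y\<^sup>2 * (1 / real n)"
      using \<open>n > 0\<close> assms by (simp add: field_simps power2_eq_square)
    finally show "real n * sig' (real n * y - 1) \<le> 4 / y\<^sup>2 * (1 / real n)" .
  qed
  have "(\<lambda>n. 4 / y\<^sup>2 * (1 / real n)) \<longlonglongrightarrow> 4 / y\<^sup>2 * 0"
    by (intro tendsto_mult_left lim_1_over_n)
  then show "(\<lambda>n. 4 / y\<^sup>2 * (1 / real n)) \<longlonglongrightarrow> 0" by simp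
qed auto

text \<open>The kernel is the derivative of a shifted and scaled \<open>sig\<close>, which is 0 at
  \<open>c\<close> and never exceeds 1.\<close>

lemma kernel_mass_lower:
  assumes "c \<le> d"
  shows "(\<integral>\<^sup>+t. ennreal (real n * sig' (real n * (t - c) - 1)) * indicator {c..d} t \<partial>lborel) \<le> 1"
proof -
  have D: "((\<lambda>t. sig (real n * (t - c) - 1)) has_real_derivative real n * sig' (real n * (t - c) - 1)) (at t)" for t
    by (rule DERIV_cong[OF DERIV_chain2[OF sig_deriv]]) (auto intro!: derivative_eq_intros)
  have "(\<integral>\<^sup>+t. ennreal (real n * sig' (real n * (t - c) - 1)) * indicator {c..d} t \<partial>lborel)
      = ennreal (sig (real n * (d - c) - 1) - sig (real n * (c - c) - 1))"
    by (rule nn_integral_FTC_Icc) (use assms D in auto)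
  also have "\<dots> \<le> 1"
    by (simp add: sig_eq_0)
  finally show ?thesis .
qed

lemma kernel_mass_upper:
  assumes "c \<le> d"
  shows "(\<integral>\<^sup>+t. ennreal (real n * sig' (real n * (d - t) - 1)) * indicator {c..d} t \<partial>lborel) \<le> 1"
proof -
  have D: "((\<lambda>t. - sig (real n * (d - t) - 1)) has_real_derivative real n * sig' (real n * (d - t) - 1)) (at t)" for t
    by (rule DERIV_cong[OF DERIV_minus[OF DERIV_chain2[OF sig_deriv]]]) (auto intro!: derivative_eq_intros)
  have "(\<integral>\<^sup>+t. ennreal (real n * sig' (real n * (d - t) - 1)) * indicator {c..d} t \<partial>lborel)
      = ennreal (- sig (real n * (d - d) - 1) - (- sig (real n * (d - c) - 1)))"
    by (rule nn_integral_FTC_Icc) (use assms D in auto)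
  also have "\<dots> \<le> 1"
    by (simp add: sig_eq_0)
  finally show ?thesis .
qed

section \<open>Boundary terms on a box as limits\<close>

locale box_domain =
  fixes c d :: "'a::euclidean_space"
  assumes box_pos: "\<And>b. b \<in> Basis \<Longrightarrow> c \<bullet> b < d \<bullet> b"
begin

sublocale bounded_domain "box c d"
  by unfold_locales auto

lemma integrable_mult_smooth:
  assumes "smooth_term h" "integrable M f" shows "integrable M (\<lambda>x. f x * h x)"
proof -
  obtain B where "\<And>x. x \<in> closure (box c d) \<Longrightarrow> \<bar>h x\<bar> \<le> B"
    using continuous_bounded[OF smooth_term_continuous[OF assms(1)]] by blast
  then show ?thesis
    using closure_subset[of "box c d"]
    by (intro integrable_mult_bounded[OF assms(2) borel_on[OF smooth_term_borel[OF assms(1)]]]) blast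
qed

lemma boxcut_limit:
  assumes "integrable M F"
  shows "(\<lambda>n. LINT x|M. F x * boxcut n c d x) \<longlonglongrightarrow> (LINT x|M. F x)"
proof (rule integral_dominated_convergence[where w = "\<lambda>x. \<bar>F x\<bar>"])
  show "AE x in M. (\<lambda>n. F x * boxcut n c d x) \<longlonglongrightarrow> F x"
  proof (rule AE_I2)
    fix x assume "x \<in> space M"
    then have "(\<lambda>n. F x * boxcut n c d x) \<longlonglongrightarrow> F x * 1"
      by (intro tendsto_mult_left boxcut_tendsto) simp
    then show "(\<lambda>n. F x * boxcut n c d x) \<longlonglongrightarrow> F x" by simp
  qed
  show "AE x in M. norm (F x * boxcut n c d x) \<le> \<bar>F x\<bar>" for n
    by (rule AE_I2) (simp add: abs_mult mult_left_le)
  show "(\<lambda>x. F x * boxcut n c d x) \<in> borel_measurable M" for n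
    by (rule borel_measurable_times[OF borel_measurable_integrable[OF assms] borel_on[OF smooth_term_borel[OF smooth_term_boxcut]]])
qed (use assms in \<open>simp_all add: borel_measurable_integrable\<close>)

text \<open>Testing with \<open>h\<close> times the cutoff and moving the term that differentiates
  \<open>h\<close> to the right isolates the derivative of the cutoff, that is, the boundary term at
  scale 1/n.\<close>

lemma weak_deriv_boxcut:
  assumes wd: "has_weak_deriv (box c d) [e] f g" and f: "integrable M f" and g: "integrable M g"
    and e: "e \<in> Basis" and h: "smooth_term h" and n: "n > 0"
  shows "(LINT x|M. f x * h x * (locut e n c d x - upcut e n c d x)) =
     - (LINT x|M. g x * h x * boxcut n c d x) - (LINT x|M. f x * iter_deriv [e] h x * boxcut n c d x)"
proof -
  let ?\<eta> = "\<lambda>x. h x * boxcut n c d x"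
  have t: "test_function (box c d) ?\<eta>"
    by (rule boxcut_test_function[OF n h order_refl])
  have D: "iter_deriv [e] ?\<eta> x = iter_deriv [e] h x * boxcut n c d x + h x * (locut e n c d x - upcut e n c d x)" for x
    unfolding iter_deriv_1_mult[OF h smooth_term_boxcut] boxcut_deriv[OF e] ..
  have i1: "integrable M (\<lambda>x. f x * iter_deriv [e] h x * boxcut n c d x)"
    by (intro integrable_mult_smooth smooth_term_iter_deriv smooth_term_boxcut f h)
  have "integrable M (\<lambda>x. f x * iter_deriv [e] ?\<eta> x)"
    by (intro integrable_mult_smooth smooth_term_iter_deriv smooth_term_boxcut f h smooth_term.mult)
  from Bochner_Integration.integral_diff[OF this i1]
  have "(LINT x|M. f x * iter_deriv [e] ?\<eta> x - f x * iter_deriv [e] h x * boxcut n c d x)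
    = (LINT x|M. f x * iter_deriv [e] ?\<eta> x) - (LINT x|M. f x * iter_deriv [e] h x * boxcut n c d x)" .
  also have "(\<lambda>x. f x * iter_deriv [e] ?\<eta> x - f x * iter_deriv [e] h x * boxcut n c d x)
    = (\<lambda>x. f x * h x * (locut e n c d x - upcut e n c d x))"
    unfolding D by (simp only: ring_distribs mult.assoc) simp
  also have "(LINT x|M. f x * iter_deriv [e] ?\<eta> x) = - (LINT x|M. g x * ?\<eta> x)"
    unfolding has_weak_derivD[OF wd t] by simp
  finally show ?thesis by (simp only: mult.assoc)
qed

text \<open>The limit is the boundary contribution, lower face minus upper face. It exists for every
  integrable \<open>f\<close> with integrable weak derivative, before any trace of \<open>f\<close>
  is known.\<close>

lemma weak_deriv_boundary_limit:
  assumes wd: "has_weak_deriv (box c d) [e] f g" and f: "integrable M f" and g: "integrable M g"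
    and e: "e \<in> Basis" and h: "smooth_term h"
  shows "(\<lambda>n. LINT x|M. f x * h x * (locut e n c d x - upcut e n c d x)) \<longlonglongrightarrow>
     - (LINT x|M. g x * h x) - (LINT x|M. f x * iter_deriv [e] h x)"
proof (rule Lim_transform_eventually)
  show "(\<lambda>n. - (LINT x|M. g x * h x * boxcut n c d x) - (LINT x|M. f x * iter_deriv [e] h x * boxcut n c d x))
    \<longlonglongrightarrow> - (LINT x|M. g x * h x) - (LINT x|M. f x * iter_deriv [e] h x)"
    by (intro tendsto_diff tendsto_minus boxcut_limit integrable_mult_smooth smooth_term_iter_deriv f g h)
  show "\<forall>\<^sub>F n in sequentially. - (LINT x|M. g x * h x * boxcut n c d x) - (LINT x|M. f x * iter_deriv [e] h x * boxcut n c d x)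
    = (LINT x|M. f x * h x * (locut e n c d x - upcut e n c d x))"
    using eventually_gt_at_top[of 0]
    by eventually_elim (rule weak_deriv_boxcut[OF assms, symmetric])
qed

lemma locut_borel: "locut e n c d \<in> borel_measurable M" and upcut_borel: "upcut e n c d \<in> borel_measurable M"
proof -
  have "othercut e n c d \<in> borel_measurable borel"
    unfolding othercut_def[abs_def] cut_def by measurable
  then show "locut e n c d \<in> borel_measurable M" "upcut e n c d \<in> borel_measurable M"
    unfolding locut_def[abs_def] upcut_def[abs_def] by (intro borel_on; measurable)+
qed

text \<open>These bounds grow with n and serve integrability at fixed n; uniform control comes from
  \<open>kernel_bound\<close> and \<open>cut_mass\<close>.\<close>

lemma cut_bounds: "locut e n c d x \<le> 2 * real n" "upcut e n c d x \<le> 2 * real n"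
proof -
  have "sig' y \<le> 2" for y
  proof (cases "y > 0")
    case True
    have "1 + 1 / y + (1 / y)\<^sup>2 / 2 \<le> exp (1 / y)" using exp_lower_Taylor_quadratic True by simp
    moreover have "1 / y \<ge> 0" using True by simp
    ultimately have "(1 / y)\<^sup>2 \<le> 2 * exp (1 / y)" by linarith
    then show ?thesis using True by (simp add: sig'_def exp_minus field_simps power_divide)
  qed (simp add: sig'_def)
  then have "real n * sig' y \<le> 2 * real n" for y using mult_left_mono[of "sig' y" 2 "real n"] by simp
  then show "locut e n c d x \<le> 2 * real n" "upcut e n c d x \<le> 2 * real n"
    using locut_le upcut_le order_trans by blast+
qed

lemma cut_integrable: "integrable M (locut e n c d)" "integrable M (upcut e n c d)"
  by (rule integrable_bounded[of _ "2 * real n"], rule locut_borel, simp add: cut_bounds,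
      rule integrable_bounded[of _ "2 * real n"], rule upcut_borel, simp add: cut_bounds)

text \<open>Tonelli on a product of intervals: the \<open>e\<close> direction contributes at most
  the mass 1 of \<open>k\<close>, every other direction its side length. The bound is uniform in the
  scale of the kernel.\<close>

lemma coordinate_integral_bound:
  assumes e: "e \<in> Basis" and k: "k \<in> borel_measurable borel" "\<And>t. 0 \<le> k t"
    and mass: "(\<integral>\<^sup>+t. ennreal (k t) * indicator {c \<bullet> e..d \<bullet> e} t \<partial>lborel) \<le> 1"
    and K: "integrable M K" "\<And>x. 0 \<le> K x" "\<And>x. K x \<le> k (x \<bullet> e)"
  shows "(LINT x|M. K x) \<le> (\<Prod>b\<in>Basis. if b = e then 1 else d \<bullet> b - c \<bullet> b)"
proof -
  define f where "f b t = (if b = e then ennreal (k t) * indicator {c \<bullet> e..d \<bullet> e} t else indicator {c \<bullet> b..d \<bullet> b} t)" for b t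
  let ?C = "\<Prod>b\<in>Basis. if b = e then 1 else d \<bullet> b - c \<bullet> b"
  have nonneg: "0 \<le> (if b = e then 1 else d \<bullet> b - c \<bullet> b)" if "b \<in> Basis" for b
    using box_pos[OF that] by simp
  have "(\<integral>\<^sup>+x. ennreal (K x) \<partial>M) \<le> (\<integral>\<^sup>+x. ennreal (k (x \<bullet> e)) \<partial>M)"
    by (intro nn_integral_mono ennreal_leI K)
  also have "\<dots> = (\<integral>\<^sup>+x. ennreal (k (x \<bullet> e)) * indicator (box c d) x \<partial>lebesgue)"
    by (rule nn_integral_restrict_space) simp
  also have "\<dots> = (\<integral>\<^sup>+x. ennreal (k (x \<bullet> e)) * indicator (box c d) x \<partial>lborel)"
    using k by (intro nn_integral_completion)
  also have "\<dots> \<le> (\<integral>\<^sup>+x. (\<Prod>b\<in>Basis. f b (x \<bullet> b)) \<partial>lborel)"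
  proof (rule nn_integral_mono)
    fix x
    show "ennreal (k (x \<bullet> e)) * indicator (box c d) x \<le> (\<Prod>b\<in>Basis. f b (x \<bullet> b))"
    proof (cases "x \<in> box c d")
      case True
      then have i: "c \<bullet> b \<le> x \<bullet> b \<and> x \<bullet> b \<le> d \<bullet> b" if "b \<in> Basis" for b
        using that by (auto simp: mem_box intro: less_imp_le)
      have "(\<Prod>b\<in>Basis. f b (x \<bullet> b)) = f e (x \<bullet> e) * (\<Prod>b\<in>Basis - {e}. f b (x \<bullet> b))"
        using e by (simp add: prod.remove)
      also have "(\<Prod>b\<in>Basis - {e}. f b (x \<bullet> b)) = 1"
        using i by (intro prod.neutral) (auto simp: f_def)
      finally show ?thesis using True i[OF e] by (simp add: f_def)
    qed simp
  qed
  also have "\<dots> = (\<Prod>b\<in>Basis. \<integral>\<^sup>+t. f b t \<partial>lborel)"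
    by (rule nn_integral_lborel_prod) (use k in \<open>auto simp: f_def[abs_def]\<close>)
  also have "\<dots> = (\<integral>\<^sup>+t. f e t \<partial>lborel) * (\<Prod>b\<in>Basis - {e}. \<integral>\<^sup>+t. f b t \<partial>lborel)"
    using e by (simp add: prod.remove)
  also have "\<dots> \<le> 1 * (\<Prod>b\<in>Basis - {e}. \<integral>\<^sup>+t. f b t \<partial>lborel)"
    using mass by (intro mult_right_mono) (simp_all add: f_def)
  also have "(\<Prod>b\<in>Basis - {e}. \<integral>\<^sup>+t. f b t \<partial>lborel) = (\<Prod>b\<in>Basis - {e}. ennreal (if b = e then 1 else d \<bullet> b - c \<bullet> b))"
    using box_pos by (intro prod.cong refl) (auto simp: f_def less_imp_le)
  also have "1 * \<dots> = (\<Prod>b\<in>Basis. ennreal (if b = e then 1 else d \<bullet> b - c \<bullet> b))"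
    using e by (simp add: prod.remove[of Basis e])
  also have "\<dots> = ennreal ?C" by (rule prod_ennreal[OF nonneg])
  finally have "(\<integral>\<^sup>+x. ennreal (K x) \<partial>M) \<le> ennreal ?C" .
  then have "enn2real (\<integral>\<^sup>+x. ennreal (K x) \<partial>M) \<le> ?C"
    by (intro enn2real_leI prod_nonneg nonneg)
  then show ?thesis using K by (subst integral_eq_nn_integral) auto
qed

lemma cut_mass:
  assumes e: "e \<in> Basis"
  shows "(LINT x|M. locut e n c d x) \<le> (\<Prod>b\<in>Basis. if b = e then 1 else d \<bullet> b - c \<bullet> b)"
    and "(LINT x|M. upcut e n c d x) \<le> (\<Prod>b\<in>Basis. if b = e then 1 else d \<bullet> b - c \<bullet> b)"
  by (rule coordinate_integral_bound[OF e _ _ kernel_mass_lower[of _ _ n]]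
        coordinate_integral_bound[OF e _ _ kernel_mass_upper[of _ _ n]];
      use box_pos[OF e] in \<open>simp add: cut_integrable locut_le upcut_le less_imp_le\<close>)+

text \<open>\<open>K n\<close> is an approximate identity that concentrates on the face where the distance \<open>y\<close> vanishes.\<close>

definition boundary_kernel :: "(nat \<Rightarrow> 'a \<Rightarrow> real) \<Rightarrow> ('a \<Rightarrow> real) \<Rightarrow> bool" where
  "boundary_kernel K y \<longleftrightarrow> y \<in> borel_measurable M \<and> (\<forall>x\<in>box c d. 0 < y x) \<and>
     (\<forall>n. integrable M (K n)) \<and> (\<forall>n x. 0 \<le> K n x \<and> K n x \<le> real n * sig' (real n * y x - 1)) \<and>
     (\<exists>C. \<forall>n. (LINT x|M. K n x) \<le> C)"

lemma boundary_kernel_locut: "e \<in> Basis \<Longrightarrow> boundary_kernel (\<lambda>n. locut e n c d) (\<lambda>x. x \<bullet> e - c \<bullet> e)"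
  and boundary_kernel_upcut: "e \<in> Basis \<Longrightarrow> boundary_kernel (\<lambda>n. upcut e n c d) (\<lambda>x. d \<bullet> e - x \<bullet> e)"
  unfolding boundary_kernel_def using cut_mass[of e]
  by (auto intro!: cut_integrable locut_le upcut_le borel_on simp: mem_box)

text \<open>The distance \<open>y\<close> absorbs the growth of the kernel, so \<open>2 * V\<close>
  is a majorant for all n, while pointwise the kernel tends to zero because \<open>y\<close> is
  positive inside the box.\<close>

lemma boundary_kernel_dominated:
  assumes K: "boundary_kernel K y" and F: "F \<in> borel_measurable M" and V: "integrable M V"
    and le: "AE x in M. \<bar>F x\<bar> \<le> y x * V x"
  shows "(\<lambda>n. LINT x|M. F x * K n x) \<longlonglongrightarrow> 0"
proof -
  have Kn: "0 \<le> K n x" "K n x \<le> real n * sig' (real n * y x - 1)" "integrable M (K n)" for n x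
    using K by (auto simp: boundary_kernel_def)
  have pos: "0 < y x" if "x \<in> box c d" for x using K that by (auto simp: boundary_kernel_def)
  have "(\<lambda>n. LINT x|M. F x * K n x) \<longlonglongrightarrow> (LINT x|M. 0)"
  proof (rule integral_dominated_convergence[where w = "\<lambda>x. 2 * V x"])
    show "(\<lambda>x. F x * K n x) \<in> borel_measurable M" for n
      by (rule borel_measurable_times[OF F borel_measurable_integrable[OF Kn(3)]])
    show "AE x in M. (\<lambda>n. F x * K n x) \<longlonglongrightarrow> 0"
    proof (rule AE_I2)
      fix x assume "x \<in> space M"
      then have "(\<lambda>n. real n * sig' (real n * y x - 1)) \<longlonglongrightarrow> 0"
        by (intro kernel_tendsto_0 pos) simp
      then have "(\<lambda>n. K n x) \<longlonglongrightarrow> 0"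
        using real_tendsto_sandwich[where f = "\<lambda>n. 0" and g = "\<lambda>n. K n x" and net = sequentially and c = 0
          and h = "\<lambda>n. real n * sig' (real n * y x - 1)"] Kn
        by simp
      then show "(\<lambda>n. F x * K n x) \<longlonglongrightarrow> 0" by (rule tendsto_mult_right_zero)
    qed
    show "AE x in M. norm (F x * K n x) \<le> 2 * V x" for n
      using le AE_space
    proof eventually_elim
      case (elim x)
      have y: "0 < y x" using elim pos by simp
      have "0 \<le> V x" using elim y by (smt (verit) zero_less_mult_iff mult_less_0_iff)
      have "norm (F x * K n x) \<le> (y x * V x) * (real n * sig' (real n * y x - 1))"
        unfolding real_norm_def abs_mult using elim Kn(1,2)[of n x] y \<open>0 \<le> V x\<close> by (intro mult_mono) auto
      also have "\<dots> = (y x * (real n * sig' (real n * y x - 1))) * V x" by (simp only: mult_ac)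
      also have "\<dots> \<le> 2 * V x" using kernel_bound \<open>0 \<le> V x\<close> by (rule mult_right_mono)
      finally show ?case .
    qed
  qed (use V in auto)
  then show ?thesis by simp
qed

text \<open>The usual approximate identity argument: close to the face \<open>F\<close> is at most
  \<epsilon> and the kernels have bounded mass; at distance at least \<delta> the constant
  \<open>B\<close> is at most y times \<open>B / \<delta>\<close>, so the dominated case
  applies.\<close>

lemma boundary_kernel_small:
  assumes K: "boundary_kernel K y" and F: "F \<in> borel_measurable M"
    and B: "AE x in M. \<bar>F x\<bar> \<le> B" "0 \<le> B"
    and small: "\<And>\<epsilon>. 0 < \<epsilon> \<Longrightarrow> \<exists>\<delta>>0. AE x in M. y x < \<delta> \<longrightarrow> \<bar>F x\<bar> \<le> \<epsilon>"
  shows "(\<lambda>n. LINT x|M. \<bar>F x\<bar> * K n x) \<longlonglongrightarrow> 0"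
proof (rule LIMSEQ_I)
  fix r :: real assume r: "0 < r"
  have y [measurable]: "y \<in> borel_measurable M" using K by (simp add: boundary_kernel_def)
  have Kn: "0 \<le> K n x" "integrable M (K n)" for n x
    using K by (auto simp: boundary_kernel_def)
  note Km [measurable] = borel_measurable_integrable[OF Kn(2)]
  obtain C where C: "\<And>n. (LINT x|M. K n x) \<le> C" using K by (auto simp: boundary_kernel_def)
  have C0: "0 \<le> C" by (rule order_trans[OF integral_nonneg_AE C[of 0]]) (simp add: Kn(1))
  \<comment> \<open>The summand 1 keeps the denominator positive when \<open>C = 0\<close> and makes
    \<epsilon> C < r / 2 strict.\<close>
  define \<epsilon> where "\<epsilon> = r / (2 * (C + 1))"
  have \<epsilon>: "0 < \<epsilon>" "\<epsilon> * C < r / 2" using r C0 by (auto simp: \<epsilon>_def field_simps)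
  obtain \<delta> where \<delta>: "0 < \<delta>" "AE x in M. y x < \<delta> \<longrightarrow> \<bar>F x\<bar> \<le> \<epsilon>" using small[OF \<epsilon>(1)] by blast
  \<comment> \<open>The majorant of \<open>F\<close> away from the face; near the face \<epsilon>
    takes over.\<close>
  define G where "G x = (if y x < \<delta> then 0 else B)" for x
  have G [measurable]: "G \<in> borel_measurable M" unfolding G_def by measurable
  have "(\<lambda>n. LINT x|M. G x * K n x) \<longlonglongrightarrow> 0"
  proof (rule boundary_kernel_dominated[OF K G, where V = "\<lambda>x. B / \<delta>"])
    show "AE x in M. \<bar>G x\<bar> \<le> y x * (B / \<delta>)"
    proof (rule AE_I2)
      fix x assume x: "x \<in> space M"
      then have "0 < y x" using K by (auto simp: boundary_kernel_def)
      moreover have "\<delta> * (B / \<delta>) \<le> y x * (B / \<delta>)" if "\<delta> \<le> y x" using that B(2) \<delta>(1) by (intro mult_right_mono) auto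
      ultimately show "\<bar>G x\<bar> \<le> y x * (B / \<delta>)"
        using B(2) \<delta>(1) by (auto simp: G_def not_less)
    qed
  qed simp
  from LIMSEQ_D[OF this, of "r / 2"] r obtain N where N: "\<And>n. n \<ge> N \<Longrightarrow> norm (LINT x|M. G x * K n x) < r / 2" by auto
  have GK: "integrable M (\<lambda>x. G x * K n x)" for n
    using integrable_mult_bounded[OF Kn(2) G, of B n] B(2) by (simp add: G_def mult.commute)
  have "norm ((LINT x|M. \<bar>F x\<bar> * K n x) - 0) < r" if n: "n \<ge> N" for n
  proof -
    have "(LINT x|M. \<bar>F x\<bar> * K n x) \<le> (LINT x|M. \<epsilon> * K n x + G x * K n x)"
    proof (rule integral_mono_AE)
      show "integrable M (\<lambda>x. \<bar>F x\<bar> * K n x)"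
      proof (rule Bochner_Integration.integrable_bound[of _ "\<lambda>x. B * K n x"])
        show "AE x in M. norm (\<bar>F x\<bar> * K n x) \<le> norm (B * K n x)"
          using B(1) by eventually_elim (use B(2) Kn(1) in \<open>simp add: abs_mult mult_right_mono\<close>)
      qed (use F Kn(2) in simp_all)
      show "AE x in M. \<bar>F x\<bar> * K n x \<le> \<epsilon> * K n x + G x * K n x"
        using B(1) \<delta>(2)
      proof eventually_elim
        case (elim x)
        then have "\<bar>F x\<bar> \<le> \<epsilon> + G x" using \<epsilon>(1) by (auto simp: G_def)
        then show ?case using mult_right_mono[OF _ Kn(1)] by (simp add: distrib_right[symmetric])
      qed
    qed (use GK Kn(2) in simp)
    also have "\<dots> = \<epsilon> * (LINT x|M. K n x) + (LINT x|M. G x * K n x)" using GK Kn(2) by simp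
    also have "\<dots> \<le> \<epsilon> * C + (LINT x|M. G x * K n x)" using C \<epsilon>(1) by (simp add: mult_left_mono)
    also have "\<dots> < r" using N[OF n] \<epsilon>(2) by simp
    finally have "(LINT x|M. \<bar>F x\<bar> * K n x) < r" .
    moreover have "0 \<le> (LINT x|M. \<bar>F x\<bar> * K n x)" using Kn(1) by (intro integral_nonneg_AE) simp
    ultimately show ?thesis by simp
  qed
  then show "\<exists>N. \<forall>n\<ge>N. norm ((LINT x|M. \<bar>F x\<bar> * K n x) - 0) < r" by blast
qed

lemma integration_by_parts:
  assumes wd: "has_weak_deriv (box c d) [e] f g" and f: "integrable M f" and g: "integrable M g"
    and e: "e \<in> Basis" and h: "smooth_term h"
    and lo: "(\<lambda>n. LINT x|M. f x * h x * locut e n c d x) \<longlonglongrightarrow> 0"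
    and up: "(\<lambda>n. LINT x|M. f x * h x * upcut e n c d x) \<longlonglongrightarrow> 0"
  shows "(LINT x|M. g x * h x) = - (LINT x|M. f x * iter_deriv [e] h x)"
proof -
  have int: "integrable M (\<lambda>x. f x * h x * K x)" if "K \<in> borel_measurable M" "\<And>x. 0 \<le> K x" "\<And>x. K x \<le> 2 * real n" for K n
    by (rule integrable_mult_bounded[OF integrable_mult_smooth[OF h f] that(1), of "2 * real n"]) (use that in auto)
  have "(LINT x|M. f x * h x * (locut e n c d x - upcut e n c d x)) =
      (LINT x|M. f x * h x * locut e n c d x) - (LINT x|M. f x * h x * upcut e n c d x)" for n
    unfolding right_diff_distrib
    by (intro Bochner_Integration.integral_diff int[of _ n] locut_borel upcut_borel cut_bounds locut_nonneg upcut_nonneg)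
  then have "(\<lambda>n. LINT x|M. f x * h x * (locut e n c d x - upcut e n c d x)) \<longlonglongrightarrow> 0 - 0"
    using tendsto_diff[OF lo up] by simp
  from LIMSEQ_unique[OF this weak_deriv_boundary_limit[OF wd f g e h]] show ?thesis by simp
qed

text \<open>The map \<pi> sends a point to a zero of \<open>g\<close> no farther away than
  \<open>y\<close>, so uniform continuity of \<open>g\<close> on the compact closure makes
  \<open>f\<close>, and with it \<open>F\<close>, small near the face. \<open>F\<close> is kept
  apart from \<open>f\<close> so that products and squares are covered.\<close>

lemma boundary_term_tendsto_0:
  assumes K: "boundary_kernel K y" and rep: "is_cont_rep (box c d) f g"
    and proj: "\<And>x. x \<in> box c d \<Longrightarrow> \<pi> x \<in> closure (box c d) \<and> dist x (\<pi> x) \<le> y x \<and> g (\<pi> x) = 0"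
    and F: "F \<in> borel_measurable M" "AE x in M. \<bar>F x\<bar> \<le> C * \<bar>f x\<bar>"
  shows "(\<lambda>n. LINT x|M. \<bar>F x\<bar> * K n x) \<longlonglongrightarrow> 0" "(\<lambda>n. LINT x|M. F x * K n x) \<longlonglongrightarrow> 0"
proof -
  have g: "continuous_on (closure (box c d)) g" and fg: "AE x in M. f x = g x"
    using rep by (auto simp: is_cont_rep_def)
  \<comment> \<open>A positive constant, because \<epsilon> is divided by it.\<close>
  define C' where "C' = max C 1"
  have C': "0 < C'" by (simp add: C'_def)
  have FC: "AE x in M. \<bar>F x\<bar> \<le> C' * \<bar>g x\<bar>"
    using F(2) fg
  proof eventually_elim
    case (elim x)
    have "C * \<bar>f x\<bar> \<le> C' * \<bar>f x\<bar>" by (intro mult_right_mono) (auto simp: C'_def)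
    then show ?case using elim by simp
  qed
  have sub: "x \<in> box c d \<Longrightarrow> x \<in> closure (box c d)" for x using closure_subset by blast
  obtain B where B: "B > 0" "\<And>x. x \<in> closure (box c d) \<Longrightarrow> \<bar>g x\<bar> \<le> B"
    using continuous_bounded[OF g] by blast
  have uc: "uniformly_continuous_on (closure (box c d)) g"
    by (rule compact_uniformly_continuous[OF g]) (simp add: compact_closure)
  show lim: "(\<lambda>n. LINT x|M. \<bar>F x\<bar> * K n x) \<longlonglongrightarrow> 0"
  proof (rule boundary_kernel_small[OF K F(1), where B = "C' * B"])
    show "AE x in M. \<bar>F x\<bar> \<le> C' * B"
      using FC AE_space
    proof eventually_elim
      case (elim x)
      have "C' * \<bar>g x\<bar> \<le> C' * B" using C' B(2)[OF sub] elim by (intro mult_left_mono) auto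
      then show ?case using elim by simp
    qed
    show "0 \<le> C' * B" using C' B by simp
    fix \<epsilon> :: real assume "0 < \<epsilon>"
    then have "0 < \<epsilon> / C'" using C' by simp
    then obtain \<delta> where \<delta>: "0 < \<delta>" "\<And>x x'. x \<in> closure (box c d) \<Longrightarrow> x' \<in> closure (box c d) \<Longrightarrow> dist x' x < \<delta> \<Longrightarrow> dist (g x') (g x) < \<epsilon> / C'"
      using uc unfolding uniformly_continuous_on_def by blast
    have "AE x in M. y x < \<delta> \<longrightarrow> \<bar>F x\<bar> \<le> \<epsilon>"
      using FC AE_space
    proof eventually_elim
      case (elim x)
      show ?case
      proof
        assume "y x < \<delta>"
        have x: "x \<in> box c d" using elim by simp
        have "dist x (\<pi> x) < \<delta>" using proj[OF x] \<open>y x < \<delta>\<close> by linarith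
        then have "dist (g x) (g (\<pi> x)) < \<epsilon> / C'" using \<delta>(2)[of "\<pi> x" x] proj[OF x] sub[OF x] by blast
        then have "\<bar>g x\<bar> < \<epsilon> / C'" using proj[OF x] by simp
        then have "C' * \<bar>g x\<bar> \<le> \<epsilon>" using C' by (simp add: field_simps)
        then show "\<bar>F x\<bar> \<le> \<epsilon>" using elim by simp
      qed
    qed
    with \<delta>(1) show "\<exists>\<delta>>0. AE x in M. y x < \<delta> \<longrightarrow> \<bar>F x\<bar> \<le> \<epsilon>" by blast
  qed
  have K0: "0 \<le> K n x" for n x using K by (auto simp: boundary_kernel_def)
  show "(\<lambda>n. LINT x|M. F x * K n x) \<longlonglongrightarrow> 0"
  proof (rule tendsto_0_le[OF lim, where K = 1], intro always_eventually allI)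
    fix n
    have "\<bar>LINT x|M. F x * K n x\<bar> \<le> (LINT x|M. \<bar>F x * K n x\<bar>)" by (rule integral_abs_bound)
    also have "(\<lambda>x. \<bar>F x * K n x\<bar>) = (\<lambda>x. \<bar>F x\<bar> * K n x)" using K0 by (simp add: abs_mult)
    finally show "norm (LINT x|M. F x * K n x) \<le> norm (LINT x|M. \<bar>F x\<bar> * K n x) * 1" by simp
  qed
qed

section \<open>Boundary terms that vanish on a face\<close>

lemma closure_box_eq: "closure (box c d) = cbox c d"
  using box_pos by (intro closure_box) (simp add: box_ne_empty)

lemma frontier_box_eq: "frontier (box c d) = cbox c d - box c d"
  by (simp add: frontier_def closure_box_eq interior_open[OF open_box])

lemma face_projection:
  assumes e: "e \<in> Basis" and x: "x \<in> box c d" and r: "r = c \<bullet> e \<or> r = d \<bullet> e"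
  shows "x + (r - x \<bullet> e) *\<^sub>R e \<in> closure (box c d)" "dist x (x + (r - x \<bullet> e) *\<^sub>R e) = \<bar>r - x \<bullet> e\<bar>"
proof -
  have "(x + (r - x \<bullet> e) *\<^sub>R e) \<bullet> b = (if b = e then r else x \<bullet> b)" if "b \<in> Basis" for b
    using that e by (simp add: inner_simps inner_Basis)
  then show "x + (r - x \<bullet> e) *\<^sub>R e \<in> closure (box c d)"
    using x r box_pos by (auto simp: closure_box_eq mem_box intro: less_imp_le)
  show "dist x (x + (r - x \<bullet> e) *\<^sub>R e) = \<bar>r - x \<bullet> e\<bar>"
    using e by (simp add: dist_norm)
qed

text \<open>Here the test function kills the boundary term: it vanishes at a linear rate at the
  face, and \<open>f\<close> need only be integrable.\<close>

lemma locut_test_tendsto_0: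
  assumes e: "e \<in> Basis" and f: "integrable M f" and h: "smooth_term h"
    and le: "\<And>x. x \<in> box c d \<Longrightarrow> \<bar>h x\<bar> \<le> C * (x \<bullet> e - c \<bullet> e)"
  shows "(\<lambda>n. LINT x|M. f x * h x * locut e n c d x) \<longlonglongrightarrow> 0"
proof (rule boundary_kernel_dominated[OF boundary_kernel_locut[OF e], where V = "\<lambda>x. C * \<bar>f x\<bar>"])
  show "AE x in M. \<bar>f x * h x\<bar> \<le> (x \<bullet> e - c \<bullet> e) * (C * \<bar>f x\<bar>)"
  proof (rule AE_I2)
    fix x assume "x \<in> space M"
    then have "\<bar>f x\<bar> * \<bar>h x\<bar> \<le> \<bar>f x\<bar> * (C * (x \<bullet> e - c \<bullet> e))" using le[of x] by (intro mult_left_mono) auto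
    then show "\<bar>f x * h x\<bar> \<le> (x \<bullet> e - c \<bullet> e) * (C * \<bar>f x\<bar>)" by (simp add: abs_mult mult_ac)
  qed
qed (use f integrable_mult_smooth[OF h f] in auto)

lemma upcut_test_tendsto_0:
  assumes e: "e \<in> Basis" and f: "integrable M f" and h: "smooth_term h"
    and le: "\<And>x. x \<in> box c d \<Longrightarrow> \<bar>h x\<bar> \<le> C * (d \<bullet> e - x \<bullet> e)"
  shows "(\<lambda>n. LINT x|M. f x * h x * upcut e n c d x) \<longlonglongrightarrow> 0"
proof (rule boundary_kernel_dominated[OF boundary_kernel_upcut[OF e], where V = "\<lambda>x. C * \<bar>f x\<bar>"])
  show "AE x in M. \<bar>f x * h x\<bar> \<le> (d \<bullet> e - x \<bullet> e) * (C * \<bar>f x\<bar>)"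
  proof (rule AE_I2)
    fix x assume "x \<in> space M"
    then have "\<bar>f x\<bar> * \<bar>h x\<bar> \<le> \<bar>f x\<bar> * (C * (d \<bullet> e - x \<bullet> e))" using le[of x] by (intro mult_left_mono) auto
    then show "\<bar>f x * h x\<bar> \<le> (d \<bullet> e - x \<bullet> e) * (C * \<bar>f x\<bar>)" by (simp add: abs_mult mult_ac)
  qed
qed (use f integrable_mult_smooth[OF h f] in auto)

text \<open>Here the zero boundary values of \<open>f\<close> kill the boundary term; the projection
  is the orthogonal one onto the lower face.\<close>

lemma locut_function_tendsto_0:
  assumes e: "e \<in> Basis" and rep: "is_cont_rep (box c d) f g"
    and zero: "\<And>x. x \<in> box c d \<Longrightarrow> g (x + (c \<bullet> e - x \<bullet> e) *\<^sub>R e) = 0"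
    and F: "F \<in> borel_measurable M" "AE x in M. \<bar>F x\<bar> \<le> C * \<bar>f x\<bar>"
  shows "(\<lambda>n. LINT x|M. \<bar>F x\<bar> * locut e n c d x) \<longlonglongrightarrow> 0" "(\<lambda>n. LINT x|M. F x * locut e n c d x) \<longlonglongrightarrow> 0"
proof -
  have proj: "x + (c \<bullet> e - x \<bullet> e) *\<^sub>R e \<in> closure (box c d) \<and> dist x (x + (c \<bullet> e - x \<bullet> e) *\<^sub>R e) \<le> x \<bullet> e - c \<bullet> e
      \<and> g (x + (c \<bullet> e - x \<bullet> e) *\<^sub>R e) = 0" if x: "x \<in> box c d" for x
  proof -
    have "c \<bullet> e < x \<bullet> e" "x \<bullet> e < d \<bullet> e" using x e by (auto simp: mem_box)
    then have "\<bar>c \<bullet> e - x \<bullet> e\<bar> = x \<bullet> e - c \<bullet> e" by simp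
    then show ?thesis using face_projection[OF e x, of "c \<bullet> e"] zero[OF x] by simp
  qed
  show "(\<lambda>n. LINT x|M. \<bar>F x\<bar> * locut e n c d x) \<longlonglongrightarrow> 0" "(\<lambda>n. LINT x|M. F x * locut e n c d x) \<longlonglongrightarrow> 0"
    by (rule boundary_term_tendsto_0[OF boundary_kernel_locut[OF e] rep proj F]; assumption)+
qed

lemma upcut_function_tendsto_0:
  assumes e: "e \<in> Basis" and rep: "is_cont_rep (box c d) f g"
    and zero: "\<And>x. x \<in> box c d \<Longrightarrow> g (x + (d \<bullet> e - x \<bullet> e) *\<^sub>R e) = 0"
    and F: "F \<in> borel_measurable M" "AE x in M. \<bar>F x\<bar> \<le> C * \<bar>f x\<bar>"
  shows "(\<lambda>n. LINT x|M. \<bar>F x\<bar> * upcut e n c d x) \<longlonglongrightarrow> 0" "(\<lambda>n. LINT x|M. F x * upcut e n c d x) \<longlonglongrightarrow> 0"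
proof -
  have proj: "x + (d \<bullet> e - x \<bullet> e) *\<^sub>R e \<in> closure (box c d) \<and> dist x (x + (d \<bullet> e - x \<bullet> e) *\<^sub>R e) \<le> d \<bullet> e - x \<bullet> e
      \<and> g (x + (d \<bullet> e - x \<bullet> e) *\<^sub>R e) = 0" if x: "x \<in> box c d" for x
  proof -
    have "c \<bullet> e < x \<bullet> e" "x \<bullet> e < d \<bullet> e" using x e by (auto simp: mem_box)
    then have "\<bar>d \<bullet> e - x \<bullet> e\<bar> = d \<bullet> e - x \<bullet> e" by simp
    then show ?thesis using face_projection[OF e x, of "d \<bullet> e"] zero[OF x] by simp
  qed
  show "(\<lambda>n. LINT x|M. \<bar>F x\<bar> * upcut e n c d x) \<longlonglongrightarrow> 0" "(\<lambda>n. LINT x|M. F x * upcut e n c d x) \<longlonglongrightarrow> 0"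
    by (rule boundary_term_tendsto_0[OF boundary_kernel_upcut[OF e] rep proj F]; assumption)+
qed

lemma smooth_bounded:
  assumes "smooth_term h" shows "\<exists>B>0. \<forall>x\<in>box c d. \<bar>h x\<bar> \<le> B"
proof (rule continuous_bounded[OF smooth_term_continuous[OF assms]])
  fix B :: real assume "B > 0" and B: "\<And>x. x \<in> closure (box c d) \<Longrightarrow> \<bar>h x\<bar> \<le> B"
  moreover have "\<bar>h x\<bar> \<le> B" if "x \<in> box c d" for x
    using that closure_subset by (intro B) auto
  ultimately show ?thesis by auto
qed

lemma function_mult_smooth:
  assumes f: "integrable M f" and h: "smooth_term h"
  shows "(\<lambda>x. f x * h x) \<in> borel_measurable M" "\<exists>B. AE x in M. \<bar>f x * h x\<bar> \<le> B * \<bar>f x\<bar>"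
proof -
  show "(\<lambda>x. f x * h x) \<in> borel_measurable M"
    by (rule borel_measurable_integrable[OF integrable_mult_smooth[OF h f]])
  obtain B where B: "\<forall>x\<in>box c d. \<bar>h x\<bar> \<le> B" using smooth_bounded[OF h] by auto
  have "AE x in M. \<bar>f x * h x\<bar> \<le> B * \<bar>f x\<bar>"
  proof (rule AE_I2)
    fix x assume "x \<in> space M"
    then have "\<bar>h x\<bar> \<le> B" using B by simp
    then have "\<bar>h x\<bar> * \<bar>f x\<bar> \<le> B * \<bar>f x\<bar>" by (rule mult_right_mono) simp
    then show "\<bar>f x * h x\<bar> \<le> B * \<bar>f x\<bar>"
      by (simp add: abs_mult mult.commute[of "\<bar>f x\<bar>"])
  qed
  then show "\<exists>B. AE x in M. \<bar>f x * h x\<bar> \<le> B * \<bar>f x\<bar>" ..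
qed

lemma integration_by_parts_vanishing_test:
  assumes "has_weak_deriv (box c d) [e] f g" and f: "integrable M f" and "integrable M g"
    and e: "e \<in> Basis" and h: "smooth_term h"
    and "\<And>x. x \<in> box c d \<Longrightarrow> \<bar>h x\<bar> \<le> C * (x \<bullet> e - c \<bullet> e)"
    and "\<And>x. x \<in> box c d \<Longrightarrow> \<bar>h x\<bar> \<le> C * (d \<bullet> e - x \<bullet> e)"
  shows "(LINT x|M. g x * h x) = - (LINT x|M. f x * iter_deriv [e] h x)"
  by (rule integration_by_parts[OF assms(1-5) locut_test_tendsto_0[OF e f h assms(6)] upcut_test_tendsto_0[OF e f h assms(7)]])

lemma integration_by_parts_vanishing_function:
  assumes "has_weak_deriv (box c d) [e] f g" and f: "integrable M f" and "integrable M g"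
    and e: "e \<in> Basis" and h: "smooth_term h" and rep: "is_cont_rep (box c d) f f'"
    and lo: "\<And>x. x \<in> box c d \<Longrightarrow> f' (x + (c \<bullet> e - x \<bullet> e) *\<^sub>R e) = 0"
    and up: "\<And>x. x \<in> box c d \<Longrightarrow> f' (x + (d \<bullet> e - x \<bullet> e) *\<^sub>R e) = 0"
  shows "(LINT x|M. g x * h x) = - (LINT x|M. f x * iter_deriv [e] h x)"
proof -
  note m = function_mult_smooth(1)[OF f h]
  obtain B where B: "AE x in M. \<bar>f x * h x\<bar> \<le> B * \<bar>f x\<bar>" using function_mult_smooth(2)[OF f h] by auto
  show ?thesis
    by (rule integration_by_parts[OF assms(1-5) locut_function_tendsto_0(2)[OF e rep lo m B] upcut_function_tendsto_0(2)[OF e rep up m B]])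
qed

lemma cut_mult_integrable:
  assumes "integrable M f"
  shows "integrable M (\<lambda>x. f x * locut e n c d x)" "integrable M (\<lambda>x. f x * upcut e n c d x)"
  by (rule integrable_mult_bounded[OF assms locut_borel, where B = "2 * real n"], simp add: cut_bounds,
      rule integrable_mult_bounded[OF assms upcut_borel, where B = "2 * real n"], simp add: cut_bounds)

end

section \<open>Representation along vertical lines\<close>

lemma smooth_term_real_chain:
  fixes k :: "real \<Rightarrow> real" assumes "smooth_term k"
  shows "(iter_deriv (replicate n 1) k has_real_derivative iter_deriv (replicate (Suc n) 1) k y) (at y)"
proof -
  have "smooth_term (iter_deriv (replicate n 1) k)" by (rule smooth_term_iter_deriv[OF assms])
  then obtain D where D: "(iter_deriv (replicate n 1) k has_real_derivative D) (at y)"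
    using smooth_term_differentiable real_differentiableE by blast
  have "iter_deriv (replicate (Suc n) 1) k y = D"
    using frechet_derivative_at[OF D[unfolded has_field_derivative_def]] by (metis iter_deriv.simps(2) mult.right_neutral replicate_Suc)
  with D show ?thesis by simp
qed

text \<open>The iterated derivatives of \<open>k\<close> form a chain, and an antiderivative put in
  front of it is a chain as well, so \<open>F\<close> composed with a coordinate stays in the class.
  \<open>vertical_bound\<close> builds its test functions this way.\<close>

lemma smooth_term_antiderivative:
  fixes k :: "real \<Rightarrow> real" assumes k: "smooth_term k"
  obtains F where "\<And>y. (F has_real_derivative k y) (at y)" "\<And>(b::'a::euclidean_space) m. smooth_term (\<lambda>x. F (x \<bullet> b) + m)"
proof -
  have "continuous_on UNIV k" by (rule smooth_term_continuous[OF k])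
  then have "\<And>x. isCont k x" by (simp add: continuous_on_eq_continuous_at)
  then obtain F where F: "\<And>y. (F has_real_derivative k y) (at y)"
    using einterval_antiderivative[of "-\<infinity>" "\<infinity>" k] by (auto simp: has_real_derivative_iff_has_vector_derivative)
  have "smooth_term (\<lambda>x. (case_nat F (\<lambda>n. iter_deriv (replicate n 1) k)) 0 (x \<bullet> b))" for b :: 'a
  proof (rule smooth_term.atom)
    fix n y
    show "(case_nat F (\<lambda>n. iter_deriv (replicate n 1) k) n has_real_derivative
        case_nat F (\<lambda>n. iter_deriv (replicate n 1) k) (Suc n) y) (at y)"
      using F smooth_term_real_chain[OF k] by (cases n) (simp_all del: replicate_Suc)
  qed
  then have A: "smooth_term (\<lambda>x. F (x \<bullet> b))" for b :: 'a by simp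
  show thesis by (rule that[OF F smooth_term.add[OF A smooth_term.const]])
qed

lemma Cauchy_Schwarz_lborel:
  fixes f :: "real \<Rightarrow> real"
  assumes f: "integrable lborel f" "integrable lborel (\<lambda>s. (f s)\<^sup>2)" and ab: "a \<le> b"
    and supp: "\<And>s. s \<notin> {a..b} \<Longrightarrow> f s = 0"
  shows "(LINT s|lborel. f s)\<^sup>2 \<le> (b - a) * (LINT s|lborel. (f s)\<^sup>2)"
proof -
  define I where "I = (LINT s|lborel. f s)"
  define S where "S = (LINT s|lborel. (f s)\<^sup>2)"
  have "0 \<le> (b - a) * S - I\<^sup>2"
  proof (cases "a = b")
    case True
    have "AE s in lborel. f s = 0" using AE_lborel_singleton[of a] by eventually_elim (use supp True in auto)
    then have "I = 0" unfolding I_def by (rule integral_eq_zero_AE)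
    then show ?thesis using True by simp
  next
    case False
    then have ba: "0 < b - a" using ab by simp
    \<comment> \<open>The mean value of \<open>f\<close> on the interval; the integrand below is the
      square of \<open>f - ?m\<close> there and vanishes elsewhere.\<close>
    let ?m = "I / (b - a)"
    have ind: "integrable lborel (\<lambda>s. indicator {a..b} s :: real)"
      using ab by (intro integrable_real_indicator) simp_all
    have "0 \<le> (LINT s|lborel. ((f s)\<^sup>2 - 2 * ?m * f s) + ?m\<^sup>2 * indicator {a..b} s)"
    proof (rule integral_nonneg_AE, rule AE_I2)
      fix s
      have "0 \<le> (f s - ?m)\<^sup>2" by simp
      then show "0 \<le> ((f s)\<^sup>2 - 2 * ?m * f s) + ?m\<^sup>2 * indicator {a..b} s"
        using supp[of s] by (cases "s \<in> {a..b}") (simp_all add: power2_diff mult_ac)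
    qed
    also have "\<dots> = (S - 2 * ?m * I) + ?m\<^sup>2 * (b - a)"
      using f ind ab by (simp add: S_def I_def)
    finally have "0 \<le> (b - a) * ((S - 2 * ?m * I) + ?m\<^sup>2 * (b - a))" using ba by simp
    also have "\<dots> = (b - a) * S - I\<^sup>2"
    proof -
      have "L * ((S - 2 * (I / L) * I) + (I / L)\<^sup>2 * L) = L * S - I\<^sup>2" if "L \<noteq> 0" for L
        using that by (simp add: field_simps power2_eq_square)
      then show ?thesis using ba by simp
    qed
    finally show ?thesis .
  qed
  then show ?thesis by (simp add: I_def S_def)
qed

locale vertical_box = box_domain c d for c d :: "'a::euclidean_space \<times> real"
begin

abbreviation "ez \<equiv> (0, 1) :: 'a \<times> real"

lemma ez_Basis: "ez \<in> Basis" by (simp add: Basis_prod_def)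

lemma inner_ez [simp]: "p \<bullet> ez = snd p" by (cases p) simp

lemma height: "snd c < snd d" using box_pos[OF ez_Basis] by simp

lemma box_snd: "p \<in> box c d \<Longrightarrow> snd c < snd p \<and> snd p < snd d"
  using ez_Basis by (auto simp: mem_box)

text \<open>Fubini is used for \<open>lborel\<close>, through its product structure, so a Lebesgue
  measurable function is first replaced by a Borel one that vanishes outside the box.\<close>

lemma lborel_integral_box:
  assumes "f \<in> borel_measurable M"
  obtains f1 where "f1 \<in> borel_measurable borel" "\<And>p. p \<notin> box c d \<Longrightarrow> f1 p = 0"
    "AE p in M. f p = (f1 p :: real)"
proof -
  have "(\<lambda>p. if p \<in> box c d then f p else 0) \<in> borel_measurable lebesgue"
    by (rule borel_measurable_if_I[OF assms]) simp
  then obtain f0 where f0: "f0 \<in> borel_measurable lborel" "AE p in lborel. (if p \<in> box c d then f p else 0) = f0 p"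
    using completion_ex_borel_measurable_real by blast
  have "AE p in lebesgue. (if p \<in> box c d then f p else 0) = f0 p" by (rule AE_completion[OF f0(2)])
  then have "AE p in M. f p = indicator (box c d) p * f0 p"
    by (simp add: AE_restrict_space_iff) (auto elim: eventually_mono)
  then show thesis using f0(1) by (intro that[of "\<lambda>p. indicator (box c d) p * f0 p"]) auto
qed

lemma M_lborel:
  assumes "f \<in> borel_measurable borel" "\<And>p. p \<notin> box c d \<Longrightarrow> f p = (0::real)"
  shows "integrable M f \<longleftrightarrow> integrable lborel f" "(LINT p|M. f p) = (LINT p|lborel. f p)"
proof -
  have eq: "(\<lambda>p. indicat_real (box c d) p *\<^sub>R f p) = f" using assms(2) by (auto simp: indicator_def fun_eq_iff)
  show "integrable M f \<longleftrightarrow> integrable lborel f"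
    using assms(1) integrable_restrict_space[of "box c d" lebesgue f] integrable_completion[of f lborel]
    unfolding eq by simp
  show "(LINT p|M. f p) = (LINT p|lborel. f p)"
    using assms(1) integral_restrict_space[of "box c d" lebesgue f] integral_completion[of f lborel]
    unfolding eq by simp
qed


lemma othercut_vertical: "othercut ez n c' d' (x, s) = othercut ez n c' d' (x, z)"
  unfolding othercut_def by (rule prod.cong) (auto simp: Basis_prod_def)

lemma boxcut_vertical: "boxcut n c' d' p = cut n (snd c') (snd d') (snd p) * othercut ez n c' d' p"
  unfolding boxcut_def othercut_def using prod.remove[OF finite_Basis ez_Basis, of "\<lambda>e. cut n (c' \<bullet> e) (d' \<bullet> e) (p \<bullet> e)"]
  by simp

text \<open>If the integration by parts formula holds for test functions that need not vanish near the lower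
  face, then \<open>f(x, z) = \<integral>\<^bsub>c\<^esub>\<^bsup>z\<^esup> g(x, s) ds\<close>; the square bound is Cauchy-Schwarz.\<close>

lemma vertical_bound:
  assumes f: "f \<in> L2_space (box c d)" and g: "g \<in> L2_space (box c d)"
    and ibp: "\<And>h. smooth_term h \<Longrightarrow> (\<And>p. p \<in> box c d \<Longrightarrow> \<bar>h p\<bar> \<le> snd d - snd p) \<Longrightarrow>
      (LINT p|M. g p * h p) = - (LINT p|M. f p * iter_deriv [ez] h p)"
  obtains V where "integrable M V" "AE p in M. (f p)\<^sup>2 \<le> (snd p - snd c) * V p"
proof -
  obtain g1 where g1 [measurable]: "g1 \<in> borel_measurable borel" and g1_0: "\<And>p. p \<notin> box c d \<Longrightarrow> g1 p = 0"
    and g1_AE: "AE p in M. g p = g1 p"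
    using lborel_integral_box[OF L2_measurable[OF g]] by blast
  have g1': "g1 \<in> borel_measurable M" by (rule borel_on[OF g1])
  have g1L: "g1 \<in> L2_space (box c d)" by (rule L2_cong_AE[OF g g1' g1_AE])
  have g1m [measurable]: "g1 \<in> borel_measurable (lborel \<Otimes>\<^sub>M lborel)" by (simp add: lborel_prod)
  have i1: "integrable (lborel \<Otimes>\<^sub>M lborel) g1"
    using L2_integrable[OF g1L] M_lborel(1)[OF g1 g1_0] by (simp add: lborel_prod)
  have "integrable M (\<lambda>p. (g1 p)\<^sup>2) \<longleftrightarrow> integrable lborel (\<lambda>p. (g1 p)\<^sup>2)"
    by (rule M_lborel(1)) (simp_all add: g1_0)
  then have i2: "integrable (lborel \<Otimes>\<^sub>M lborel) (\<lambda>p. (g1 p)\<^sup>2)"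
    using L2_square[OF g1L] by (simp add: lborel_prod)
  \<comment> \<open>As \<open>g1\<close> vanishes outside the box, this integrates it along the
    vertical line from the lower face up to \<open>p\<close>.\<close>
  define W where "W p = (LINT s|lborel. (if s \<le> snd p then g1 (fst p, s) else 0))" for p :: "'a \<times> real"
  define V0 where "V0 x = (LINT s|lborel. (g1 (x, s))\<^sup>2)" for x
  define V where "V p = V0 (fst p)" for p :: "'a \<times> real"
  have g1p [measurable]: "(\<lambda>(p, s). g1 (fst p, s)) \<in> borel_measurable ((borel :: ('a \<times> real) measure) \<Otimes>\<^sub>M (borel :: real measure))"
  proof -
    have "(\<lambda>q. (fst (fst q), snd q)) \<in> ((borel :: ('a \<times> real) measure) \<Otimes>\<^sub>M (borel :: real measure)) \<rightarrow>\<^sub>M borel"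
      unfolding borel_prod by (intro borel_measurable_continuous_onI continuous_intros)
    from measurable_compose[OF this g1] show ?thesis by (simp add: case_prod_beta)
  qed
  have Wm [measurable]: "W \<in> borel_measurable borel"
    unfolding W_def[abs_def]
  proof (rule lborel.borel_measurable_lebesgue_integral)
    show "(\<lambda>(p, s). if s \<le> snd p then g1 (fst p, s) else 0) \<in> borel_measurable (borel \<Otimes>\<^sub>M lborel)"
    proof -
      have s: "{q \<in> space (borel \<Otimes>\<^sub>M borel). snd q \<le> snd (fst q)} \<in> sets ((borel :: ('a \<times> real) measure) \<Otimes>\<^sub>M (borel :: real measure))"
      proof -
        have "closed {q :: ('a \<times> real) \<times> real. snd q \<le> snd (fst q)}"
          by (intro closed_Collect_le continuous_intros)
        then show ?thesis unfolding borel_prod by simp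
      qed
      have "(\<lambda>q. if snd q \<le> snd (fst q) then g1 (fst (fst q), snd q) else 0) \<in> borel_measurable ((borel :: ('a \<times> real) measure) \<Otimes>\<^sub>M (borel :: real measure))"
        by (rule measurable_If[OF g1p[unfolded case_prod_unfold] _ s]) simp
      then show ?thesis
        by (simp add: case_prod_unfold measurable_cong_sets[OF sets_pair_measure_cong[OF refl sets_lborel] refl])
    qed
  qed
  have AEx: "AE x in lborel. integrable lborel (\<lambda>s. g1 (x, s)) \<and> integrable lborel (\<lambda>s. (g1 (x, s))\<^sup>2)"
    using lborel_pair.AE_integrable_fst'[OF i1] lborel_pair.AE_integrable_fst'[OF i2] by eventually_elim simp
  have V0: "integrable lborel V0" unfolding V0_def using lborel_pair.integrable_fst'[OF i2] by simp
  have V0_nonneg: "0 \<le> V0 x" for x unfolding V0_def by simp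
  \<comment> \<open>A null set of base points spans a null cylinder; this transfers statements about
    almost every vertical line to almost every point.\<close>
  have AE_lift: "AE p in (lborel :: ('a \<times> real) measure). Q (fst p)" if "AE x in lborel. Q x" for Q :: "'a \<Rightarrow> bool"
  proof -
    from that obtain N where N: "N \<in> null_sets lborel" "{x. \<not> Q x} \<subseteq> N"
      unfolding eventually_ae_filter by auto
    have "N \<times> (UNIV :: real set) \<in> null_sets (lborel \<Otimes>\<^sub>M lborel)"
      using N(1) by (auto simp: null_sets_def lborel.emeasure_pair_measure_Times intro!: pair_measureI)
    then show ?thesis
      using N(2) unfolding lborel_prod by (intro AE_I'[of "N \<times> UNIV"]) auto
  qed
  have W2: "(W (x, z))\<^sup>2 \<le> (z - snd c) * V0 x"
    if x: "integrable lborel (\<lambda>s. g1 (x, s))" "integrable lborel (\<lambda>s. (g1 (x, s))\<^sup>2)" and z: "snd c \<le> z" for x z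
  proof -
    let ?g = "\<lambda>s. if s \<le> z then g1 (x, s) else 0"
    have m: "?g \<in> borel_measurable lborel"
      using x(1)[THEN borel_measurable_integrable] by measurable
    have j1: "integrable lborel ?g" by (rule Bochner_Integration.integrable_bound[OF x(1) m]) auto
    have j2: "integrable lborel (\<lambda>s. (?g s)\<^sup>2)" 
      by (rule Bochner_Integration.integrable_bound[OF x(2) borel_measurable_power[OF m]]) auto
    have "(W (x, z))\<^sup>2 \<le> (z - snd c) * (LINT s|lborel. (?g s)\<^sup>2)"
      unfolding W_def fst_conv snd_conv
    proof (rule Cauchy_Schwarz_lborel[OF j1 j2 z])
      fix s assume "s \<notin> {snd c..z}"
      then show "?g s = 0" using g1_0[of "(x, s)"] box_snd[of "(x, s)"]
        by (cases "(x, s) \<in> box c d") auto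
    qed
    also have "\<dots> \<le> (z - snd c) * V0 x"
      unfolding V0_def using z by (intro mult_left_mono integral_mono[OF j2 x(2)]) auto
    finally show ?thesis .
  qed
  have W2_AE: "AE p in M. (W p)\<^sup>2 \<le> (snd p - snd c) * V p"
  proof -
    have "AE p in (lebesgue :: ('a \<times> real) measure). integrable lborel (\<lambda>s. g1 (fst p, s)) \<and> integrable lborel (\<lambda>s. (g1 (fst p, s))\<^sup>2)"
      by (rule AE_completion) (rule AE_lift[OF AEx])
    then have "AE p in M. integrable lborel (\<lambda>s. g1 (fst p, s)) \<and> integrable lborel (\<lambda>s. (g1 (fst p, s))\<^sup>2)"
      by (simp add: AE_restrict_space_iff) (auto elim: eventually_mono)
    then show ?thesis using AE_space
    proof eventually_elim
      case (elim p)
      then show ?case using W2[of "fst p" "snd p"] box_snd[of p] by (simp add: V_def)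
    qed
  qed
  have V: "integrable M V"
  proof -
    have V0m [measurable]: "V0 \<in> borel_measurable borel" using borel_measurable_integrable[OF V0] by simp
    let ?F = "\<lambda>p :: 'a \<times> real. V0 (fst p) * indicator {snd c..snd d} (snd p)" and ?V1 = "\<lambda>p. indicator (box c d) p * V p"
    have vf: "(\<lambda>p. V0 (fst p)) \<in> borel_measurable (borel :: ('a \<times> real) measure)"
      by (rule measurable_compose[OF _ V0m]) (intro borel_measurable_continuous_onI continuous_intros)
    have "integrable (lborel \<Otimes>\<^sub>M lborel) ?F"
    proof (rule lborel_pair.Fubini_integrable)
      have "(\<lambda>p. indicat_real {snd c..snd d} (snd p)) \<in> borel_measurable (borel :: ('a \<times> real) measure)"
        by (rule measurable_compose[OF borel_measurable_continuous_onI[OF continuous_on_snd[OF continuous_on_id]]]) simp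
      with vf show "?F \<in> borel_measurable (lborel \<Otimes>\<^sub>M lborel)" unfolding lborel_prod by simp
      show "integrable lborel (\<lambda>x. LINT z|lborel. norm (?F (x, z)))"
        using V0 height by (simp add: abs_mult)
      show "AE x in lborel. integrable lborel (\<lambda>z. ?F (x, z))"
        using height by (auto intro!: integrable_real_indicator)
    qed
    then have i: "integrable lborel ?F" by (simp add: lborel_prod)
    have m: "?V1 \<in> borel_measurable borel" unfolding V_def using vf by simp
    have "integrable lborel ?V1"
    proof (rule Bochner_Integration.integrable_bound[OF i])
      show "AE p in lborel. norm (?V1 p) \<le> norm (?F p)"
        using box_snd by (auto simp: V_def indicator_def V0_nonneg less_imp_le)
    qed (use m in simp)
    then have "integrable M ?V1" using m by (subst M_lborel(1)) auto
    moreover have "integrable M ?V1 \<longleftrightarrow> integrable M V" by (rule Bochner_Integration.integrable_cong) auto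
    ultimately show ?thesis by simp
  qed
  have W: "integrable M W"
  proof (rule Bochner_Integration.integrable_bound[of _ "\<lambda>p. 1 + (snd d - snd c) * V p"])
    show "AE p in M. norm (W p) \<le> norm (1 + (snd d - snd c) * V p)"
      using W2_AE AE_space
    proof eventually_elim
      case (elim p)
      have V0p: "0 \<le> V p" by (simp add: V_def V0_nonneg)
      have "\<bar>W p\<bar> \<le> 1 + (W p)\<^sup>2" using abs_mult_le_squares[of 1 "W p"] by simp
      also have "\<dots> \<le> 1 + (snd d - snd c) * V p"
      proof -
        have "(snd p - snd c) * V p \<le> (snd d - snd c) * V p"
          using elim box_snd[of p] V0p by (intro mult_right_mono) auto
        then show ?thesis using elim by simp
      qed
      finally show ?case by simp
    qed
  qed (use V borel_on[OF Wm] in simp_all)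
  \<comment> \<open>\<open>f\<close> and \<open>W\<close> are identified by comparing their
    integrals against box cutoffs: that of \<open>f\<close> is known from \<open>ibp\<close>, that
    of \<open>W\<close> from Fubini.\<close>
  have "AE p in M. f p - W p = 0"
  proof (rule AE_zero_of_boxcut)
    show "integrable M (\<lambda>p. f p - W p)" using W L2_integrable[OF f] by simp
    fix c' d' :: "'a \<times> real" and n :: nat
    assume cd': "cbox c' d' \<subseteq> box c d" and n: "0 < n"
    show "(LINT p|M. (f p - W p) * boxcut n c' d' p) = 0"
    proof (cases "box c' d' = {}")
      case True
      then show ?thesis by (simp add: boxcut_eq_0)
    next
      case False
      then have "d' \<in> cbox c' d'" by (auto simp: box_ne_empty mem_box intro: less_imp_le)
      then have d'_less: "snd d' < snd d" using cd' box_snd by blast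
      let ?k = "cut n (snd c') (snd d')" and ?o = "othercut ez n c' d'" and ?b = "boxcut n c' d'"
      have b_0: "?b p = 0" if "p \<notin> box c d" for p
        using that cd' box_subset_cbox[of c' d'] by (intro boxcut_eq_0) blast
      have k: "smooth_term ?k" using smooth_term_cut[where b = "1 :: real"] by simp
      have km: "?k \<in> borel_measurable borel" by (rule smooth_term_borel[OF k])
      obtain F where F: "\<And>y. (F has_real_derivative ?k y) (at y)"
        "\<And>(b :: 'a \<times> real) m. smooth_term (\<lambda>x. F (x \<bullet> b) + m)"
        by (rule smooth_term_antiderivative[OF k]) blast
      \<comment> \<open>A vertical antiderivative of the cutoff, normalised to vanish on the upper
        face. It need not vanish near the lower face, which is why \<open>ibp\<close> has to admit
        such test functions.\<close>
      define h where "h p = ?o p * (F (p \<bullet> ez) + (- F (snd d)))" for p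
      have o: "smooth_term ?o"
        unfolding othercut_def[abs_def] by (intro smooth_term_prod smooth_term_cut)
      have h: "smooth_term h" unfolding h_def[abs_def] by (intro smooth_term.mult o F(2))
      have hD: "iter_deriv [ez] h p = ?b p" for p
      proof (rule iter_deriv_1_eq[OF h])
        have eq: "h (p + s *\<^sub>R ez) = ?o p * (F (snd p + s) + (- F (snd d)))" for s
          using othercut_vertical[of n c' d' "fst p" "snd p + s" "snd p"] by (cases p) (simp add: h_def)
        have "((\<lambda>s. F (snd p + s)) has_real_derivative ?k (snd p + 0) * 1) (at 0)"
          by (rule DERIV_chain2[OF F(1)]) (auto intro!: derivative_eq_intros)
        then show "((\<lambda>s. h (p + s *\<^sub>R ez)) has_real_derivative ?b p) (at 0)"
          unfolding eq boxcut_vertical by (auto intro!: derivative_eq_intros)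
      qed
      have F_int: "(LINT z|lborel. ?k z * indicator {s..snd d} z) = F (snd d) - F s" if "s \<le> snd d" for s
        by (rule integral_FTC_Icc_nonneg[OF km F(1) cut_nonneg that])
      have h_bound: "\<bar>h p\<bar> \<le> snd d - snd p" if p: "p \<in> box c d" for p
      proof -
        obtain \<xi> where "F (snd d) - F (snd p) = (snd d - snd p) * ?k \<xi>"
          using MVT2[of "snd p" "snd d" F ?k] F(1) box_snd[OF p] by blast
        then have "\<bar>F (snd p) + - F (snd d)\<bar> = (snd d - snd p) * ?k \<xi>"
          using box_snd[OF p] by (simp add: abs_minus_commute[of "F (snd p)"] abs_mult)
        also have "\<dots> \<le> snd d - snd p" using box_snd[OF p] by (intro mult_left_le) auto
        finally have "\<bar>?o p\<bar> * \<bar>F (snd p) + - F (snd d)\<bar> \<le> 1 * (snd d - snd p)"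
          by (intro mult_mono) auto
        then show ?thesis by (simp add: h_def abs_mult)
      qed
      have hm [measurable]: "h \<in> borel_measurable borel" by (rule smooth_term_borel[OF h])
      have bm [measurable]: "?b \<in> borel_measurable borel" by (rule smooth_term_borel[OF smooth_term_boxcut])
      have "(LINT p|M. g1 p * h p) = (LINT p|M. g p * h p)"
      proof (rule integral_cong_AE)
        show "AE p in M. g1 p * h p = g p * h p" using g1_AE by eventually_elim simp
      qed (use L2_measurable[OF g] g1' borel_on[OF hm] in simp_all)
      also have "\<dots> = - (LINT p|M. f p * ?b p)" using ibp[OF h h_bound] unfolding hD .
      finally have 1: "(LINT p|M. f p * ?b p) = - (LINT p|lborel. g1 p * h p)"
        using M_lborel(2)[of "\<lambda>p. g1 p * h p"] g1_0 by simp
      have gh: "integrable lborel (\<lambda>p. g1 p * h p)"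
        using integrable_mult_smooth[OF h L2_integrable[OF g1L]] M_lborel(1)[of "\<lambda>p. g1 p * h p"] g1_0 by simp
      have Wb: "integrable M (\<lambda>p. W p * ?b p)"
        by (rule integrable_mult_smooth[OF smooth_term_boxcut W])
      then have Wb': "integrable lborel (\<lambda>p. W p * ?b p)"
        using M_lborel(1)[of "\<lambda>p. W p * ?b p"] b_0 by simp
      \<comment> \<open>Exchanging the order on the triangle s <= z leaves \<open>g1\<close> times
        the integral of the cutoff from s to the upper face, which is minus \<open>h\<close> by its
        normalisation.\<close>
      have key: "(LINT z|lborel. W (x, z) * ?b (x, z)) = (LINT s|lborel. - (g1 (x, s) * h (x, s)))"
        if x: "integrable lborel (\<lambda>s. g1 (x, s))" for x
      proof -
        have gx [measurable]: "(\<lambda>s. g1 (x, s)) \<in> borel_measurable borel" using borel_measurable_integrable[OF x] by simp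
        have bx [measurable]: "(\<lambda>z. ?b (x, z)) \<in> borel_measurable borel"
          by (rule measurable_compose[OF _ bm]) (intro borel_measurable_continuous_onI continuous_intros)
        have bi: "integrable lborel (\<lambda>z. ?b (x, z))"
        proof (rule Bochner_Integration.integrable_bound[of _ "\<lambda>z. indicator {snd c..snd d} z :: real"])
          show "AE z in lborel. norm (?b (x, z)) \<le> norm (indicator {snd c..snd d} z :: real)"
          proof (rule AE_I2)
            fix z show "norm (?b (x, z)) \<le> norm (indicator {snd c..snd d} z :: real)"
              using b_0[of "(x, z)"] box_snd[of "(x, z)"] by (cases "(x, z) \<in> box c d") (auto simp: indicator_def)
          qed
        qed (use height in \<open>auto intro!: integrable_real_indicator\<close>)
        let ?G = "\<lambda>s z. (if s \<le> z then g1 (x, s) else 0) * ?b (x, z)"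
        have "integrable (lborel \<Otimes>\<^sub>M lborel) (\<lambda>q. g1 (x, fst q) * ?b (x, snd q))"
        proof (rule lborel_pair.Fubini_integrable)
          show "(\<lambda>q. g1 (x, fst q) * ?b (x, snd q)) \<in> borel_measurable (lborel \<Otimes>\<^sub>M lborel)" by measurable
          show "integrable lborel (\<lambda>s. LINT z|lborel. norm (g1 (x, fst (s, z)) * ?b (x, snd (s, z))))"
            using x bi by (simp add: abs_mult)
          show "AE s in lborel. integrable lborel (\<lambda>z. g1 (x, fst (s, z)) * ?b (x, snd (s, z)))"
            using bi by simp
        qed
        then have "integrable (lborel \<Otimes>\<^sub>M lborel) (case_prod ?G)"
        proof (rule Bochner_Integration.integrable_bound)
          show "case_prod ?G \<in> borel_measurable (lborel \<Otimes>\<^sub>M lborel)" by measurable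
        qed auto
        from lborel_pair.Fubini_integral[OF this]
        have "(LINT z|lborel. LINT s|lborel. ?G s z) = (LINT s|lborel. LINT z|lborel. ?G s z)" .
        also have "(LINT z|lborel. LINT s|lborel. ?G s z) = (LINT z|lborel. W (x, z) * ?b (x, z))"
          by (simp add: W_def cong: if_cong)
        also have "(\<lambda>s. LINT z|lborel. ?G s z) = (\<lambda>s. - (g1 (x, s) * h (x, s)))"
        proof
          fix s
          show "(LINT z|lborel. ?G s z) = - (g1 (x, s) * h (x, s))"
          proof (cases "(x, s) \<in> box c d")
            case True
            then have s: "s \<le> snd d" using box_snd by force
            have "?G s z = g1 (x, s) * ?o (x, s) * (?k z * indicator {s..snd d} z)" for z
            proof (cases "z \<le> snd d")
              case True
              then show ?thesis
                using othercut_vertical[of n c' d' x z s] by (simp add: boxcut_vertical indicator_def)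
            next
              case False
              then have "(x, z) \<notin> box c d" using box_snd[of "(x, z)"] by auto
              then show ?thesis using b_0 False by simp
            qed
            then have "(LINT z|lborel. ?G s z) = g1 (x, s) * ?o (x, s) * (F (snd d) - F s)"
              by (simp add: F_int[OF s])
            then show ?thesis by (simp add: h_def algebra_simps)
          next
            case False
            then have "g1 (x, s) = 0" by (rule g1_0)
            then show ?thesis by (simp cong: if_cong)
          qed
        qed
        finally show ?thesis .
      qed
      have "(LINT p|M. W p * ?b p) = (LINT p|lborel. W p * ?b p)"
        by (rule M_lborel(2)) (simp_all add: b_0)
      also have "\<dots> = (LINT x|lborel. LINT z|lborel. W (x, z) * ?b (x, z))"
        using lborel_pair.integral_fst'[of "\<lambda>p. W p * ?b p"] Wb' by (simp add: lborel_prod)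
      also have "\<dots> = (LINT x|lborel. LINT s|lborel. - (g1 (x, s) * h (x, s)))"
      proof (rule integral_cong_AE)
        show "AE x in lborel. (LINT z|lborel. W (x, z) * ?b (x, z)) = (LINT s|lborel. - (g1 (x, s) * h (x, s)))"
          using AEx by eventually_elim (simp add: key)
        show "(\<lambda>x. LINT z|lborel. W (x, z) * ?b (x, z)) \<in> borel_measurable lborel"
          using lborel_pair.integrable_fst'[of "\<lambda>p. W p * ?b p"] Wb' by (intro borel_measurable_integrable) (simp add: lborel_prod)
        show "(\<lambda>x. LINT s|lborel. - (g1 (x, s) * h (x, s))) \<in> borel_measurable lborel"
          using lborel_pair.integrable_fst'[of "\<lambda>p. - (g1 p * h p)"] gh by (intro borel_measurable_integrable) (simp add: lborel_prod)
      qed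
      also have "\<dots> = - (LINT p|lborel. g1 p * h p)"
        using lborel_pair.integral_fst'[of "\<lambda>p. - (g1 p * h p)"] gh by (simp add: lborel_prod)
      finally have "(LINT p|M. W p * ?b p) = (LINT p|M. f p * ?b p)" using 1 by simp
      then show ?thesis
        using Wb integrable_mult_smooth[OF smooth_term_boxcut L2_integrable[OF f]] by (simp add: left_diff_distrib)
    qed
  qed
  with W2_AE have "AE p in M. (f p)\<^sup>2 \<le> (snd p - snd c) * V p" by eventually_elim simp
  with V show thesis by (rule that)
qed

end

section \<open>Differentiation in time\<close>

text \<open>The quotient is the derivative of ln (y^2 + \<delta>) / 2. The bound follows from
  \<bar>y\<bar> <= y^2 + 1 and \<delta> <= 1; its size in \<delta> is harmless since \<delta> is
  fixed while differentiating in time.\<close>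

lemma entropy_slope_bound:
  fixes y \<delta> :: real assumes "0 < \<delta>" "\<delta> \<le> 1"
  shows "\<bar>y / (y\<^sup>2 + \<delta>)\<bar> \<le> 1 / \<delta>"
proof -
  have pos: "0 < y\<^sup>2 + \<delta>" using assms by (simp add: add_nonneg_pos)
  have "0 \<le> (\<bar>y\<bar> - 1)\<^sup>2" by simp
  then have "2 * \<bar>y\<bar> \<le> y\<^sup>2 + 1" by (simp add: power2_diff)
  then have "\<bar>y\<bar> \<le> y\<^sup>2 + 1" by linarith
  then have "\<delta> * \<bar>y\<bar> \<le> \<delta> * y\<^sup>2 + \<delta>" using assms mult_left_mono[of "\<bar>y\<bar>" "y\<^sup>2 + 1" \<delta>] by (simp add: distrib_left)
  also have "\<dots> \<le> y\<^sup>2 + \<delta>" using assms mult_right_mono[of \<delta> 1 "y\<^sup>2"] by simp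
  finally have "\<bar>y\<bar> \<le> (y\<^sup>2 + \<delta>) / \<delta>" using assms by (simp add: field_simps)
  then show ?thesis using pos assms by (simp add: abs_div_pos[symmetric] field_simps)
qed

lemma entropy_slope_Lipschitz:
  fixes y z \<delta> :: real assumes "0 < \<delta>"
  shows "\<bar>y / (y\<^sup>2 + \<delta>) - z / (z\<^sup>2 + \<delta>)\<bar> \<le> \<bar>y - z\<bar> / \<delta>"
proof -
  have pos: "0 < y\<^sup>2 + \<delta>" "0 < z\<^sup>2 + \<delta>" using assms by (simp_all add: add_nonneg_pos)
  have eq: "y / (y\<^sup>2 + \<delta>) - z / (z\<^sup>2 + \<delta>) = (y - z) * ((\<delta> - y * z) / ((y\<^sup>2 + \<delta>) * (z\<^sup>2 + \<delta>)))"
    using pos by (simp add: divide_simps) (simp add: power2_eq_square algebra_simps)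
  have "\<bar>\<delta> - y * z\<bar> * \<delta> \<le> (\<delta> + (y\<^sup>2 + z\<^sup>2)) * \<delta>"
    using abs_mult_le_squares[of y z] assms by (intro mult_right_mono) auto
  also have "\<dots> \<le> (y\<^sup>2 + \<delta>) * (z\<^sup>2 + \<delta>)"
  proof -
    have "0 \<le> y\<^sup>2 * z\<^sup>2" by simp
    then show ?thesis by (simp add: algebra_simps)
  qed
  finally have "\<bar>\<delta> - y * z\<bar> / ((y\<^sup>2 + \<delta>) * (z\<^sup>2 + \<delta>)) \<le> 1 / \<delta>"
    using pos assms by (simp add: divide_simps mult_ac)
  then have "\<bar>(\<delta> - y * z) / ((y\<^sup>2 + \<delta>) * (z\<^sup>2 + \<delta>))\<bar> \<le> 1 / \<delta>"
    using pos by (simp add: abs_mult)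
  from mult_left_mono[OF this abs_ge_zero[of "y - z"]] show ?thesis unfolding eq abs_mult by simp
qed

text \<open>The mean value theorem gives the slope at an intermediate point, and the Lipschitz bound
  compares it with the slope at \<open>q\<close>. A quadratic remainder is what suits a curve that
  is differentiable in L2 only.\<close>

lemma entropy_taylor:
  fixes p q \<delta> :: real assumes "0 < \<delta>"
  shows "\<bar>ln (p\<^sup>2 + \<delta>) / 2 - ln (q\<^sup>2 + \<delta>) / 2 - q / (q\<^sup>2 + \<delta>) * (p - q)\<bar> \<le> (p - q)\<^sup>2 / \<delta>"
proof -
  define G where "G y = ln (y\<^sup>2 + \<delta>) / 2" for y
  have D: "(G has_real_derivative y / (y\<^sup>2 + \<delta>)) (at y)" for y
  proof -
    have "0 < y\<^sup>2 + \<delta>" using assms by (simp add: add_nonneg_pos)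
    then show ?thesis unfolding G_def by (auto intro!: derivative_eq_intros simp: field_simps)
  qed
  have "\<exists>\<xi>. \<bar>\<xi> - q\<bar> \<le> \<bar>p - q\<bar> \<and> G p - G q = (p - q) * (\<xi> / (\<xi>\<^sup>2 + \<delta>))"
  proof (cases p q rule: linorder_cases)
    case less
    then obtain \<xi> where "p < \<xi>" "\<xi> < q" "G q - G p = (q - p) * (\<xi> / (\<xi>\<^sup>2 + \<delta>))"
      using MVT2[of p q G "\<lambda>y. y / (y\<^sup>2 + \<delta>)"] D by auto
    then have "G p - G q = - ((q - p) * (\<xi> / (\<xi>\<^sup>2 + \<delta>)))" by simp
    also have "\<dots> = (p - q) * (\<xi> / (\<xi>\<^sup>2 + \<delta>))" by (simp only: mult_minus_left[symmetric] minus_diff_eq)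
    finally show ?thesis using \<open>p < \<xi>\<close> \<open>\<xi> < q\<close> by (intro exI[of _ \<xi>]) auto
  next
    case greater
    then obtain \<xi> where "q < \<xi>" "\<xi> < p" "G p - G q = (p - q) * (\<xi> / (\<xi>\<^sup>2 + \<delta>))"
      using MVT2[of q p G "\<lambda>y. y / (y\<^sup>2 + \<delta>)"] D by auto
    then show ?thesis by (intro exI[of _ \<xi>]) auto
  qed auto
  then obtain \<xi> where \<xi>: "\<bar>\<xi> - q\<bar> \<le> \<bar>p - q\<bar>" "G p - G q = (p - q) * (\<xi> / (\<xi>\<^sup>2 + \<delta>))" by blast
  have "\<bar>G p - G q - q / (q\<^sup>2 + \<delta>) * (p - q)\<bar> = \<bar>p - q\<bar> * \<bar>\<xi> / (\<xi>\<^sup>2 + \<delta>) - q / (q\<^sup>2 + \<delta>)\<bar>"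
    unfolding \<xi>(2) abs_mult[symmetric] by (simp add: right_diff_distrib mult.commute)
  also have "\<dots> \<le> \<bar>p - q\<bar> * (\<bar>p - q\<bar> / \<delta>)"
    using \<xi>(1) assms
    by (intro mult_left_mono order_trans[OF entropy_slope_Lipschitz[OF assms, of \<xi> q]] divide_right_mono) auto
  also have "\<dots> = (p - q)\<^sup>2 / \<delta>" by (simp add: power2_eq_square)
  finally show ?thesis unfolding G_def .
qed

section \<open>Functionals along differentiable curves in Sobolev spaces\<close>

context bounded_domain
begin

lemma Cauchy_Schwarz_L2:
  assumes f: "f \<in> L2_space \<Omega>" and g: "g \<in> L2_space \<Omega>"
  shows "\<bar>LINT x|M. f x * g x\<bar> \<le> sqrt (LINT x|M. (f x)\<^sup>2) * sqrt (LINT x|M. (g x)\<^sup>2)"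
proof -
  define A B C where "A = (LINT x|M. (f x)\<^sup>2)" and "B = (LINT x|M. f x * g x)" and "C = (LINT x|M. (g x)\<^sup>2)"
  note int = L2_square[OF f] L2_square[OF g] L2_mult_integrable[OF f g]
  have quad: "0 \<le> A + 2 * r * B + r\<^sup>2 * C" for r
  proof -
    have "0 \<le> (LINT x|M. (f x)\<^sup>2 + 2 * r * (f x * g x) + r\<^sup>2 * (g x)\<^sup>2)"
    proof (rule integral_nonneg_AE, rule AE_I2)
      fix x
      have "0 \<le> (f x + r * g x)\<^sup>2" by simp
      then show "0 \<le> (f x)\<^sup>2 + 2 * r * (f x * g x) + r\<^sup>2 * (g x)\<^sup>2"
        by (simp add: power2_sum power_mult_distrib algebra_simps)
    qed
    also have "\<dots> = A + 2 * r * B + r\<^sup>2 * C"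
      using int by (simp add: A_def B_def C_def)
    finally show ?thesis .
  qed
  have AC: "0 \<le> A" "0 \<le> C" unfolding A_def C_def by simp_all
  have "B\<^sup>2 \<le> A * C"
  proof (cases "C = 0")
    case True
    have "B = 0"
    proof (rule ccontr)
      assume "B \<noteq> 0"
      \<comment> \<open>For \<open>C = 0\<close> the quadratic is linear in r, and at this r it
        takes the value -1.\<close>
      with quad[of "- (A + 1) / (2 * B)"] True show False by (simp add: field_simps)
    qed
    then show ?thesis using True by simp
  next
    case False
    then have "0 < C" using AC by simp
    \<comment> \<open>The minimiser of the quadratic.\<close>
    with quad[of "- B / C"] show ?thesis
      by (simp add: field_simps power2_eq_square)
  qed
  then have "sqrt (B\<^sup>2) \<le> sqrt (A * C)" by (rule real_sqrt_le_mono)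
  then show ?thesis by (simp add: A_def B_def C_def real_sqrt_mult)
qed

lemma C1_curve_props:
  assumes "C1_curve k \<Omega> T u v" "t \<in> time_interval T"
  shows C1_curve_sobolev: "u t \<in> sobolev k \<Omega>" "v t \<in> sobolev k \<Omega>"
    and "((\<lambda>s. sobolev_norm k \<Omega> (\<lambda>x. (u s x - u t x) / (s - t) - v t x)) \<longlongrightarrow> 0) (at t within time_interval T)"
  using assms unfolding C1_curve_def by blast+

text \<open>Almost everywhere, the weak derivative of the difference quotient is the difference
  quotient of the weak derivatives, and its L2 norm is one of the summands in the Sobolev
  norm.\<close>

lemma C1_curve_deriv_L2:
  assumes C: "C1_curve k \<Omega> T u v" and t: "t \<in> time_interval T" and es: "es \<in> derivs_upto k"
  shows "((\<lambda>s. LINT x|M. ((weak_deriv \<Omega> es (u s) x - weak_deriv \<Omega> es (u t) x) / (s - t) - weak_deriv \<Omega> es (v t) x)\<^sup>2) \<longlongrightarrow> 0)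
     (at t within time_interval T)"
proof -
  let ?I = "time_interval T"
  let ?q = "\<lambda>s x. (u s x - u t x) / (s - t) - v t x"
  let ?d = "\<lambda>s x. (weak_deriv \<Omega> es (u s) x - weak_deriv \<Omega> es (u t) x) / (s - t) - weak_deriv \<Omega> es (v t) x"
  have "((\<lambda>s. (sobolev_norm k \<Omega> (?q s))\<^sup>2) \<longlongrightarrow> 0\<^sup>2) (at t within ?I)"
    by (intro tendsto_power C1_curve_props(3)[OF C t])
  then have lim: "((\<lambda>s. (sobolev_norm k \<Omega> (?q s))\<^sup>2) \<longlongrightarrow> 0) (at t within ?I)" by simp
  have le: "(LINT x|M. (?d s x)\<^sup>2) \<le> (sobolev_norm k \<Omega> (?q s))\<^sup>2" if s: "s \<in> ?I" for s
  proof -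
    note us = C1_curve_sobolev(1)[OF C s] and ut = C1_curve_sobolev(1)[OF C t] and vt = C1_curve_sobolev(2)[OF C t]
    define w where "w = (\<lambda>x. 1 * u s x + (-1) * u t x)"
    have w: "w \<in> sobolev k \<Omega>" unfolding w_def by (rule sobolev_lincomb(1)[OF us ut])
    have qw: "?q s = (\<lambda>x. (1 / (s - t)) * w x + (-1) * v t x)"
      by (simp add: w_def fun_eq_iff diff_divide_distrib)
    have q: "?q s \<in> sobolev k \<Omega>" unfolding qw by (rule sobolev_lincomb(1)[OF w vt])
    have ae: "AE x in M. weak_deriv \<Omega> es (?q s) x = ?d s x"
      using sobolev_lincomb(2)[OF us ut es, of 1 "-1"] sobolev_lincomb(2)[OF w vt es, of "1 / (s - t)" "-1"]
      unfolding qw[symmetric] w_def[symmetric] by eventually_elim simp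
    have L2s: "weak_deriv \<Omega> es (u s) \<in> L2_space \<Omega>" "weak_deriv \<Omega> es (u t) \<in> L2_space \<Omega>" "weak_deriv \<Omega> es (v t) \<in> L2_space \<Omega>"
      "weak_deriv \<Omega> es (?q s) \<in> L2_space \<Omega>"
      by (rule weak_deriv_L2[OF us es] weak_deriv_L2[OF ut es] weak_deriv_L2[OF vt es] weak_deriv_L2[OF q es])+
    note [measurable] = L2s[THEN L2_measurable]
    have "(LINT x|M. (?d s x)\<^sup>2) = (LINT x|M. (weak_deriv \<Omega> es (?q s) x)\<^sup>2)"
    proof (rule integral_cong_AE)
      show "AE x in M. (?d s x)\<^sup>2 = (weak_deriv \<Omega> es (?q s) x)\<^sup>2" using ae by eventually_elim simp
    qed measurable
    also have "\<dots> \<le> (sobolev_norm k \<Omega> (?q s))\<^sup>2" by (rule weak_deriv_le_sobolev_norm[OF es])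
    finally show ?thesis .
  qed
  show ?thesis
  proof (rule tendsto_sandwich[OF _ _ tendsto_const[of 0] lim])
    show "\<forall>\<^sub>F s in at t within ?I. (LINT x|M. (?d s x)\<^sup>2) \<le> (sobolev_norm k \<Omega> (?q s))\<^sup>2"
      unfolding eventually_at_filter using le by (intro always_eventually) blast
  qed simp
qed

lemma weak_deriv_C1:
  assumes C: "C1_curve k \<Omega> T u v" and t: "t \<in> time_interval T" and es: "es \<in> derivs_upto k"
  shows "weak_deriv \<Omega> es (u t) \<in> L2_space \<Omega>" "weak_deriv \<Omega> es (v t) \<in> L2_space \<Omega>"
  by (rule weak_deriv_L2[OF _ es], rule C1_curve_sobolev[OF C t])+

lemma difference_quotient_L2:
  assumes "f \<in> L2_space \<Omega>" "g \<in> L2_space \<Omega>" "h \<in> L2_space \<Omega>"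
  shows "(\<lambda>x. (f x - g x) / r - h x) \<in> L2_space \<Omega>"
proof -
  have "(\<lambda>x. 1 * ((1 / r) * f x + (- 1 / r) * g x) + (-1) * h x) \<in> L2_space \<Omega>"
    by (intro L2_lincomb assms)
  then show ?thesis by (simp add: diff_divide_distrib)
qed

text \<open>Pairing with a fixed square-integrable function is a continuous linear functional, by
  Cauchy-Schwarz. All functionals linear in \<open>u\<close> or \<open>\<psi>\<close> are
  differentiated in time through this.\<close>

lemma C1_curve_pairing_deriv:
  assumes C: "C1_curve k \<Omega> T u v" and t: "t \<in> time_interval T" and es: "es \<in> derivs_upto k"
    and w: "w \<in> L2_space \<Omega>"
  shows "((\<lambda>t. LINT x|M. weak_deriv \<Omega> es (u t) x * w x) has_real_derivative
      (LINT x|M. weak_deriv \<Omega> es (v t) x * w x)) (at t within time_interval T)"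
proof -
  let ?I = "time_interval T"
  let ?d = "\<lambda>s x. (weak_deriv \<Omega> es (u s) x - weak_deriv \<Omega> es (u t) x) / (s - t) - weak_deriv \<Omega> es (v t) x"
  let ?q = "\<lambda>s. ((LINT x|M. weak_deriv \<Omega> es (u s) x * w x) - (LINT x|M. weak_deriv \<Omega> es (u t) x * w x)) / (s - t)"
  let ?D = "LINT x|M. weak_deriv \<Omega> es (v t) x * w x"
  have eq: "?q s - ?D = (LINT x|M. ?d s x * w x)" if s: "s \<in> ?I" for s
  proof -
    have i: "integrable M (\<lambda>x. weak_deriv \<Omega> es (u s) x * w x)" "integrable M (\<lambda>x. weak_deriv \<Omega> es (u t) x * w x)"
      "integrable M (\<lambda>x. weak_deriv \<Omega> es (v t) x * w x)"
      by (rule L2_mult_integrable[OF _ w], rule weak_deriv_C1[OF C _ es], rule s t)+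
    have "(LINT x|M. ?d s x * w x) = (LINT x|M. (weak_deriv \<Omega> es (u s) x * w x - weak_deriv \<Omega> es (u t) x * w x) / (s - t) - weak_deriv \<Omega> es (v t) x * w x)"
      by (simp add: left_diff_distrib diff_divide_distrib)
    also have "\<dots> = ?q s - ?D" using i by simp
    finally show ?thesis ..
  qed
  have "((\<lambda>s. sqrt (LINT x|M. (?d s x)\<^sup>2) * sqrt (LINT x|M. (w x)\<^sup>2)) \<longlongrightarrow> sqrt 0 * sqrt (LINT x|M. (w x)\<^sup>2)) (at t within ?I)"
    by (intro tendsto_mult tendsto_real_sqrt C1_curve_deriv_L2[OF C t es] tendsto_const)
  then have lim: "((\<lambda>s. sqrt (LINT x|M. (?d s x)\<^sup>2) * sqrt (LINT x|M. (w x)\<^sup>2)) \<longlongrightarrow> 0) (at t within ?I)" by simp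
  have "((\<lambda>s. ?q s - ?D) \<longlongrightarrow> 0) (at t within ?I)"
  proof (rule tendsto_0_le[OF lim, where K = 1])
    show "\<forall>\<^sub>F s in at t within ?I. norm (?q s - ?D) \<le> norm (sqrt (LINT x|M. (?d s x)\<^sup>2) * sqrt (LINT x|M. (w x)\<^sup>2)) * 1"
      unfolding eventually_at_filter
    proof (intro always_eventually allI impI)
      fix s assume "s \<in> ?I"
      then have "?d s \<in> L2_space \<Omega>"
        by (intro difference_quotient_L2 weak_deriv_C1[OF C _ es] t)
      from Cauchy_Schwarz_L2[OF this w] show "norm (?q s - ?D) \<le> norm (sqrt (LINT x|M. (?d s x)\<^sup>2) * sqrt (LINT x|M. (w x)\<^sup>2)) * 1"
        unfolding eq[OF \<open>s \<in> ?I\<close>] by (simp add: abs_mult)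
    qed
  qed
  then show ?thesis
    unfolding has_field_derivative_iff using LIM_zero_iff by blast
qed

text \<open>The increment is s - t times the sum of the quotient error and the derivative, and this
  sum stays bounded in L2.\<close>

lemma C1_curve_L2_continuous:
  assumes C: "C1_curve k \<Omega> T u v" and t: "t \<in> time_interval T" and es: "es \<in> derivs_upto k"
  shows "((\<lambda>s. LINT x|M. (weak_deriv \<Omega> es (u s) x - weak_deriv \<Omega> es (u t) x)\<^sup>2) \<longlongrightarrow> 0) (at t within time_interval T)"
proof -
  let ?I = "time_interval T"
  let ?d = "\<lambda>s x. (weak_deriv \<Omega> es (u s) x - weak_deriv \<Omega> es (u t) x) / (s - t) - weak_deriv \<Omega> es (v t) x"
  let ?V = "LINT x|M. (weak_deriv \<Omega> es (v t) x)\<^sup>2"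
  have "((\<lambda>s. 2 * (s - t)\<^sup>2 * ((LINT x|M. (?d s x)\<^sup>2) + ?V)) \<longlongrightarrow> 2 * (t - t)\<^sup>2 * (0 + ?V)) (at t within ?I)"
    by (intro tendsto_intros C1_curve_deriv_L2[OF C t es])
  then have lim: "((\<lambda>s. 2 * (s - t)\<^sup>2 * ((LINT x|M. (?d s x)\<^sup>2) + ?V)) \<longlongrightarrow> 0) (at t within ?I)" by simp
  show ?thesis
  proof (rule tendsto_sandwich[OF _ _ tendsto_const[of 0] lim])
    show "\<forall>\<^sub>F s in at t within ?I. (LINT x|M. (weak_deriv \<Omega> es (u s) x - weak_deriv \<Omega> es (u t) x)\<^sup>2)
      \<le> 2 * (s - t)\<^sup>2 * ((LINT x|M. (?d s x)\<^sup>2) + ?V)"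
      unfolding eventually_at_filter
    proof (intro always_eventually allI impI)
      fix s assume st: "s \<noteq> t" and s: "s \<in> ?I"
      have d: "?d s \<in> L2_space \<Omega>"
        using s by (intro difference_quotient_L2 weak_deriv_C1[OF C _ es] t)
      note i = L2_square[OF d] L2_square[OF weak_deriv_C1(2)[OF C t es]]
      have L: "(\<lambda>x. 1 * weak_deriv \<Omega> es (u s) x + (-1) * weak_deriv \<Omega> es (u t) x) \<in> L2_space \<Omega>"
        by (intro L2_lincomb weak_deriv_C1[OF C _ es] s t)
      have "(LINT x|M. (weak_deriv \<Omega> es (u s) x - weak_deriv \<Omega> es (u t) x)\<^sup>2)
        \<le> (LINT x|M. 2 * (s - t)\<^sup>2 * ((?d s x)\<^sup>2 + (weak_deriv \<Omega> es (v t) x)\<^sup>2))"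
      proof (rule integral_mono)
        show "integrable M (\<lambda>x. (weak_deriv \<Omega> es (u s) x - weak_deriv \<Omega> es (u t) x)\<^sup>2)"
          using L2_square[OF L] by simp
        show "integrable M (\<lambda>x. 2 * (s - t)\<^sup>2 * ((?d s x)\<^sup>2 + (weak_deriv \<Omega> es (v t) x)\<^sup>2))"
          by (intro integrable_mult_right Bochner_Integration.integrable_add i)
        have sq: "(p + q)\<^sup>2 \<le> 2 * (p\<^sup>2 + q\<^sup>2)" for p q :: real
          using sum_squares_bound[of p q] by (simp add: power2_sum)
        fix x
        have "weak_deriv \<Omega> es (u s) x - weak_deriv \<Omega> es (u t) x = (s - t) * (?d s x + weak_deriv \<Omega> es (v t) x)"
          using st by simp
        from arg_cong[OF this, of "\<lambda>x. x\<^sup>2"] have "(weak_deriv \<Omega> es (u s) x - weak_deriv \<Omega> es (u t) x)\<^sup>2 = (s - t)\<^sup>2 * (?d s x + weak_deriv \<Omega> es (v t) x)\<^sup>2"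
          by (rule trans[OF _ power_mult_distrib])
        also have "(s - t)\<^sup>2 * (?d s x + weak_deriv \<Omega> es (v t) x)\<^sup>2 \<le> (s - t)\<^sup>2 * (2 * ((?d s x)\<^sup>2 + (weak_deriv \<Omega> es (v t) x)\<^sup>2))"
          using sq by (intro mult_left_mono zero_le_power2)
        finally show "(weak_deriv \<Omega> es (u s) x - weak_deriv \<Omega> es (u t) x)\<^sup>2 \<le> 2 * (s - t)\<^sup>2 * ((?d s x)\<^sup>2 + (weak_deriv \<Omega> es (v t) x)\<^sup>2)"
          by (simp only: mult_ac)
      qed
      also have "\<dots> = 2 * (s - t)\<^sup>2 * ((LINT x|M. (?d s x)\<^sup>2) + ?V)" using i by simp
      finally show "(LINT x|M. (weak_deriv \<Omega> es (u s) x - weak_deriv \<Omega> es (u t) x)\<^sup>2)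
        \<le> 2 * (s - t)\<^sup>2 * ((LINT x|M. (?d s x)\<^sup>2) + ?V)" .
    qed
  qed simp
qed

text \<open>Needed for the majorant \<open>drift\<close>. The absolute value is not linear in the
  curve, so continuity comes from the reverse triangle inequality and L2 continuity.\<close>

lemma C1_curve_abs_continuous:
  assumes C: "C1_curve k \<Omega> T u v" and es: "es \<in> derivs_upto k"
    and w: "w \<in> L2_space \<Omega>" "\<And>x. x \<in> \<Omega> \<Longrightarrow> 0 \<le> w x"
  shows "continuous_on (time_interval T) (\<lambda>t. LINT x|M. \<bar>weak_deriv \<Omega> es (u t) x\<bar> * w x)"
  unfolding continuous_on_def
proof
  let ?I = "time_interval T"
  fix t assume t: "t \<in> ?I"
  let ?d = "\<lambda>s x. weak_deriv \<Omega> es (u s) x - weak_deriv \<Omega> es (u t) x"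
  let ?a = "\<lambda>s. LINT x|M. \<bar>weak_deriv \<Omega> es (u s) x\<bar> * w x"
  have "((\<lambda>s. sqrt (LINT x|M. (?d s x)\<^sup>2) * sqrt (LINT x|M. (w x)\<^sup>2)) \<longlongrightarrow> sqrt 0 * sqrt (LINT x|M. (w x)\<^sup>2)) (at t within ?I)"
    by (intro tendsto_mult tendsto_real_sqrt C1_curve_L2_continuous[OF C t es] tendsto_const)
  then have lim: "((\<lambda>s. sqrt (LINT x|M. (?d s x)\<^sup>2) * sqrt (LINT x|M. (w x)\<^sup>2)) \<longlongrightarrow> 0) (at t within ?I)" by simp
  have abs_L2: "(\<lambda>x. \<bar>f x\<bar>) \<in> L2_space \<Omega>" if "f \<in> L2_space \<Omega>" for f
    using that borel_measurable_abs[of f M] by (simp add: L2_space_def)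
  have "((\<lambda>s. ?a s - ?a t) \<longlongrightarrow> 0) (at t within ?I)"
  proof (rule tendsto_0_le[OF lim, where K = 1])
    show "\<forall>\<^sub>F s in at t within ?I. norm (?a s - ?a t) \<le> norm (sqrt (LINT x|M. (?d s x)\<^sup>2) * sqrt (LINT x|M. (w x)\<^sup>2)) * 1"
      unfolding eventually_at_filter
    proof (intro always_eventually allI impI)
      fix s assume s: "s \<in> ?I"
      have "(\<lambda>x. 1 * weak_deriv \<Omega> es (u s) x + (-1) * weak_deriv \<Omega> es (u t) x) \<in> L2_space \<Omega>"
        by (intro L2_lincomb weak_deriv_C1[OF C _ es] s t)
      then have d: "?d s \<in> L2_space \<Omega>" by simp
      have i: "integrable M (\<lambda>x. \<bar>weak_deriv \<Omega> es (u s) x\<bar> * w x)" "integrable M (\<lambda>x. \<bar>weak_deriv \<Omega> es (u t) x\<bar> * w x)"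
        "integrable M (\<lambda>x. \<bar>?d s x\<bar> * w x)"
        by (rule L2_mult_integrable[OF abs_L2 w(1)], rule weak_deriv_C1[OF C _ es] d, (rule s t)?)+
      have "\<bar>?a s - ?a t\<bar> = \<bar>LINT x|M. \<bar>weak_deriv \<Omega> es (u s) x\<bar> * w x - \<bar>weak_deriv \<Omega> es (u t) x\<bar> * w x\<bar>"
        using i by simp
      also have "\<dots> \<le> (LINT x|M. \<bar>?d s x\<bar> * w x)"
      proof (rule integral_abs_bound[THEN order_trans], rule integral_mono)
        fix x assume "x \<in> space M"
        then have "0 \<le> w x" using w by simp
        have "\<bar>\<bar>weak_deriv \<Omega> es (u s) x\<bar> * w x - \<bar>weak_deriv \<Omega> es (u t) x\<bar> * w x\<bar>
          = \<bar>\<bar>weak_deriv \<Omega> es (u s) x\<bar> - \<bar>weak_deriv \<Omega> es (u t) x\<bar>\<bar> * w x"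
          using \<open>0 \<le> w x\<close> by (simp add: left_diff_distrib[symmetric] abs_mult)
        also have "\<dots> \<le> \<bar>?d s x\<bar> * w x" using \<open>0 \<le> w x\<close> abs_triangle_ineq3 by (rule mult_right_mono[rotated])
        finally show "\<bar>\<bar>weak_deriv \<Omega> es (u s) x\<bar> * w x - \<bar>weak_deriv \<Omega> es (u t) x\<bar> * w x\<bar> \<le> \<bar>?d s x\<bar> * w x" .
      qed (use i in auto)
      also have "\<dots> \<le> sqrt (LINT x|M. (?d s x)\<^sup>2) * sqrt (LINT x|M. (w x)\<^sup>2)"
        using Cauchy_Schwarz_L2[OF abs_L2[OF d] w(1)] by simp
      finally show "norm (?a s - ?a t) \<le> norm (sqrt (LINT x|M. (?d s x)\<^sup>2) * sqrt (LINT x|M. (w x)\<^sup>2)) * 1"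
        by simp
    qed
  qed
  then show "(?a \<longlongrightarrow> ?a t) (at t within ?I)" using LIM_zero_iff by blast
qed

text \<open>The inequality ln z <= z - 1, applied to z and to 1 / z, bounds the logarithm on both
  sides; 1 / z is at most 1 / \<delta>.\<close>

lemma entropy_integrable:
  assumes f: "f \<in> L2_space \<Omega>" and w: "w \<in> borel_measurable M" "\<And>x. x \<in> \<Omega> \<Longrightarrow> \<bar>w x\<bar> \<le> B" and \<delta>: "0 < \<delta>" "\<delta> \<le> 1"
  shows "integrable M (\<lambda>x. ln ((f x)\<^sup>2 + \<delta>) / 2 * w x)"
proof (rule integrable_mult_bounded[OF _ w])
  have [measurable]: "f \<in> borel_measurable M" by (rule L2_measurable[OF f])
  show "integrable M (\<lambda>x. ln ((f x)\<^sup>2 + \<delta>) / 2)"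
  proof (rule Bochner_Integration.integrable_bound[of _ "\<lambda>x. (f x)\<^sup>2 + 1 + 1 / \<delta>"])
    show "AE x in M. norm (ln ((f x)\<^sup>2 + \<delta>) / 2) \<le> norm ((f x)\<^sup>2 + 1 + 1 / \<delta>)"
    proof (rule AE_I2)
      fix x
      let ?z = "(f x)\<^sup>2 + \<delta>"
      have z: "0 < ?z" using \<delta> by (simp add: add_nonneg_pos)
      have neg: "ln (1 / ?z) = - ln ?z" using z by (simp add: ln_div)
      have "ln ?z \<le> ?z - 1" "ln (1 / ?z) \<le> 1 / ?z - 1" using z by (intro ln_le_minus_one; simp)+
      moreover have "0 < 1 / \<delta>" using \<delta> by simp
      moreover have "1 / ?z \<le> 1 / \<delta>" using \<delta> z by (intro divide_left_mono mult_pos_pos) auto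
      ultimately have "\<bar>ln ?z\<bar> \<le> (f x)\<^sup>2 + 1 + 1 / \<delta>" using \<delta> zero_le_power2[of "f x"] unfolding neg
        by linarith
      then show "norm (ln ((f x)\<^sup>2 + \<delta>) / 2) \<le> norm ((f x)\<^sup>2 + 1 + 1 / \<delta>)" by simp
    qed
    show "(\<lambda>x. ln ((f x)\<^sup>2 + \<delta>) / 2) \<in> borel_measurable M" by measurable
  qed (use L2_square[OF f] in simp)
qed

text \<open>Divided by s - t, the quadratic remainder of \<open>entropy_taylor\<close> becomes
  \<bar>s - t\<bar> times an integrable function, and the linear term is a bounded slope times the
  L2 error of the difference quotient. No pointwise differentiability in time is involved.\<close>

lemma C1_curve_entropy_deriv:
  assumes C: "C1_curve k \<Omega> T u v" and t: "t \<in> time_interval T"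
    and w: "w \<in> borel_measurable M" "\<And>x. x \<in> \<Omega> \<Longrightarrow> \<bar>w x\<bar> \<le> B" and \<delta>: "0 < \<delta>" "\<delta> \<le> 1"
  shows "((\<lambda>t. LINT x|M. ln ((u t x)\<^sup>2 + \<delta>) / 2 * w x) has_real_derivative
      (LINT x|M. u t x / ((u t x)\<^sup>2 + \<delta>) * v t x * w x)) (at t within time_interval T)"
proof -
  let ?I = "time_interval T"
  have es: "[] \<in> derivs_upto k" by (simp add: derivs_upto_def)
  let ?G = "\<lambda>y. ln (y\<^sup>2 + \<delta>) / 2" and ?G' = "\<lambda>y. y / (y\<^sup>2 + \<delta>)"
  let ?d = "\<lambda>s x. (weak_deriv \<Omega> [] (u s) x - weak_deriv \<Omega> [] (u t) x) / (s - t) - weak_deriv \<Omega> [] (v t) x"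
  let ?V = "LINT x|M. (v t x)\<^sup>2"
  let ?L = "\<lambda>t. LINT x|M. ?G (u t x) * w x"
  let ?D = "LINT x|M. ?G' (u t x) * v t x * w x"
  have uL: "u s \<in> L2_space \<Omega>" "v s \<in> L2_space \<Omega>" if "s \<in> ?I" for s
    using C1_curve_sobolev[OF C that] sobolev_L2 by auto
  note um [measurable] = uL[OF t, THEN L2_measurable]
  define N where "N s = (LINT x|M. (?d s x)\<^sup>2)" for s
  \<comment> \<open>The first summand bounds the linear error by Cauchy-Schwarz against the constant
    1, the second the quadratic remainder.\<close>
  define R where "R s = B / \<delta> * (sqrt (N s) * sqrt (LINT x|M. 1\<^sup>2) + \<bar>s - t\<bar> * (2 * (N s + ?V)))" for s
  have "(R \<longlongrightarrow> B / \<delta> * (sqrt 0 * sqrt (LINT x|M. 1\<^sup>2) + \<bar>t - t\<bar> * (2 * (0 + ?V)))) (at t within ?I)"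
    unfolding R_def N_def by (intro tendsto_intros C1_curve_deriv_L2[OF C t es])
  then have lim: "(R \<longlongrightarrow> 0) (at t within ?I)" by simp
  have G'm: "(\<lambda>x. ?G' (u t x) * w x) \<in> borel_measurable M" using w(1) by measurable
  have G'b: "\<bar>?G' (u t x) * w x\<bar> \<le> 1 / \<delta> * B" if "x \<in> \<Omega>" for x
    unfolding abs_mult using entropy_slope_bound[OF \<delta>, of "u t x"] w(2)[OF that] \<delta> by (intro mult_mono) auto
  have iD: "integrable M (\<lambda>x. ?G' (u t x) * v t x * w x)"
    using integrable_mult_bounded[OF L2_integrable[OF uL(2)[OF t]] G'm G'b] by (simp add: mult_ac)
  have bound: "\<bar>(?L s - ?L t) / (s - t) - ?D\<bar> \<le> R s" if s: "s \<in> ?I" "s \<noteq> t" for s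
  proof -
    note us [measurable] = uL(1)[OF s(1), THEN L2_measurable]
    define q where "q x = (u s x - u t x) / (s - t) - v t x" for x
    have qL: "q \<in> L2_space \<Omega>" unfolding q_def by (intro difference_quotient_L2 uL s t)
    have Nq: "N s = (LINT x|M. (q x)\<^sup>2)"
      unfolding N_def
    proof (rule integral_cong_AE)
      show "AE x in M. (?d s x)\<^sup>2 = (q x)\<^sup>2"
        using weak_deriv_Nil_AE[OF uL(1)[OF s(1)]] weak_deriv_Nil_AE[OF uL(1)[OF t]] weak_deriv_Nil_AE[OF uL(2)[OF t]]
        by eventually_elim (simp add: q_def)
      have "?d s \<in> L2_space \<Omega>" by (intro difference_quotient_L2 weak_deriv_C1[OF C _ es] s t)
      from L2_measurable[OF this] show "(\<lambda>x. (?d s x)\<^sup>2) \<in> borel_measurable M" by (rule borel_measurable_power)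
      show "(\<lambda>x. (q x)\<^sup>2) \<in> borel_measurable M" by (rule borel_measurable_power[OF L2_measurable[OF qL]])
    qed
    have alg: "(P * y - Q * y) / r - g * v * y = ((P - Q - g * d) / r + g * (d / r - v)) * y" if "r \<noteq> 0" for P Q y r g v d :: real
      using that by (simp add: field_simps)
    have alg2: "(X / \<delta> + 1 / \<delta> * Q) * B = B / \<delta> * (Q * 1 + X)" for X Q
      using \<delta> by (simp add: field_simps)
    have oneL: "(\<lambda>x. 1) \<in> L2_space \<Omega>" by (rule L2_bounded[of _ 1]) auto
    have absL: "(\<lambda>x. \<bar>q x\<bar>) \<in> L2_space \<Omega>" using qL borel_measurable_abs[of q M] by (simp add: L2_space_def)
    note ints = entropy_integrable[OF uL(1)[OF s(1)] w \<delta>] entropy_integrable[OF uL(1)[OF t] w \<delta>] iD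
    have eq: "(?L s - ?L t) / (s - t) - ?D
       = (LINT x|M. (?G (u s x) * w x - ?G (u t x) * w x) / (s - t) - ?G' (u t x) * v t x * w x)"
      using ints by simp
    have "\<bar>(?L s - ?L t) / (s - t) - ?D\<bar> \<le> (LINT x|M. B / \<delta> * (\<bar>q x\<bar> * 1 + \<bar>s - t\<bar> * (2 * ((q x)\<^sup>2 + (v t x)\<^sup>2))))"
      unfolding eq
    proof (rule integral_abs_bound[THEN order_trans], rule integral_mono)
      show "integrable M (\<lambda>x. \<bar>(?G (u s x) * w x - ?G (u t x) * w x) / (s - t) - ?G' (u t x) * v t x * w x\<bar>)"
        using ints by (intro integrable_abs Bochner_Integration.integrable_diff integrable_divide)
      show "integrable M (\<lambda>x. B / \<delta> * (\<bar>q x\<bar> * 1 + \<bar>s - t\<bar> * (2 * ((q x)\<^sup>2 + (v t x)\<^sup>2))))"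
        by (intro integrable_mult_right Bochner_Integration.integrable_add L2_mult_integrable[OF absL oneL] L2_square qL uL t)
      fix x assume "x \<in> space M"
      then have x: "x \<in> \<Omega>" by simp
      let ?E = "?G (u s x) - ?G (u t x) - ?G' (u t x) * (u s x - u t x)"
      have "(?G (u s x) * w x - ?G (u t x) * w x) / (s - t) - ?G' (u t x) * v t x * w x
        = (?E / (s - t) + ?G' (u t x) * q x) * w x"
        unfolding q_def by (rule alg) (use s(2) in simp)
      also have "\<bar>\<dots>\<bar> \<le> (\<bar>s - t\<bar> * (2 * ((q x)\<^sup>2 + (v t x)\<^sup>2)) / \<delta> + 1 / \<delta> * \<bar>q x\<bar>) * B"
        unfolding abs_mult
      proof (intro mult_mono w(2) x)
        have st: "0 < \<bar>s - t\<bar>" using s(2) by simp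
        have "u s x - u t x = (s - t) * (q x + v t x)" using s(2) by (simp add: q_def)
        then have "(u s x - u t x)\<^sup>2 = \<bar>s - t\<bar> * (\<bar>s - t\<bar> * (q x + v t x)\<^sup>2)"
          by (simp add: power_mult_distrib power2_eq_square abs_mult_self_eq mult.assoc[symmetric])
        also have "\<dots> \<le> \<bar>s - t\<bar> * (\<bar>s - t\<bar> * (2 * ((q x)\<^sup>2 + (v t x)\<^sup>2)))"
          using sum_squares_bound[of "q x" "v t x"] by (intro mult_left_mono) (auto simp: power2_sum)
        finally have sq: "(u s x - u t x)\<^sup>2 / \<delta> \<le> \<bar>s - t\<bar> * (\<bar>s - t\<bar> * (2 * ((q x)\<^sup>2 + (v t x)\<^sup>2))) / \<delta>"
          using \<delta> by (intro divide_right_mono) auto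
        have "\<bar>?E\<bar> \<le> \<bar>s - t\<bar> * (\<bar>s - t\<bar> * (2 * ((q x)\<^sup>2 + (v t x)\<^sup>2)) / \<delta>)"
          using order_trans[OF entropy_taylor[OF \<delta>(1)] sq] by simp
        then have "\<bar>?E / (s - t)\<bar> \<le> \<bar>s - t\<bar> * (2 * ((q x)\<^sup>2 + (v t x)\<^sup>2)) / \<delta>"
          using st by (simp only: abs_divide pos_divide_le_eq mult.commute)
        moreover have "\<bar>?G' (u t x) * q x\<bar> \<le> 1 / \<delta> * \<bar>q x\<bar>"
          unfolding abs_mult by (intro mult_right_mono entropy_slope_bound \<delta>) auto
        ultimately show "\<bar>?E / (s - t) + ?G' (u t x) * q x\<bar> \<le> \<bar>s - t\<bar> * (2 * ((q x)\<^sup>2 + (v t x)\<^sup>2)) / \<delta> + 1 / \<delta> * \<bar>q x\<bar>"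
          by linarith
      qed (use \<delta> in auto)
      also have "\<dots> = B / \<delta> * (\<bar>q x\<bar> * 1 + \<bar>s - t\<bar> * (2 * ((q x)\<^sup>2 + (v t x)\<^sup>2)))"
        by (rule alg2)
      finally show "\<bar>(?G (u s x) * w x - ?G (u t x) * w x) / (s - t) - ?G' (u t x) * v t x * w x\<bar>
        \<le> B / \<delta> * (\<bar>q x\<bar> * 1 + \<bar>s - t\<bar> * (2 * ((q x)\<^sup>2 + (v t x)\<^sup>2)))" .
    qed
    also have "\<dots> = B / \<delta> * ((LINT x|M. \<bar>q x\<bar> * 1) + \<bar>s - t\<bar> * (2 * (N s + ?V)))"
    proof -
      note i = L2_square[OF qL] L2_square[OF uL(2)[OF t]]
      have i': "integrable M (\<lambda>x. \<bar>s - t\<bar> * (2 * ((q x)\<^sup>2 + (v t x)\<^sup>2)))"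
        by (intro integrable_mult_right Bochner_Integration.integrable_add i)
      show ?thesis
        unfolding Nq integral_mult_right_zero Bochner_Integration.integral_add[OF L2_mult_integrable[OF absL oneL] i']
          Bochner_Integration.integral_add[OF i] ..
    qed
    also have "\<dots> \<le> R s"
    \<comment> \<open>\<open>B\<close> is known to be nonnegative only if the domain has a point;
      over the empty domain both sides are zero.\<close>
    proof (cases "\<exists>x. x \<in> \<Omega>")
      case True
      then have "0 \<le> B" using w(2) by (meson abs_ge_zero order_trans)
      moreover have "(LINT x|M. \<bar>q x\<bar> * 1) \<le> sqrt (N s) * sqrt (LINT x|M. 1\<^sup>2)"
        using abs_le_D1[OF Cauchy_Schwarz_L2[OF absL oneL]] unfolding Nq by simp
      ultimately show ?thesis unfolding R_def using \<delta> by (intro mult_left_mono add_right_mono) auto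
    next
      case False
      then have "\<Omega> = {}" by blast
      then show ?thesis by (simp add: R_def N_def)
    qed
    finally show ?thesis .
  qed
  have "((\<lambda>s. (?L s - ?L t) / (s - t) - ?D) \<longlongrightarrow> 0) (at t within ?I)"
  proof (rule tendsto_0_le[OF lim, where K = 1])
    show "\<forall>\<^sub>F s in at t within ?I. norm ((?L s - ?L t) / (s - t) - ?D) \<le> norm (R s) * 1"
      unfolding eventually_at_filter
      using bound by (intro always_eventually) (auto intro: order_trans[OF _ abs_ge_self])
  qed
  then show ?thesis
    unfolding has_field_derivative_iff using LIM_zero_iff by blast
qed

end

section \<open>A Riccati-type differential inequality\<close>

text \<open>The derivative at 0 is one-sided, but the mean value argument uses interior points,
  where it is two-sided, and continuity at the ends. The sign is required only from \<open>r\<close>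
  on because the last step of the blow-up argument starts late.\<close>

lemma nondecreasing_on_halfline:
  fixes f :: "real \<Rightarrow> real"
  assumes D: "\<And>t. 0 \<le> t \<Longrightarrow> (f has_real_derivative f' t) (at t within {0..})"
    and nn: "\<And>t. r \<le> t \<Longrightarrow> 0 \<le> f' t" and st: "0 \<le> r" "r \<le> s" "s \<le> t"
  shows "f s \<le> f t"
proof (rule DERIV_nonneg_imp_increasing_open[OF st(3)])
  fix x assume x: "s < x" "x < t"
  have "at x within {0..} = at x" using x st by (intro at_within_interior) auto
  then show "\<exists>y. (f has_real_derivative y) (at x) \<and> 0 \<le> y" using D[of x] nn[of x] x st by auto
next
  have "continuous_on {0..} f"
    using D by (auto simp: continuous_on_eq_continuous_within intro: DERIV_continuous)
  then show "continuous_on {s..t} f" by (rule continuous_on_subset) (use st in auto)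
qed

lemma integral_has_derivative_halfline:
  fixes f :: "real \<Rightarrow> real"
  assumes f: "continuous_on {0..} f" and t: "0 \<le> t"
  shows "((\<lambda>t. integral {0..t} f) has_real_derivative f t) (at t within {0..})"
proof -
  have "((\<lambda>t. integral {0..t} f) has_real_derivative f t) (at t within {0..t + 1})"
    by (rule integral_has_real_derivative[OF continuous_on_subset[OF f]]) (use t in auto)
  moreover have "at t within {0..t + 1} = at t within {0..}"
    by (rule at_within_nhd[of _ "{..<t + 1}"]) auto
  ultimately show ?thesis by simp
qed

text \<open>The quantity \<open>Q = \<beta> + 2 I\<close> satisfies \<open>Q' \<ge> Q\<^sup>2 / M + const\<close>, because \<open>Q' - Q\<^sup>2 / M\<close> is nondecreasing.\<close>

lemma exponential_memory_blowup:
  fixes M \<beta> :: real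
  assumes M: "0 < M" and \<beta>: "0 < \<beta>"
    and Y: "\<And>t. 0 \<le> t \<Longrightarrow> (Y has_real_derivative P t) (at t within {0..})"
    and I: "\<And>t. 0 \<le> t \<Longrightarrow> (I has_real_derivative M * exp (2 * Y t / M)) (at t within {0..})" and I0: "I 0 = 0"
    and P: "\<And>t. 0 \<le> t \<Longrightarrow> \<beta> + 2 * I t \<le> P t"
  shows False
proof -
  define E where "E t = 2 * M * exp (2 * Y t / M)" for t
  define Q where "Q t = \<beta> + 2 * I t" for t
  have Epos: "0 < E t" for t using M by (simp add: E_def)
  have DQ: "(Q has_real_derivative E t) (at t within {0..})" if "0 \<le> t" for t
    unfolding Q_def E_def using I[OF that] by (auto intro!: derivative_eq_intros)
  have DE: "(E has_real_derivative 2 / M * E t * P t) (at t within {0..})" if "0 \<le> t" for t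
    unfolding E_def using Y[OF that] M by (auto intro!: derivative_eq_intros simp: field_simps)
  have Qge: "\<beta> \<le> Q t" if "0 \<le> t" for t
    using nondecreasing_on_halfline[OF DQ, of 0 0 t] that Epos I0 by (simp add: Q_def less_imp_le)
  have PQ: "Q t \<le> P t" "0 < P t" if "0 \<le> t" for t
    using P[OF that] Qge[OF that] \<beta> by (auto simp: Q_def)
  have Emono: "E 0 \<le> E t" if "0 \<le> t" for t
  proof (rule nondecreasing_on_halfline[OF DE, of 0])
    show "0 \<le> 2 / M * E s * P s" if "0 \<le> s" for s
      using M Epos[of s] PQ(2)[OF that] by simp
  qed (use that in auto)
  have Qlin: "\<beta> + E 0 * t \<le> Q t" if "0 \<le> t" for t
  proof -
    have "((\<lambda>t. Q t - E 0 * t) has_real_derivative E s - E 0) (at s within {0..})" if "0 \<le> s" for s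
      using DQ[OF that] by (auto intro!: derivative_eq_intros)
    from nondecreasing_on_halfline[OF this, of 0 0 t] Emono that I0 show ?thesis by (simp add: Q_def)
  qed
  \<comment> \<open>The value at time 0 of \<open>E - Q^2 / M\<close>, possibly negative.\<close>
  define c where "c = E 0 - \<beta>\<^sup>2 / M"
  have EQ: "(Q t)\<^sup>2 / M + c \<le> E t" if "0 \<le> t" for t
  proof -
    have D: "((\<lambda>t. E t - (Q t)\<^sup>2 / M) has_real_derivative 2 / M * E s * (P s - Q s)) (at s within {0..})" if "0 \<le> s" for s
      using DQ[OF that] DE[OF that] M by (auto intro!: derivative_eq_intros simp: field_simps)
    have "E 0 - (Q 0)\<^sup>2 / M \<le> E t - (Q t)\<^sup>2 / M"
    proof (rule nondecreasing_on_halfline[OF D, of 0])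
      show "0 \<le> 2 / M * E s * (P s - Q s)" if "0 \<le> s" for s
        using M Epos[of s] PQ(1)[OF that] by simp
    qed (use that in auto)
    then show ?thesis using I0 by (simp add: c_def Q_def)
  qed
  \<comment> \<open>Once \<open>Q\<close> reaches \<open>m\<close>, it is at least 1 and
    \<open>Q^2\<close> is at least \<open>2 * M * \<bar>c\<bar>\<close>, so half of the quadratic
    term absorbs \<open>c\<close>. The time \<open>r\<close> is when the linear lower bound of
    \<open>Q\<close> has reached \<open>m\<close>.\<close>
  define m where "m = max 1 (2 * M * \<bar>c\<bar>)"
  define r where "r = m / E 0"
  have r: "0 \<le> r" using Epos[of 0] by (simp add: r_def m_def)
  have late: "(Q t)\<^sup>2 / (2 * M) \<le> E t" if "r \<le> t" for t
  proof -
    have t: "0 \<le> t" using r that by simp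
    have "m = E 0 * r" using Epos[of 0] by (simp add: r_def)
    also have "\<dots> \<le> E 0 * t" using Epos[of 0] that by (intro mult_left_mono) auto
    also have "\<dots> \<le> Q t" using Qlin[OF t] \<beta> by simp
    finally have mQ: "m \<le> Q t" .
    then have "1 \<le> Q t" by (simp add: m_def)
    then have "Q t \<le> (Q t)\<^sup>2" by (simp add: power2_eq_square mult_le_cancel_left1)
    then have "2 * M * \<bar>c\<bar> \<le> (Q t)\<^sup>2" using mQ by (simp add: m_def)
    then have "\<bar>c\<bar> \<le> (Q t)\<^sup>2 / (2 * M)" using M by (simp add: field_simps)
    moreover have "(Q t)\<^sup>2 / M = 2 * ((Q t)\<^sup>2 / (2 * M))" using M by simp
    ultimately show ?thesis using EQ[OF t] by linarith
  qed
  have D: "((\<lambda>t. - inverse (Q t) - t / (2 * M)) has_real_derivative E s / (Q s)\<^sup>2 - 1 / (2 * M)) (at s within {0..})"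
    if "0 \<le> s" for s
    using DQ[OF that] Qge[OF that] \<beta> M by (auto intro!: derivative_eq_intros simp: power2_eq_square field_simps)
  \<comment> \<open>From \<open>r\<close> on, -1/Q - s/(2M) is nondecreasing in s; at this
    \<open>t\<close> that would force 1/Q to be at most zero.\<close>
  define t where "t = r + 2 * M / Q r"
  have Qr: "0 < Q r" using Qge[OF r] \<beta> by simp
  have rt: "r \<le> t" using Qr M by (simp add: t_def)
  have "- inverse (Q r) - r / (2 * M) \<le> - inverse (Q t) - t / (2 * M)"
  proof (rule nondecreasing_on_halfline[OF D, of r])
    fix s assume s: "r \<le> s"
    have "0 < Q s" using Qge[of s] r s \<beta> by simp
    then have "0 < (Q s)\<^sup>2" by simp
    then show "0 \<le> E s / (Q s)\<^sup>2 - 1 / (2 * M)"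
      using late[OF s] M by (simp add: field_simps)
  qed (use r rt in auto)
  moreover have "t / (2 * M) = r / (2 * M) + inverse (Q r)"
    using M Qr by (simp add: t_def field_simps)
  moreover have "0 < inverse (Q t)" using Qge[of t] r rt \<beta> by simp
  ultimately show False by simp
qed

section \<open>The weight functions\<close>

lemma smooth_term_sin: "smooth_term (\<lambda>x. sin (k * (x \<bullet> b) + m))"
proof (rule smooth_term_affine[of "\<lambda>n y. sin (y + real n * (pi / 2))", simplified])
  fix n y
  show "((\<lambda>y. sin (y + real n * pi / 2)) has_real_derivative sin (y + (1 + real n) * pi / 2)) (at y)"
    by (auto intro!: derivative_eq_intros simp: sin_add cos_add distrib_right add_divide_distrib)
qed

lemma smooth_term_exp: "smooth_term (\<lambda>x. exp (k * (x \<bullet> b) + m))"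
  by (rule smooth_term_affine[of "\<lambda>n. exp"]) (rule DERIV_exp)

lemma smooth_term_coord: "smooth_term (\<lambda>x. x \<bullet> b)"
proof -
  have "smooth_term (\<lambda>x. (case_nat (\<lambda>y. y) (case_nat (\<lambda>y. 1) (\<lambda>n y. 0))) 0 (x \<bullet> b))"
  proof (rule smooth_term.atom)
    fix n and y :: real
    show "(case_nat (\<lambda>y. y) (case_nat (\<lambda>y. 1) (\<lambda>n y. 0)) n has_real_derivative
       case_nat (\<lambda>y. y) (case_nat (\<lambda>y. 1) (\<lambda>n y. 0)) (Suc n) y) (at y)"
      by (auto split: nat.split intro!: derivative_eq_intros)
  qed
  then show ?thesis by simp
qed

locale cylinder =
  fixes a b :: real assumes a_pos: "0 < a" and b_pos: "0 < b"
begin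

sublocale vertical_box "((0, 0), 0) :: point" "((a, a), b)"
  by unfold_locales (use a_pos b_pos in \<open>auto simp: Basis_prod_def\<close>)

abbreviation Om :: "point set" where "Om \<equiv> box ((0, 0), 0) ((a, a), b)"
abbreviation e1 :: point where "e1 \<equiv> ((1, 0), 0)"
abbreviation e2 :: point where "e2 \<equiv> ((0, 1), 0)"
abbreviation \<alpha> :: real where "\<alpha> \<equiv> alp a"

lemma alpha_pos: "0 < \<alpha>" and alpha_a: "\<alpha> * a = pi" using a_pos by (simp_all add: alp_def)

lemma Basis_point: "(Basis :: point set) = {e1, e2, ez}"
  by (auto simp: Basis_prod_def zero_prod_def)

lemma e_z_eq: "e_z = ez" by (simp add: e_z_def zero_prod_def)

lemma mem_Om: "p \<in> Om \<longleftrightarrow> 0 < fst (fst p) \<and> fst (fst p) < a \<and> 0 < snd (fst p) \<and> snd (fst p) < a \<and> 0 < snd p \<and> snd p < b"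
  by (cases p) (auto simp: mem_box Basis_point)

lemma Omega_x_eq: "Omega_x a = {x. 0 < fst x \<and> fst x < a \<and> 0 < snd x \<and> snd x < a}"
  by (auto simp: Omega_x_def)

lemma Omega_eq: "Omega a b = Om"
  by (auto simp: Omega_def Omega_x_eq mem_Om set_eq_iff)

lemma frontier_Om: "p \<in> frontier Om \<longleftrightarrow> p \<notin> Om \<and>
   0 \<le> fst (fst p) \<and> fst (fst p) \<le> a \<and> 0 \<le> snd (fst p) \<and> snd (fst p) \<le> a \<and> 0 \<le> snd p \<and> snd p \<le> b"
  by (cases p) (auto simp: frontier_box_eq mem_box Basis_point)

section \<open>The weight and its vertical derivative\<close>

definition sn :: "real \<Rightarrow> real" where "sn r = sin (\<alpha> * r)"
text \<open>\<open>sh z\<close> and \<open>ch z\<close> are sinh and cosh of \<alpha> (b - z), with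
  the exponents expanded to the affine form of \<open>smooth_term_exp\<close>.\<close>

definition sh :: "real \<Rightarrow> real" where "sh z = (exp (- \<alpha> * z + \<alpha> * b) - exp (\<alpha> * z + - \<alpha> * b)) / 2"
definition ch :: "real \<Rightarrow> real" where "ch z = (exp (- \<alpha> * z + \<alpha> * b) + exp (\<alpha> * z + - \<alpha> * b)) / 2"
definition w\<^sub>\<phi> :: "point \<Rightarrow> real" where "w\<^sub>\<phi> p = sh (snd p) * (sn (fst (fst p)) * sn (snd (fst p)))"
text \<open>The vertical derivative of the weight: each horizontal second derivative multiplies it
  by -\<alpha>^2, the vertical one by \<alpha>^2.\<close>

definition w\<^sub>z :: "point \<Rightarrow> real" where "w\<^sub>z p = - \<alpha> * ch (snd p) * (sn (fst (fst p)) * sn (snd (fst p)))"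

lemma phi_eq: "phi a b = w\<^sub>\<phi>"
proof
  fix p :: point
  have "- \<alpha> * (snd p - b) = - \<alpha> * snd p + \<alpha> * b" "\<alpha> * (snd p - b) = \<alpha> * snd p + - \<alpha> * b"
    by (simp_all add: algebra_simps)
  moreover have "pi * r / a = \<alpha> * r" for r by (simp add: alp_def)
  ultimately show "phi a b p = w\<^sub>\<phi> p"
    by (cases p) (simp add: phi_def w\<^sub>\<phi>_def sh_def sn_def case_prod_beta)
qed

lemma inner_e1 [simp]: "p \<bullet> e1 = fst (fst p)" and inner_e2 [simp]: "p \<bullet> e2 = snd (fst p)"
  by (cases p, auto)+

lemma smooth_sn: "smooth_term (\<lambda>p. sn (p \<bullet> e))"
  using smooth_term_sin[of \<alpha> e 0] by (simp add: sn_def)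

lemma smooth_sh: "smooth_term (\<lambda>p. sh (p \<bullet> e))" and smooth_ch: "smooth_term (\<lambda>p. ch (p \<bullet> e))"
proof -
  note E = smooth_term_exp[of "- \<alpha>" e "\<alpha> * b"] smooth_term_exp[of "\<alpha>" e "- \<alpha> * b"]
  have "smooth_term (\<lambda>p. exp (- \<alpha> * (p \<bullet> e) + \<alpha> * b) * (1 / 2) + exp (\<alpha> * (p \<bullet> e) + - \<alpha> * b) * (- 1 / 2))"
    by (intro smooth_term.add smooth_term.mult E smooth_term.const)
  then show "smooth_term (\<lambda>p. sh (p \<bullet> e))" by (simp add: sh_def diff_divide_distrib)
  have "smooth_term (\<lambda>p. exp (- \<alpha> * (p \<bullet> e) + \<alpha> * b) * (1 / 2) + exp (\<alpha> * (p \<bullet> e) + - \<alpha> * b) * (1 / 2))"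
    by (intro smooth_term.add smooth_term.mult E smooth_term.const)
  then show "smooth_term (\<lambda>p. ch (p \<bullet> e))" by (simp add: ch_def add_divide_distrib)
qed

lemma smooth_w\<^sub>\<phi>: "smooth_term w\<^sub>\<phi>" and smooth_w\<^sub>z: "smooth_term w\<^sub>z"
proof -
  have "smooth_term (\<lambda>p. sh (p \<bullet> ez) * (sn (p \<bullet> e1) * sn (p \<bullet> e2)))"
    by (intro smooth_term.mult smooth_sh smooth_sn)
  then show "smooth_term w\<^sub>\<phi>" unfolding w\<^sub>\<phi>_def[abs_def] inner_ez inner_e1 inner_e2 .
  have "smooth_term (\<lambda>p. - \<alpha> * ch (p \<bullet> ez) * (sn (p \<bullet> e1) * sn (p \<bullet> e2)))"
    by (intro smooth_term.mult smooth_ch smooth_sn smooth_term.const)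
  then show "smooth_term w\<^sub>z" unfolding w\<^sub>z_def[abs_def] inner_ez inner_e1 inner_e2 .
qed

lemma sh_deriv: "(sh has_real_derivative - \<alpha> * ch z) (at z)"
  unfolding sh_def[abs_def] ch_def by (auto intro!: derivative_eq_intros simp: field_simps)

lemma ch_deriv: "(ch has_real_derivative - \<alpha> * sh z) (at z)"
  unfolding sh_def ch_def[abs_def] by (auto intro!: derivative_eq_intros simp: field_simps)

lemma w\<^sub>\<phi>_deriv: "iter_deriv [ez] w\<^sub>\<phi> p = w\<^sub>z p"
proof (rule iter_deriv_1_eq[OF smooth_w\<^sub>\<phi>])
  have "((\<lambda>s. sh (snd p + s)) has_real_derivative - \<alpha> * ch (snd p + 0) * 1) (at 0)"
    by (rule DERIV_chain2[OF sh_deriv]) (auto intro!: derivative_eq_intros)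
  from DERIV_cmult_right[OF this, of "sn (fst (fst p)) * sn (snd (fst p))"]
  show "((\<lambda>s. w\<^sub>\<phi> (p + s *\<^sub>R ez)) has_real_derivative w\<^sub>z p) (at 0)"
    by (simp add: w\<^sub>\<phi>_def w\<^sub>z_def)
qed

lemma w\<^sub>z_deriv: "iter_deriv [ez] w\<^sub>z p = \<alpha>\<^sup>2 * w\<^sub>\<phi> p"
proof (rule iter_deriv_1_eq[OF smooth_w\<^sub>z])
  have "((\<lambda>s. ch (snd p + s)) has_real_derivative - \<alpha> * sh (snd p + 0) * 1) (at 0)"
    by (rule DERIV_chain2[OF ch_deriv]) (auto intro!: derivative_eq_intros)
  from DERIV_cmult_right[OF DERIV_cmult[OF this, of "- \<alpha>"], of "sn (fst (fst p)) * sn (snd (fst p))"]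
  show "((\<lambda>s. w\<^sub>z (p + s *\<^sub>R ez)) has_real_derivative \<alpha>\<^sup>2 * w\<^sub>\<phi> p) (at 0)"
    by (simp add: w\<^sub>\<phi>_def w\<^sub>z_def power2_eq_square mult_ac)
qed

text \<open>Since \<alpha> a = pi, the sine is symmetric about the midpoint. The linear bounds at
  both ends are the decay that a vanishing test function must have.\<close>

lemma sn_bounds:
  assumes "0 < r" "r < a"
  shows "0 < sn r" "\<bar>sn r\<bar> \<le> \<alpha> * r" "\<bar>sn r\<bar> \<le> \<alpha> * (a - r)"
proof -
  have r: "0 < \<alpha> * r" "\<alpha> * r < pi"
    using assms alpha_pos mult_strict_left_mono[OF assms(2) alpha_pos] by (auto simp: alpha_a)
  show "0 < sn r" unfolding sn_def using r by (intro sin_gt_zero)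
  show "\<bar>sn r\<bar> \<le> \<alpha> * r" unfolding sn_def using abs_sin_x_le_abs_x[of "\<alpha> * r"] r by simp
  have "sn r = sin (\<alpha> * (a - r))" by (simp add: sn_def right_diff_distrib alpha_a)
  then show "\<bar>sn r\<bar> \<le> \<alpha> * (a - r)" using abs_sin_x_le_abs_x[of "\<alpha> * (a - r)"] assms alpha_pos by simp
qed

lemma sh_nonneg: "z \<le> b \<Longrightarrow> 0 \<le> sh z" and sh_pos: "z < b \<Longrightarrow> 0 < sh z" and ch_pos: "0 < ch z" and sh_b: "sh b = 0"
proof -
  show "0 \<le> sh z" if "z \<le> b"
  proof -
    have "\<alpha> * z \<le> \<alpha> * b" using that alpha_pos by (intro mult_left_mono) auto
    then show ?thesis by (simp add: sh_def mult.commute)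
  qed
  show "0 < sh z" if "z < b"
  proof -
    have "\<alpha> * z < \<alpha> * b" using that alpha_pos by (intro mult_strict_left_mono) auto
    then show ?thesis by (simp add: sh_def mult.commute)
  qed
  show "0 < ch z" by (simp add: ch_def add_pos_pos)
  show "sh b = 0" by (simp add: sh_def)
qed

lemma w\<^sub>\<phi>_pos: "p \<in> Om \<Longrightarrow> 0 < w\<^sub>\<phi> p" and w\<^sub>z_neg: "p \<in> Om \<Longrightarrow> w\<^sub>z p < 0"
  using sn_bounds(1) sh_pos ch_pos alpha_pos
  by (auto simp: mem_Om w\<^sub>\<phi>_def w\<^sub>z_def intro!: mult_pos_pos)

text \<open>\<open>sh\<close> vanishes at \<open>b\<close> and its slope is at most
  \<open>\<alpha> * ch 0\<close> in modulus on the interval, where \<open>ch\<close> decreases; the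
  sines are at most 1.\<close>

lemma w\<^sub>\<phi>_upper: "\<exists>C. \<forall>p\<in>Om. \<bar>w\<^sub>\<phi> p\<bar> \<le> C * (b - snd p)"
proof -
  have "\<bar>w\<^sub>\<phi> p\<bar> \<le> \<alpha> * ch 0 * (b - snd p)" if p: "p \<in> Om" for p
  proof -
    obtain z where z: "snd p < z" "z < b" "sh b - sh (snd p) = (b - snd p) * (- \<alpha> * ch z)"
      using MVT2[of "snd p" b sh "\<lambda>z. - \<alpha> * ch z"] sh_deriv p mem_Om by blast
    have "0 < snd p" using p by (simp add: mem_Om)
    then have z0: "0 \<le> z" using z(1) by simp
    have "ch z \<le> ch 0"
    proof (rule DERIV_nonpos_imp_nonincreasing[of 0 z ch])
      fix x assume "0 \<le> x" "x \<le> z"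
      then show "\<exists>y. (ch has_real_derivative y) (at x) \<and> y \<le> 0"
        using ch_deriv[of x] sh_nonneg[of x] z alpha_pos by (intro exI[of _ "- \<alpha> * sh x"]) simp
    qed (rule z0)
    then have "sh (snd p) \<le> (b - snd p) * (\<alpha> * ch 0)"
      using z sh_b p alpha_pos by (simp add: mem_Om mult_left_mono)
    moreover have "\<bar>sn r * sn s\<bar> \<le> 1" for r s unfolding sn_def abs_mult by (intro mult_le_one) auto
    ultimately have "\<bar>sh (snd p)\<bar> * \<bar>sn (fst (fst p)) * sn (snd (fst p))\<bar> \<le> (b - snd p) * (\<alpha> * ch 0) * 1"
      using sh_nonneg[of "snd p"] p ch_pos[of 0] alpha_pos by (intro mult_mono) (auto simp: mem_Om)
    then show ?thesis by (simp add: w\<^sub>\<phi>_def abs_mult mult_ac)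
  qed
  then show ?thesis by blast
qed

text \<open>Two integrations by parts. The first has no boundary terms because the sine vanishes on
  both faces, the second because \<open>f\<close> does; the factor \<open>R\<close> does not vary
  along \<open>e\<close>, and the sine returns multiplied by -\<alpha>^2.\<close>

lemma horizontal_laplacian:
  assumes e: "e = e1 \<or> e = e2" and R: "smooth_term R" and inv: "\<And>p s. R (p + s *\<^sub>R e) = R p"
    and wd2: "has_weak_deriv Om [e, e] f g2" and wd1: "has_weak_deriv Om [e] f g1"
    and f: "integrable M f" and g1: "integrable M g1" and g2: "integrable M g2"
    and rep: "is_cont_rep Om f F" and zero: "\<And>p. p \<in> frontier Om - Gam a b \<Longrightarrow> F p = 0"
  shows "(LINT p|M. g2 p * (R p * sn (p \<bullet> e))) = - \<alpha>\<^sup>2 * (LINT p|M. f p * (R p * sn (p \<bullet> e)))"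
proof -
  have eB: "e \<in> Basis" using e by (auto simp: Basis_point)
  have ce: "((0, 0), 0) \<bullet> e = 0" "((a, a), b) \<bullet> e = a" "e \<bullet> e = 1" using e by auto
  \<comment> \<open>The cosine, written as a shifted sine so that \<open>smooth_term_sin\<close>
    covers it.\<close>
  define cs where "cs r = sin (\<alpha> * r + pi / 2)" for r
  let ?h = "\<lambda>p. R p * sn (p \<bullet> e)" and ?h' = "\<lambda>p. \<alpha> * R p * cs (p \<bullet> e)"
  have h: "smooth_term ?h" by (intro smooth_term.mult R smooth_sn)
  have h': "smooth_term ?h'"
    unfolding cs_def by (intro smooth_term.mult R smooth_term.const smooth_term_sin)
  have D: "iter_deriv [e] ?h p = ?h' p" for p
  proof (rule iter_deriv_1_eq[OF h])
    show "((\<lambda>s. R (p + s *\<^sub>R e) * sn ((p + s *\<^sub>R e) \<bullet> e)) has_real_derivative ?h' p) (at 0)"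
      unfolding inv by (auto intro!: derivative_eq_intros simp: sn_def cs_def inner_add_left ce sin_add)
  qed
  have D': "iter_deriv [e] ?h' p = - \<alpha>\<^sup>2 * ?h p" for p
  proof (rule iter_deriv_1_eq[OF h'])
    show "((\<lambda>s. \<alpha> * R (p + s *\<^sub>R e) * cs ((p + s *\<^sub>R e) \<bullet> e)) has_real_derivative - \<alpha>\<^sup>2 * ?h p) (at 0)"
      unfolding inv by (auto intro!: derivative_eq_intros simp: sn_def cs_def inner_add_left ce sin_add cos_add power2_eq_square)
  qed
  obtain B where B: "0 < B" "\<forall>x\<in>Om. \<bar>R x\<bar> \<le> B" using smooth_bounded[OF R] by auto
  have pe: "0 < p \<bullet> e" "p \<bullet> e < a" if "p \<in> Om" for p using that e by (auto simp: mem_Om)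
  have "(LINT p|M. g2 p * ?h p) = - (LINT p|M. g1 p * iter_deriv [e] ?h p)"
  proof (rule integration_by_parts_vanishing_test[OF has_weak_deriv_step[OF wd2 wd1 eB] g1 g2 eB h, where C = "B * \<alpha>"])
    fix p assume p: "p \<in> Om"
    have "\<bar>R p\<bar> * \<bar>sn (p \<bullet> e)\<bar> \<le> B * (\<alpha> * (p \<bullet> e))" "\<bar>R p\<bar> * \<bar>sn (p \<bullet> e)\<bar> \<le> B * (\<alpha> * (a - p \<bullet> e))"
      using B p sn_bounds(2,3)[OF pe[OF p]] by (auto intro!: mult_mono)
    then show "\<bar>R p * sn (p \<bullet> e)\<bar> \<le> B * \<alpha> * (p \<bullet> e - ((0, 0), 0) \<bullet> e)"
      "\<bar>R p * sn (p \<bullet> e)\<bar> \<le> B * \<alpha> * (((a, a), b) \<bullet> e - p \<bullet> e)"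
      unfolding ce by (simp_all add: abs_mult mult.assoc)
  qed
  also have "\<dots> = - (LINT p|M. g1 p * ?h' p)" unfolding D ..
  also have "(LINT p|M. g1 p * ?h' p) = - (LINT p|M. f p * iter_deriv [e] ?h' p)"
  proof (rule integration_by_parts_vanishing_function[OF wd1 f g1 eB h' rep])
    fix p assume p: "p \<in> Om"
    show "F (p + (((0, 0), 0) \<bullet> e - p \<bullet> e) *\<^sub>R e) = 0" "F (p + (((a, a), b) \<bullet> e - p \<bullet> e) *\<^sub>R e) = 0"
      using p e a_pos by (intro zero; cases p; auto simp: frontier_Om mem_Om Gam_def Omega_x_eq)+
  qed
  also have "\<dots> = \<alpha>\<^sup>2 * (LINT p|M. f p * ?h p)"
    unfolding D' by (simp add: mult.left_commute[of "f _"])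
  finally show ?thesis by simp
qed

subsection \<open>Green's formula\<close>

lemma closure_Om: "p \<in> closure Om \<longleftrightarrow> 0 \<le> fst (fst p) \<and> fst (fst p) \<le> a \<and> 0 \<le> snd (fst p) \<and> snd (fst p) \<le> a \<and> 0 \<le> snd p \<and> snd p \<le> b"
  by (cases p) (auto simp: closure_box_eq mem_box Basis_point)

lemma open_Omega_x: "open (Omega_x a)"
  unfolding Omega_x_def by (intro open_Times open_greaterThanLessThan)

text \<open>Applied twice: with \<open>k\<close> the vertical derivative of a test function, where
  \<open>K = 0\<close>, and with \<open>k\<close> the derivative of the weight, where
  \<open>K\<close> produces the integral over the bottom.\<close>

lemma fubini_cylinder:
  fixes G k :: "point \<Rightarrow> real"
  assumes G: "continuous_on (closure Om) G" and k: "continuous_on UNIV k"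
    and K: "\<And>x. (LINT z|lborel. k (x, z) * indicator {0..b} z) = K x" "K \<in> borel_measurable borel"
  shows "(LINT p|M. G (fst p, 0) * k p) = (LINT x|lebesgue_on (Omega_x a). G (x, 0) * K x)"
proof -
  let ?G1 = "\<lambda>x. indicat_real (Omega_x a) x *\<^sub>R G (x, 0)"
  let ?F = "\<lambda>p. ?G1 (fst p) * (indicat_real {0<..<b} (snd p) * k p)"
  have cG: "continuous_on (Omega_x a) (\<lambda>x. G (x, 0))"
    by (rule continuous_on_compose2[OF G]) (use b_pos in \<open>auto intro!: continuous_intros simp: closure_Om Omega_x_eq\<close>)
  have G1m: "?G1 \<in> borel_measurable borel"
    by (rule borel_measurable_continuous_on_indicator[OF _ cG]) (simp add: open_Omega_x)
  have km: "k \<in> borel_measurable borel" by (rule borel_measurable_continuous_onI[OF k])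
  have fst_m: "fst \<in> borel \<rightarrow>\<^sub>M (borel :: (real \<times> real) measure)" and snd_m: "snd \<in> borel \<rightarrow>\<^sub>M (borel :: real measure)"
    by (intro borel_measurable_continuous_onI continuous_intros)+
  have Fm: "?F \<in> borel_measurable (borel :: point measure)"
    by (intro borel_measurable_times measurable_compose[OF fst_m G1m] measurable_compose[OF snd_m] km) simp
  have F0: "?F p = 0" if "p \<notin> Om" for p using that by (auto simp: mem_Om Omega_x_eq indicator_def)
  have FG: "?F p = G (fst p, 0) * k p" if "p \<in> Om" for p using that by (simp add: mem_Om Omega_x_eq)
  obtain B where B: "\<And>p. p \<in> closure Om \<Longrightarrow> \<bar>G p\<bar> \<le> B" by (rule continuous_bounded[OF G]) blast
  obtain C where C: "\<And>p. p \<in> closure Om \<Longrightarrow> \<bar>k p\<bar> \<le> C"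
    by (rule continuous_bounded[OF continuous_on_subset[OF k subset_UNIV]]) blast
  have "integrable M ?F"
  proof (rule integrable_bounded[OF borel_on[OF Fm], where B = "B * C"])
    fix p assume p: "p \<in> Om"
    then have "(fst p, 0) \<in> closure Om" "p \<in> closure Om" using b_pos by (auto simp: closure_Om mem_Om)
    from B[OF this(1)] C[OF this(2)] show "\<bar>?F p\<bar> \<le> B * C"
      unfolding FG[OF p] abs_mult by (intro mult_mono) auto
  qed
  then have iF: "integrable (lborel \<Otimes>\<^sub>M lborel) ?F" using M_lborel(1)[OF Fm F0] by (simp add: lborel_prod)
  have "(LINT p|M. G (fst p, 0) * k p) = (LINT p|M. ?F p)"
    by (rule Bochner_Integration.integral_cong[OF refl], rule FG[symmetric]) simp
  also have "\<dots> = (LINT p|lborel. ?F p)" by (rule M_lborel(2)[OF Fm F0])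
  also have "\<dots> = (LINT x|lborel. LINT z|lborel. ?F (x, z))"
    using lborel_pair.integral_fst'[OF iF] by (simp add: lborel_prod)
  also have "\<dots> = (LINT x|lborel. ?G1 x * K x)"
  proof (rule Bochner_Integration.integral_cong[OF refl])
    fix x :: "real \<times> real"
    have kx: "(\<lambda>z. k (x, z)) \<in> borel_measurable borel"
      by (rule measurable_compose[OF _ km]) (intro borel_measurable_continuous_onI continuous_intros)
    have "(LINT z|lborel. indicat_real {0<..<b} z * k (x, z)) = (LINT z|lborel. k (x, z) * indicator {0..b} z)"
    proof (rule integral_cong_AE)
      show "AE z in lborel. indicat_real {0<..<b} z * k (x, z) = k (x, z) * indicator {0..b} z"
        using AE_lborel_singleton[of 0] AE_lborel_singleton[of b]
        by eventually_elim (auto simp: indicator_def)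
    qed (use kx in simp_all)
    then show "(LINT z|lborel. ?F (x, z)) = ?G1 x * K x" using K(1)[of x] by simp
  qed
  also have "\<dots> = (LINT x|lebesgue. ?G1 x * K x)"
    using G1m K(2) by (intro integral_completion[symmetric]) simp
  also have "\<dots> = (LINT x|lebesgue_on (Omega_x a). G (x, 0) * K x)"
    by (subst integral_restrict_space) (simp_all add: open_Omega_x mult.assoc)
  finally show ?thesis .
qed

text \<open>By Fubini the pairing reduces to integrals of the vertical derivative of \<eta> over
  whole segments, and these vanish because \<eta> is zero at both end points.\<close>

lemma vertical_constant_weak_deriv:
  assumes G: "continuous_on (closure Om) G"
  shows "has_weak_deriv Om [ez] (\<lambda>p. G (fst p, 0)) (\<lambda>p. 0)" "continuous_on (closure Om) (\<lambda>p. G (fst p, 0))"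
    "integrable M (\<lambda>p. G (fst p, 0))"
proof -
  show c: "continuous_on (closure Om) (\<lambda>p. G (fst p, 0))"
    by (rule continuous_on_compose2[OF G]) (use b_pos in \<open>auto intro!: continuous_intros simp: closure_Om\<close>)
  obtain B where B: "\<And>p. p \<in> closure Om \<Longrightarrow> \<bar>G (fst p, 0)\<bar> \<le> B" by (rule continuous_bounded[OF c]) blast
  have "(\<lambda>p. G (fst p, 0)) \<in> borel_measurable M"
    by (rule continuous_imp_measurable_on_sets_lebesgue[OF continuous_on_subset[OF c closure_subset]]) simp
  then show int: "integrable M (\<lambda>p. G (fst p, 0))"
    using B closure_subset[of Om] by (intro integrable_bounded[where B = B]) auto
  show "has_weak_deriv Om [ez] (\<lambda>p. G (fst p, 0)) (\<lambda>p. 0)"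
    unfolding has_weak_deriv_def
  proof (intro conjI integrable_locally int allI impI)
    fix \<eta> assume \<eta>: "test_function Om \<eta>"
    have k: "continuous_on UNIV (iter_deriv [ez] \<eta>)"
      using test_function_continuous[OF \<eta>, of "[ez]"] ez_Basis by simp
    have D: "((\<lambda>z. \<eta> (x, z)) has_real_derivative iter_deriv [ez] \<eta> (x, z)) (at z)" for x z
    proof -
      have "iter_deriv [] \<eta> differentiable_on UNIV"
        using \<eta> unfolding test_function_def smooth_def by (elim conjE allE[of _ "[]"]) simp
      from this[unfolded differentiable_on_def, THEN bspec, OF UNIV_I, of "(x, z)"]
      have "\<eta> differentiable (at (x, z))" by simp
      then have 1: "(\<eta> has_derivative frechet_derivative \<eta> (at (x, z))) (at (x, z))"
        by (simp add: frechet_derivative_works)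
      have 2: "((\<lambda>z. (x, z)) has_derivative (\<lambda>h. (0, h))) (at z)"
        by (auto intro!: derivative_eq_intros)
      have "frechet_derivative \<eta> (at (x, z)) (0, h) = iter_deriv [ez] \<eta> (x, z) * h" for h
      proof -
        have "frechet_derivative \<eta> (at (x, z)) (h *\<^sub>R (0, 1)) = h *\<^sub>R frechet_derivative \<eta> (at (x, z)) (0, 1)"
          by (rule linear_scale[OF has_derivative_linear[OF 1]])
        then show ?thesis by (simp add: mult.commute)
      qed
      then have "(\<lambda>h. frechet_derivative \<eta> (at (x, z)) (0, h)) = (*) (iter_deriv [ez] \<eta> (x, z))"
        by (rule ext)
      then show ?thesis
        using has_derivative_compose[OF 2 1] unfolding has_field_derivative_def by (simp only:)
    qed
    have \<eta>0: "\<eta> p = 0" if "p \<notin> Om" for p using \<eta> that unfolding test_function_def by blast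
    have "(LINT p|M. G (fst p, 0) * iter_deriv [ez] \<eta> p) = (LINT x|lebesgue_on (Omega_x a). G (x, 0) * 0)"
    proof (rule fubini_cylinder[OF G k])
      fix x
      have "isCont (\<lambda>z. iter_deriv [ez] \<eta> (x, z)) z" for z
      proof (rule isCont_o2[where g = "iter_deriv [ez] \<eta>"])
        show "isCont (iter_deriv [ez] \<eta>) (x, z)"
          using k unfolding continuous_on_eq_continuous_at[OF open_UNIV] by blast
      qed (intro continuous_intros)
      then have "(LINT z|lborel. iter_deriv [ez] \<eta> (x, z) * indicator {0..b} z) = \<eta> (x, b) - \<eta> (x, 0)"
        using b_pos D by (intro integral_FTC_Icc_real) auto
      then show "(LINT z|lborel. iter_deriv [ez] \<eta> (x, z) * indicator {0..b} z) = 0"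
        by (simp add: \<eta>0 mem_Om)
    qed simp
    then show "(LINT p|M. G (fst p, 0) * iter_deriv [ez] \<eta> p) = (-1) ^ length [ez] * (LINT p|M. 0 * \<eta> p)" by simp
  qed simp
qed

text \<open>The weight vanishes at z = b, so integrating its derivative vertically leaves minus its
  value at z = 0; this is where the factor \<open>sh 0\<close> originates.\<close>

lemma weight_vertical_integral:
  assumes G: "continuous_on (closure Om) G"
  shows "(LINT p|M. G (fst p, 0) * w\<^sub>z p) = - sh 0 * (LINT x|lebesgue_on (Omega_x a). G (x, 0) * (sn (fst x) * sn (snd x)))"
proof -
  have "(LINT p|M. G (fst p, 0) * w\<^sub>z p) = (LINT x|lebesgue_on (Omega_x a). G (x, 0) * (- sh 0 * (sn (fst x) * sn (snd x))))"
  proof (rule fubini_cylinder[OF G smooth_term_continuous[OF smooth_w\<^sub>z]])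
    fix x
    have D: "((\<lambda>z. w\<^sub>\<phi> (x, z)) has_real_derivative w\<^sub>z (x, z)) (at z)" for z
      unfolding w\<^sub>\<phi>_def w\<^sub>z_def fst_conv snd_conv using sh_deriv by (rule DERIV_cmult_right)
    have "isCont (\<lambda>z. w\<^sub>z (x, z)) z" for z
    proof (rule isCont_o2[where g = "w\<^sub>z"])
      show "isCont w\<^sub>z (x, z)"
        using smooth_term_continuous[OF smooth_w\<^sub>z, of UNIV] unfolding continuous_on_eq_continuous_at[OF open_UNIV] by blast
    qed (intro continuous_intros)
    then have "(LINT z|lborel. w\<^sub>z (x, z) * indicator {0..b} z) = w\<^sub>\<phi> (x, b) - w\<^sub>\<phi> (x, 0)"
      using b_pos D by (intro integral_FTC_Icc_real) auto
    then show "(LINT z|lborel. w\<^sub>z (x, z) * indicator {0..b} z) = - sh 0 * (sn (fst x) * sn (snd x))"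
      by (simp add: w\<^sub>\<phi>_def sh_b)
  next
    show "(\<lambda>x. - sh 0 * (sn (fst x) * sn (snd x))) \<in> borel_measurable borel"
      unfolding sn_def by (intro borel_measurable_continuous_onI continuous_intros)
  qed
  also have "\<dots> = (LINT x|lebesgue_on (Omega_x a). - sh 0 * (G (x, 0) * (sn (fst x) * sn (snd x))))"
    by (simp add: mult.left_commute)
  finally show ?thesis by simp
qed

lemma derivs_upto_point: "[ez] \<in> derivs_upto 3" "[ez] \<in> derivs_upto 2" "e \<in> Basis \<Longrightarrow> [e] \<in> derivs_upto 3" "e \<in> Basis \<Longrightarrow> [e, e] \<in> derivs_upto 3"
  using ez_Basis by (auto simp: derivs_upto_def)

lemma laplacian_sum: "weak_laplacian Om f p = weak_deriv Om [e1, e1] f p + weak_deriv Om [e2, e2] f p + weak_deriv Om [ez, ez] f p"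
  unfolding weak_laplacian_def Basis_point by (simp add: zero_prod_def)

lemma laplacian_pairing:
  assumes f: "f \<in> sobolev 3 Om"
  shows "(LINT p|M. weak_laplacian Om f p * w\<^sub>z p) = (LINT p|M. weak_deriv Om [e1, e1] f p * w\<^sub>z p)
     + (LINT p|M. weak_deriv Om [e2, e2] f p * w\<^sub>z p) + (LINT p|M. weak_deriv Om [ez, ez] f p * w\<^sub>z p)"
proof -
  have eB: "e1 \<in> Basis" "e2 \<in> Basis" by (simp_all add: Basis_point)
  note int = L2_integrable[OF weak_deriv_L2[OF f]]
  show ?thesis
    unfolding laplacian_sum distrib_right
    using integrable_mult_smooth[OF smooth_w\<^sub>z int[OF derivs_upto_point(4)[OF eB(1)]]]
      integrable_mult_smooth[OF smooth_w\<^sub>z int[OF derivs_upto_point(4)[OF eB(2)]]]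
      integrable_mult_smooth[OF smooth_w\<^sub>z int[OF derivs_upto_point(4)[OF ez_Basis]]] by simp
qed

text \<open>The value of \<open>\<psi>\<close> at \<open>z = 0\<close> enters by subtracting \<open>G (x, 0)\<close>, whose weak \<open>z\<close>-derivative is zero.\<close>

lemma green:
  assumes \<psi>: "\<psi> \<in> sobolev 3 Om" and bc: "boundary_condition a b \<psi>" and rep: "is_cont_rep Om \<psi> G"
  shows "(LINT p|M. weak_laplacian Om \<psi> p * w\<^sub>z p) = \<alpha>\<^sup>2 * (LINT p|M. weak_deriv Om [ez] \<psi> p * w\<^sub>\<phi> p)
     + 2 * \<alpha>\<^sup>2 * sh 0 * (LINT x|lebesgue_on (Omega_x a). G (x, 0) * (sn (fst x) * sn (snd x)))"
proof -
  let ?D = "\<lambda>es. weak_deriv Om es \<psi>"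
  let ?R = "LINT x|lebesgue_on (Omega_x a). G (x, 0) * (sn (fst x) * sn (snd x))"
  have eB: "e1 \<in> Basis" "e2 \<in> Basis" by (simp_all add: Basis_point)
  note wd = weak_deriv_weak[OF \<psi>]
  note int = L2_integrable[OF weak_deriv_L2[OF \<psi>]]
  have i\<psi>: "integrable M \<psi>" by (rule L2_integrable[OF sobolev_L2[OF \<psi>]])
  have G: "continuous_on (closure Om) G" and \<psi>G: "AE p in M. \<psi> p = G p" using rep by (auto simp: is_cont_rep_def)
  have G0: "G p = 0" if p: "p \<in> frontier Om - Gam a b" for p
  proof -
    obtain g where g: "is_cont_rep Om \<psi> g" "\<forall>p\<in>frontier Om - Gam a b. g p = 0"
      using bc by (auto simp: boundary_condition_def vanishes_on_def Omega_eq)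
    have "p \<in> closure Om" using p by (auto simp: frontier_def)
    then have "G p = g p" by (rule cont_rep_unique[OF rep g(1)])
    then show ?thesis using g(2) p by simp
  qed
  obtain gz where gz: "is_cont_rep Om (?D [ez]) gz" "\<forall>p\<in>Gam a b. gz p = 0"
    using bc by (auto simp: boundary_condition_def vanishes_on_def Omega_eq e_z_eq)
  have wz: "w\<^sub>z p = (- \<alpha> * ch (p \<bullet> ez) * sn (p \<bullet> e2)) * sn (p \<bullet> e1)" "w\<^sub>z p = (- \<alpha> * ch (p \<bullet> ez) * sn (p \<bullet> e1)) * sn (p \<bullet> e2)" for p
    by (simp_all add: w\<^sub>z_def mult_ac)
  have 1: "(LINT p|M. ?D [e1, e1] p * w\<^sub>z p) = - \<alpha>\<^sup>2 * (LINT p|M. \<psi> p * w\<^sub>z p)"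
    unfolding wz(1)
  proof (rule horizontal_laplacian[OF _ _ _ wd wd i\<psi> int int rep G0])
    show "smooth_term (\<lambda>p. - \<alpha> * ch (p \<bullet> ez) * sn (p \<bullet> e2))"
      by (intro smooth_term.mult smooth_term.const smooth_ch smooth_sn)
  qed (simp_all add: derivs_upto_point eB)
  have 2: "(LINT p|M. ?D [e2, e2] p * w\<^sub>z p) = - \<alpha>\<^sup>2 * (LINT p|M. \<psi> p * w\<^sub>z p)"
    unfolding wz(2)
  proof (rule horizontal_laplacian[OF _ _ _ wd wd i\<psi> int int rep G0])
    show "smooth_term (\<lambda>p. - \<alpha> * ch (p \<bullet> ez) * sn (p \<bullet> e1))"
      by (intro smooth_term.mult smooth_term.const smooth_ch smooth_sn)
  qed (simp_all add: derivs_upto_point eB)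
  \<comment> \<open>The boundary terms carry the vertical derivative of \<open>\<psi>\<close>, which
    is zero on \<open>Gam\<close>.\<close>
  have 3: "(LINT p|M. ?D [ez, ez] p * w\<^sub>z p) = - (LINT p|M. ?D [ez] p * iter_deriv [ez] w\<^sub>z p)"
  proof (rule integration_by_parts_vanishing_function[OF has_weak_deriv_step[OF wd wd] int int ez_Basis smooth_w\<^sub>z gz(1)])
    fix p assume "p \<in> Om"
    then show "gz (p + (((0, 0), 0) \<bullet> ez - p \<bullet> ez) *\<^sub>R ez) = 0" "gz (p + (((a, a), b) \<bullet> ez - p \<bullet> ez) *\<^sub>R ez) = 0"
      using gz(2) by (cases p, auto simp: Gam_def mem_Om Omega_x_eq)+
  qed (use derivs_upto_point ez_Basis in auto)
  define f where "f p = 1 * \<psi> p + (-1) * G (fst p, 0)" for p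
  note vc = vertical_constant_weak_deriv[OF G]
  have f: "integrable M f" unfolding f_def using i\<psi> vc(3) by simp
  have fD: "has_weak_deriv Om [ez] f (\<lambda>p. 1 * ?D [ez] p + (-1) * 0)"
    unfolding f_def
    by (rule has_weak_deriv_lincomb[OF wd vc(1) i\<psi> int vc(3)]) (simp_all add: derivs_upto_point ez_Basis)
  have frep: "is_cont_rep Om f (\<lambda>p. G p - G (fst p, 0))"
    using \<psi>G G vc(2) by (auto simp: is_cont_rep_def f_def intro!: continuous_on_diff)
  \<comment> \<open>The two faces vanish for different reasons: \<open>f\<close> is zero on z = 0,
    the weight on z = b.\<close>
  have 4: "(LINT p|M. (1 * ?D [ez] p + (-1) * 0) * w\<^sub>\<phi> p) = - (LINT p|M. f p * iter_deriv [ez] w\<^sub>\<phi> p)"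
  proof (rule integration_by_parts[OF fD f _ ez_Basis smooth_w\<^sub>\<phi>])
    show "integrable M (\<lambda>p. 1 * ?D [ez] p + - 1 * 0)" using int[OF derivs_upto_point(1)] by simp
    obtain B where B: "AE p in M. \<bar>f p * w\<^sub>\<phi> p\<bar> \<le> B * \<bar>f p\<bar>" using function_mult_smooth(2)[OF f smooth_w\<^sub>\<phi>] by auto
    show "(\<lambda>n. LINT p|M. f p * w\<^sub>\<phi> p * locut ez n ((0, 0), 0) ((a, a), b) p) \<longlonglongrightarrow> 0"
    proof (rule locut_function_tendsto_0(2)[OF ez_Basis frep _ function_mult_smooth(1)[OF f smooth_w\<^sub>\<phi>] B])
      fix p show "G (p + (((0, 0), 0) \<bullet> ez - p \<bullet> ez) *\<^sub>R ez) - G (fst (p + (((0, 0), 0) \<bullet> ez - p \<bullet> ez) *\<^sub>R ez), 0) = 0"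
        by (cases p) simp
    qed
    obtain C where C: "\<forall>p\<in>Om. \<bar>w\<^sub>\<phi> p\<bar> \<le> C * (b - snd p)" using w\<^sub>\<phi>_upper by auto
    show "(\<lambda>n. LINT p|M. f p * w\<^sub>\<phi> p * upcut ez n ((0, 0), 0) ((a, a), b) p) \<longlonglongrightarrow> 0"
      by (rule upcut_test_tendsto_0[OF ez_Basis f smooth_w\<^sub>\<phi>, where C = C]) (use C in simp)
  qed
  have "(LINT p|M. f p * w\<^sub>z p) = (LINT p|M. \<psi> p * w\<^sub>z p) - (LINT p|M. G (fst p, 0) * w\<^sub>z p)"
    unfolding f_def using integrable_mult_smooth[OF smooth_w\<^sub>z i\<psi>] integrable_mult_smooth[OF smooth_w\<^sub>z vc(3)]
    by (simp add: left_diff_distrib)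
  with 4 have 5: "(LINT p|M. \<psi> p * w\<^sub>z p) = - (LINT p|M. ?D [ez] p * w\<^sub>\<phi> p) - sh 0 * ?R"
    unfolding w\<^sub>\<phi>_deriv weight_vertical_integral[OF G] by simp
  have 6: "(LINT p|M. ?D [ez] p * iter_deriv [ez] w\<^sub>z p) = \<alpha>\<^sup>2 * (LINT p|M. ?D [ez] p * w\<^sub>\<phi> p)"
    unfolding w\<^sub>z_deriv by (simp add: mult.left_commute)
  \<comment> \<open>The horizontal directions contribute twice \<alpha>^2 of the weighted integral
    of \<open>\<psi>\<^sub>z\<close>, the vertical one minus \<alpha>^2. With \<alpha> = pi / a the
    difference is the denominator in \<open>r_fun\<close>.\<close>
  show ?thesis unfolding laplacian_pairing[OF \<psi>] 1 2 3 5 6 by (simp add: algebra_simps)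
qed

lemma bottom_integrable:
  assumes G: "continuous_on (closure Om) G"
  shows "integrable (lebesgue_on (Omega_x a)) (\<lambda>x. G (x, 0) * (sn (fst x) * sn (snd x)))"
proof -
  have "bounded (Omega_x a)" unfolding Omega_x_def by (intro bounded_Times bounded_box[of 0 a, simplified box_real])
  then interpret X: bounded_domain "Omega_x a" by unfold_locales (rule open_Omega_x)
  obtain B where B: "\<And>p. p \<in> closure Om \<Longrightarrow> \<bar>G p\<bar> \<le> B" by (rule continuous_bounded[OF G]) blast
  have c: "continuous_on (Omega_x a) (\<lambda>x. G (x, 0))"
    by (rule continuous_on_compose2[OF G]) (use b_pos in \<open>auto intro!: continuous_intros simp: closure_Om Omega_x_eq\<close>)
  show ?thesis
  proof (rule X.integrable_bounded[where B = B])
    have "continuous_on (Omega_x a) (\<lambda>x. G (x, 0) * (sn (fst x) * sn (snd x)))"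
      unfolding sn_def by (intro continuous_intros c)
    then show "(\<lambda>x. G (x, 0) * (sn (fst x) * sn (snd x))) \<in> borel_measurable (lebesgue_on (Omega_x a))"
      by (rule continuous_imp_measurable_on_sets_lebesgue) simp
    fix x assume "x \<in> Omega_x a"
    then have "\<bar>G (x, 0)\<bar> \<le> B" using b_pos by (intro B) (auto simp: closure_Om Omega_x_eq)
    moreover have "\<bar>sn (fst x) * sn (snd x)\<bar> \<le> 1" unfolding sn_def abs_mult by (intro mult_le_one) auto
    ultimately have "\<bar>G (x, 0)\<bar> * \<bar>sn (fst x) * sn (snd x)\<bar> \<le> B * 1" by (intro mult_mono) auto
    then show "\<bar>G (x, 0) * (sn (fst x) * sn (snd x))\<bar> \<le> B" by (simp only: abs_mult mult_1_right)
  qed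
qed

end

section \<open>A global solution\<close>

text \<open>\<open>S\<close> is bounded, so \<epsilon> can be fixed first to make the first summand
  small for all n, and then n is taken large for the second.\<close>

lemma tendsto_0_of_weighted_bound:
  fixes x S J :: "nat \<Rightarrow> real"
  assumes le: "\<And>n \<epsilon>. 0 < \<epsilon> \<Longrightarrow> \<bar>x n\<bar> \<le> \<epsilon> * S n + J n / \<epsilon>" and S: "S \<longlonglongrightarrow> L" and J: "J \<longlonglongrightarrow> 0"
  shows "x \<longlonglongrightarrow> 0"
proof (rule LIMSEQ_I)
  fix r :: real assume r: "0 < r"
  have "Bseq S" using S convergentI convergent_imp_Bseq by blast
  then obtain C where C: "0 < C" "\<And>n. \<bar>S n\<bar> \<le> C" by (auto simp: Bseq_def)
  define \<epsilon> where "\<epsilon> = r / (2 * C)"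
  have \<epsilon>: "0 < \<epsilon>" "\<epsilon> * C = r / 2" using r C(1) by (auto simp: \<epsilon>_def)
  obtain N where N: "\<And>n. n \<ge> N \<Longrightarrow> \<bar>J n\<bar> < \<epsilon> * (r / 2)"
    using LIMSEQ_D[OF J, of "\<epsilon> * (r / 2)"] \<epsilon>(1) r by auto
  have "norm (x n - 0) < r" if n: "n \<ge> N" for n
  proof -
    have "\<epsilon> * S n \<le> \<epsilon> * C" using C(2)[of n] \<epsilon>(1) by (intro mult_left_mono) auto
    moreover have "J n / \<epsilon> < r / 2" using N[OF n] \<epsilon>(1) by (simp add: divide_less_eq mult.commute)
    ultimately have "\<bar>x n\<bar> < r" using le[OF \<epsilon>(1), of n] \<epsilon>(2) by linarith
    then show ?thesis by simp
  qed
  then show "\<exists>N. \<forall>n\<ge>N. norm (x n - 0) < r" by blast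
qed

text \<open>Boundary values of \<open>u\<close> are given at time 0 only, through \<open>U0\<close>;
  \<open>trace_zero\<close> recovers those on z = 0 at later times.\<close>

locale global_solution = cylinder +
  fixes u ut \<psi> \<psi>t :: "real \<Rightarrow> point \<Rightarrow> real" and U0 :: "point \<Rightarrow> real"
  assumes Cu: "C1_curve 2 Om \<infinity> u ut" and C\<psi>: "C1_curve 3 Om \<infinity> \<psi> \<psi>t"
    and u_eq: "\<And>t. 0 \<le> t \<Longrightarrow> AE p in lebesgue_on Om. ut t p = 2 * u t p * weak_deriv Om [ez] (\<psi> t) p"
    and \<psi>_eq: "\<And>t. 0 \<le> t \<Longrightarrow> has_weak_deriv Om [ez] (\<lambda>p. (u t p)\<^sup>2) (\<lambda>p. - weak_laplacian Om (\<psi>t t) p)"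
    and bc: "\<And>t. 0 \<le> t \<Longrightarrow> boundary_condition a b (\<psi> t)"
    and U0: "is_cont_rep Om (u 0) U0" "\<And>p. p \<in> frontier Om \<Longrightarrow> U0 p = 0"
begin

lemma time: "t \<in> time_interval \<infinity> \<longleftrightarrow> 0 \<le> t" "time_interval \<infinity> = {0..}"
  by (auto simp: time_interval_def)

lemma derivs_upto_2: "[ez] \<in> derivs_upto 2" "[] \<in> derivs_upto 2"
  using ez_Basis by (auto simp: derivs_upto_def)

abbreviation D where "D t \<equiv> weak_deriv Om [ez] (\<psi> t)"

context
  fixes t :: real assumes t: "0 \<le> t"
begin

lemma t': "t \<in> time_interval \<infinity>" using t by (simp add: time)

lemma L2s: "u t \<in> L2_space Om" "ut t \<in> L2_space Om" "D t \<in> L2_space Om"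
  and sob: "u t \<in> sobolev 2 Om" "ut t \<in> sobolev 2 Om" "\<psi> t \<in> sobolev 3 Om" "\<psi>t t \<in> sobolev 3 Om"
  using C1_curve_sobolev[OF Cu t'] C1_curve_sobolev[OF C\<psi> t'] weak_deriv_L2[OF _ derivs_upto_point(1)]
  by (auto intro: sobolev_L2)

lemma D_rep: "\<exists>g. is_cont_rep Om (D t) g \<and> (\<forall>p\<in>Gam a b. g p = 0)"
  using bc[OF t] by (auto simp: boundary_condition_def vanishes_on_def Omega_eq e_z_eq)

lemma laplacian_integrable: "integrable M (weak_laplacian Om (\<psi>t t))"
  unfolding laplacian_sum[abs_def]
  by (intro Bochner_Integration.integrable_add L2_integrable weak_deriv_L2[OF sob(4)] derivs_upto_point)
    (simp_all add: Basis_point)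

text \<open>The test function b - z removes the upper face from the boundary limit of
  \<open>u\<^sup>2\<close>, whose weak z-derivative is integrable by the second equation. What
  remains is the average near the lower face.\<close>

lemma square_flux_lower:
  "\<exists>L. (\<lambda>n. LINT p|M. (u t p)\<^sup>2 * (b - snd p) * locut ez n ((0, 0), 0) ((a, a), b) p) \<longlonglongrightarrow> L"
proof -
  let ?lo = "\<lambda>n. locut ez n ((0, 0), 0) ((a, a), b)" and ?up = "\<lambda>n. upcut ez n ((0, 0), 0) ((a, a), b)"
  let ?h = "\<lambda>p::point. b + (-1) * (p \<bullet> ez)"
  have h: "smooth_term ?h" by (intro smooth_term.add smooth_term.mult smooth_term.const smooth_term_coord)
  have i: "integrable M (\<lambda>p. (u t p)\<^sup>2)" by (rule L2_square[OF L2s(1)])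
  have ih: "integrable M (\<lambda>p. (u t p)\<^sup>2 * ?h p)" by (rule integrable_mult_smooth[OF h i])
  have 1: "(\<lambda>n. LINT p|M. (u t p)\<^sup>2 * ?h p * (?lo n p - ?up n p)) \<longlonglongrightarrow>
     - (LINT p|M. - weak_laplacian Om (\<psi>t t) p * ?h p) - (LINT p|M. (u t p)\<^sup>2 * iter_deriv [ez] ?h p)"
    by (rule weak_deriv_boundary_limit[OF \<psi>_eq[OF t] i _ ez_Basis h]) (simp add: laplacian_integrable)
  have 2: "(\<lambda>n. LINT p|M. (u t p)\<^sup>2 * ?h p * ?up n p) \<longlonglongrightarrow> 0"
    by (rule upcut_test_tendsto_0[OF ez_Basis i h, where C = 1]) (simp add: mem_Om)
  have "(LINT p|M. (u t p)\<^sup>2 * ?h p * (?lo n p - ?up n p)) =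
     (LINT p|M. (u t p)\<^sup>2 * ?h p * ?lo n p) - (LINT p|M. (u t p)\<^sup>2 * ?h p * ?up n p)" for n
    unfolding right_diff_distrib[of _ "?lo n _" "?up n _"]
    by (rule Bochner_Integration.integral_diff[OF cut_mult_integrable[OF ih]])
  then have eq: "(LINT p|M. (u t p)\<^sup>2 * (b - snd p) * ?lo n p) =
     (LINT p|M. (u t p)\<^sup>2 * ?h p * (?lo n p - ?up n p)) + (LINT p|M. (u t p)\<^sup>2 * ?h p * ?up n p)" for n
    by simp
  show ?thesis unfolding eq by (rule exI, rule tendsto_add[OF 1 2])
qed

text \<open>One factor of the square is bounded by the maximum of the continuous representative, the
  other tends to zero at the face.\<close>

lemma D_flux_lower:
  "(\<lambda>n. LINT p|M. (D t p)\<^sup>2 * (b - snd p) * locut ez n ((0, 0), 0) ((a, a), b) p) \<longlonglongrightarrow> 0"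
proof -
  obtain g where g: "is_cont_rep Om (D t) g" "\<forall>p\<in>Gam a b. g p = 0" using D_rep by blast
  then have "continuous_on (closure Om) g" by (simp add: is_cont_rep_def)
  then obtain B where B: "\<And>p. p \<in> closure Om \<Longrightarrow> \<bar>g p\<bar> \<le> B" by (rule continuous_bounded) blast
  show ?thesis
  proof (rule locut_function_tendsto_0(2)[OF ez_Basis g(1), where C = "B * b"])
    fix p assume "p \<in> Om"
    then show "g (p + (((0, 0), 0) \<bullet> ez - p \<bullet> ez) *\<^sub>R ez) = 0"
      using g(2) by (cases p) (auto simp: Gam_def mem_Om Omega_x_eq)
  next
    have "smooth_term (\<lambda>p::point. b + (-1) * (p \<bullet> ez))"
      by (intro smooth_term.add smooth_term.mult smooth_term.const smooth_term_coord)
    from integrable_mult_smooth[OF this L2_square[OF L2s(3)]]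
    show "(\<lambda>p. (D t p)\<^sup>2 * (b - snd p)) \<in> borel_measurable M" by simp
    have "AE p in M. D t p = g p" using g(1) by (simp add: is_cont_rep_def)
    then show "AE p in M. \<bar>(D t p)\<^sup>2 * (b - snd p)\<bar> \<le> B * b * \<bar>D t p\<bar>"
      using AE_space
    proof eventually_elim
      case (elim p)
      have p: "p \<in> Om" "p \<in> closure Om" using elim closure_subset by auto
      have "\<bar>D t p\<bar> * \<bar>b - snd p\<bar> \<le> B * b"
        using B[OF p(2)] elim p(1) by (intro mult_mono) (auto simp: mem_Om)
      from mult_right_mono[OF this abs_ge_zero[of "D t p"]]
      show ?case by (simp add: abs_mult power2_eq_square mult_ac)
    qed
  qed
qed

text \<open>No pointwise bound of \<open>u\<close> is needed: by the second equation \<open>u\<^sup>2\<close> has an integrable weak \<open>z\<close>-derivative, so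
  its averages near \<open>z = 0\<close> stay bounded, and those of \<open>\<psi>\<^sub>z\<^sup>2\<close> tend to zero.\<close>

lemma rate_trace_zero:
  assumes h: "smooth_term h" and hb: "\<And>p. p \<in> Om \<Longrightarrow> \<bar>h p\<bar> \<le> b - snd p"
  shows "(LINT p|M. weak_deriv Om [ez] (ut t) p * h p) = - (LINT p|M. ut t p * iter_deriv [ez] h p)"
proof (rule integration_by_parts[OF weak_deriv_weak[OF sob(2) derivs_upto_2(1)] L2_integrable[OF L2s(2)]
      L2_integrable[OF weak_deriv_L2[OF sob(2) derivs_upto_2(1)]] ez_Basis h])
  let ?lo = "\<lambda>n. locut ez n ((0, 0), 0) ((a, a), b)"
  show "(\<lambda>n. LINT p|M. ut t p * h p * upcut ez n ((0, 0), 0) ((a, a), b) p) \<longlonglongrightarrow> 0"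
    by (rule upcut_test_tendsto_0[OF ez_Basis L2_integrable[OF L2s(2)] h, where C = 1]) (use hb in simp)
  obtain L where L: "(\<lambda>n. LINT p|M. (u t p)\<^sup>2 * (b - snd p) * ?lo n p) \<longlonglongrightarrow> L"
    using square_flux_lower by blast
  have hz: "smooth_term (\<lambda>p::point. b + (-1) * (p \<bullet> ez))"
    by (intro smooth_term.add smooth_term.mult smooth_term.const smooth_term_coord)
  show "(\<lambda>n. LINT p|M. ut t p * h p * ?lo n p) \<longlonglongrightarrow> 0"
  proof (rule tendsto_0_of_weighted_bound[OF _ L D_flux_lower])
    fix n and \<epsilon> :: real assume \<epsilon>: "0 < \<epsilon>"
    have i: "integrable M (\<lambda>p. (u t p)\<^sup>2 * (b - snd p) * ?lo n p)" "integrable M (\<lambda>p. (D t p)\<^sup>2 * (b - snd p) * ?lo n p)"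
      using integrable_mult_smooth[OF hz L2_square[OF L2s(1)]] integrable_mult_smooth[OF hz L2_square[OF L2s(3)]]
      by (auto intro: cut_mult_integrable)
    have "\<bar>LINT p|M. ut t p * h p * ?lo n p\<bar> \<le> (LINT p|M. \<bar>ut t p * h p * ?lo n p\<bar>)"
      by (rule integral_abs_bound)
    also have "\<dots> \<le> (LINT p|M. \<epsilon> * ((u t p)\<^sup>2 * (b - snd p) * ?lo n p) + (D t p)\<^sup>2 * (b - snd p) * ?lo n p / \<epsilon>)"
    proof (rule integral_mono_AE)
      show "integrable M (\<lambda>p. \<bar>ut t p * h p * ?lo n p\<bar>)"
        by (intro integrable_abs cut_mult_integrable integrable_mult_smooth[OF h] L2_integrable[OF L2s(2)])
      show "integrable M (\<lambda>p. \<epsilon> * ((u t p)\<^sup>2 * (b - snd p) * ?lo n p) + (D t p)\<^sup>2 * (b - snd p) * ?lo n p / \<epsilon>)"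
        using i by simp
      show "AE p in M. \<bar>ut t p * h p * ?lo n p\<bar> \<le> \<epsilon> * ((u t p)\<^sup>2 * (b - snd p) * ?lo n p) + (D t p)\<^sup>2 * (b - snd p) * ?lo n p / \<epsilon>"
        using u_eq[OF t] AE_space
      proof eventually_elim
        case (elim p)
        have p: "p \<in> Om" using elim by simp
        \<comment> \<open>The equation gives ut = 2 u \<open>\<psi>\<^sub>z\<close>, which is split
          by the weighted arithmetic-geometric mean inequality into the two quantities controlled
          above.\<close>
        have "0 \<le> (\<epsilon> * \<bar>u t p\<bar> - \<bar>D t p\<bar>)\<^sup>2" by simp
        then have "2 * \<epsilon> * (\<bar>u t p\<bar> * \<bar>D t p\<bar>) \<le> \<epsilon>\<^sup>2 * (u t p)\<^sup>2 + (D t p)\<^sup>2"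
          by (simp add: power2_diff power_mult_distrib mult_ac)
        then have "\<bar>ut t p\<bar> \<le> \<epsilon> * (u t p)\<^sup>2 + (D t p)\<^sup>2 / \<epsilon>"
          using \<epsilon> elim by (simp add: abs_mult field_simps power2_eq_square)
        moreover have "0 \<le> \<epsilon> * (u t p)\<^sup>2 + (D t p)\<^sup>2 / \<epsilon>" using \<epsilon> by simp
        ultimately have "\<bar>ut t p\<bar> * \<bar>h p\<bar> \<le> (\<epsilon> * (u t p)\<^sup>2 + (D t p)\<^sup>2 / \<epsilon>) * (b - snd p)"
          using hb[OF p] by (intro mult_mono) auto
        from mult_right_mono[OF this locut_nonneg[of ez n "((0, 0), 0)" "((a, a), b)" p]]
        show ?case by (simp add: abs_mult distrib_right mult.assoc)
      qed
    qed
    also have "\<dots> = \<epsilon> * (LINT p|M. (u t p)\<^sup>2 * (b - snd p) * ?lo n p) + (LINT p|M. (D t p)\<^sup>2 * (b - snd p) * ?lo n p) / \<epsilon>"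
      using i by simp
    finally show "\<bar>LINT p|M. ut t p * h p * ?lo n p\<bar> \<le> \<epsilon> * (LINT p|M. (u t p)\<^sup>2 * (b - snd p) * ?lo n p) + (LINT p|M. (D t p)\<^sup>2 * (b - snd p) * ?lo n p) / \<epsilon>" .
  qed
qed

end

lemma smooth_L2: "smooth_term h \<Longrightarrow> h \<in> L2_space Om"
  using smooth_bounded[of h] L2_bounded[OF borel_on[OF smooth_term_borel]] by auto

text \<open>The test function \<open>h\<close> vanishes on \<open>z = b\<close> only. The defect in the integration by parts formula is
  constant in time since its time derivative is the defect for \<open>u\<^sub>t\<close>.\<close>

lemma trace_zero:
  assumes t: "0 \<le> t" and h: "smooth_term h" and hb: "\<And>p. p \<in> Om \<Longrightarrow> \<bar>h p\<bar> \<le> b - snd p"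
  shows "(LINT p|M. weak_deriv Om [ez] (u t) p * h p) = - (LINT p|M. u t p * iter_deriv [ez] h p)"
proof -
  let ?k = "iter_deriv [ez] h"
  have k: "smooth_term ?k" by (rule smooth_term_iter_deriv[OF h])
  \<comment> \<open>The defect at time t. Writing \<open>weak_deriv Om []\<close> for
    \<open>u t\<close> itself puts both terms into the form that
    \<open>C1_curve_pairing_deriv\<close> differentiates.\<close>
  define l where "l t = (LINT p|M. weak_deriv Om [ez] (u t) p * h p) + (LINT p|M. weak_deriv Om [] (u t) p * ?k p)" for t
  have Nil: "(LINT p|M. weak_deriv Om [] f p * ?k p) = (LINT p|M. f p * ?k p)" if f: "f \<in> sobolev 2 Om" for f
  proof (rule integral_cong_AE)
    show "AE p in M. weak_deriv Om [] f p * ?k p = f p * ?k p"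
      using weak_deriv_Nil_AE[OF sobolev_L2[OF f]] by eventually_elim simp
  qed (intro borel_measurable_integrable integrable_mult_smooth[OF k] L2_integrable weak_deriv_L2[OF f derivs_upto_2(2)] sobolev_L2[OF f])+
  have D0: "(l has_real_derivative 0) (at t within {0..})" if t: "0 \<le> t" for t
  proof -
    have r: "(LINT p|M. weak_deriv Om [ez] (ut t) p * h p) = - (LINT p|M. ut t p * ?k p)"
      by (rule rate_trace_zero[OF t h]) (rule hb)
    have "(l has_real_derivative (LINT p|M. weak_deriv Om [ez] (ut t) p * h p) + (LINT p|M. weak_deriv Om [] (ut t) p * ?k p))
        (at t within time_interval \<infinity>)"
      unfolding l_def
      by (intro DERIV_add C1_curve_pairing_deriv[OF Cu] derivs_upto_2 smooth_L2 h k) (simp_all add: time t)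
    then show ?thesis
      unfolding time(2) Nil[OF sob(2)[OF t]] r left_minus .
  qed
  have D1: "((\<lambda>t. - l t) has_real_derivative 0) (at t within {0..})" if "0 \<le> t" for t
    using DERIV_minus[OF D0[OF that]] by simp
  have "l 0 \<le> l t"
    by (rule nondecreasing_on_halfline[OF D0, of 0]) (use t in auto)
  moreover have "- l 0 \<le> - l t"
    by (rule nondecreasing_on_halfline[OF D1, of 0]) (use t in auto)
  ultimately have lt: "l t = l 0" by simp
  have i0: "integrable M (u 0)" by (rule L2_integrable[OF L2s(1)]) simp
  have s0: "u 0 \<in> sobolev 2 Om" by (rule sob(1)) simp
  \<comment> \<open>At time 0 the defect vanishes because the continuous representative
    \<open>U0\<close> is zero on the bottom face.\<close>
  have "(LINT p|M. weak_deriv Om [ez] (u 0) p * h p) = - (LINT p|M. u 0 p * ?k p)"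
  proof (rule integration_by_parts[OF weak_deriv_weak[OF s0 derivs_upto_2(1)] i0
      L2_integrable[OF weak_deriv_L2[OF s0 derivs_upto_2(1)]] ez_Basis h])
    obtain B where B: "AE p in M. \<bar>u 0 p * h p\<bar> \<le> B * \<bar>u 0 p\<bar>" using function_mult_smooth(2)[OF i0 h] by auto
    show "(\<lambda>n. LINT p|M. u 0 p * h p * locut ez n ((0, 0), 0) ((a, a), b) p) \<longlonglongrightarrow> 0"
    proof (rule locut_function_tendsto_0(2)[OF ez_Basis U0(1) _ function_mult_smooth(1)[OF i0 h] B])
      fix p assume "p \<in> Om"
      then show "U0 (p + (((0, 0), 0) \<bullet> ez - p \<bullet> ez) *\<^sub>R ez) = 0"
        by (intro U0(2); cases p) (auto simp: frontier_Om mem_Om)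
    qed
    show "(\<lambda>n. LINT p|M. u 0 p * h p * upcut ez n ((0, 0), 0) ((a, a), b) p) \<longlonglongrightarrow> 0"
      by (rule upcut_test_tendsto_0[OF ez_Basis i0 h, where C = 1]) (use hb in simp)
  qed
  then have "l 0 = 0" by (simp add: l_def Nil[OF s0] del: iter_deriv.simps)
  with lt show ?thesis by (simp add: l_def Nil[OF sob(1)[OF t]] del: iter_deriv.simps)
qed

text \<open>The two sides differ by the flux of \<open>u\<^sup>2\<close> through z = b, weighted by
  \<open>w\<^sub>z\<close>, which is negative. On z = 0 the zero trace and
  \<open>vertical_bound\<close> give the linear decay of \<open>u\<^sup>2\<close> that
  \<open>boundary_kernel_dominated\<close> asks for.\<close>

lemma laplacian_rate:
  assumes t: "0 \<le> t"
  shows "\<alpha>\<^sup>2 * (LINT p|M. (u t p)\<^sup>2 * w\<^sub>\<phi> p) \<le> (LINT p|M. weak_laplacian Om (\<psi>t t) p * w\<^sub>z p)"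
proof -
  let ?lo = "\<lambda>n. locut ez n ((0, 0), 0) ((a, a), b)" and ?up = "\<lambda>n. upcut ez n ((0, 0), 0) ((a, a), b)"
  have i: "integrable M (\<lambda>p. (u t p)\<^sup>2)" by (rule L2_square[OF L2s(1)[OF t]])
  have iw: "integrable M (\<lambda>p. (u t p)\<^sup>2 * w\<^sub>z p)" by (rule integrable_mult_smooth[OF smooth_w\<^sub>z i])
  obtain V where V: "integrable M V" "AE p in M. (u t p)\<^sup>2 \<le> (snd p - snd (((0, 0), 0) :: point)) * V p"
  proof (rule vertical_bound[OF L2s(1)[OF t] weak_deriv_L2[OF sob(1)[OF t] derivs_upto_2(1)]])
    fix h :: "point \<Rightarrow> real" assume "smooth_term h" "\<And>p. p \<in> Om \<Longrightarrow> \<bar>h p\<bar> \<le> snd ((a, a), b) - snd p"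
    then show "(LINT p|M. weak_deriv Om [ez] (u t) p * h p) = - (LINT p|M. u t p * iter_deriv [ez] h p)"
      by (intro trace_zero[OF t]) simp_all
  qed (rule that)
  obtain B where B: "\<forall>p\<in>Om. \<bar>w\<^sub>z p\<bar> \<le> B" using smooth_bounded[OF smooth_w\<^sub>z] by auto
  have lo: "(\<lambda>n. LINT p|M. (u t p)\<^sup>2 * w\<^sub>z p * ?lo n p) \<longlonglongrightarrow> 0"
  proof (rule boundary_kernel_dominated[OF boundary_kernel_locut[OF ez_Basis], where V = "\<lambda>p. B * V p"])
    show "AE p in M. \<bar>(u t p)\<^sup>2 * w\<^sub>z p\<bar> \<le> (p \<bullet> ez - ((0, 0), 0) \<bullet> ez) * (B * V p)"
      using V(2) AE_space
    proof eventually_elim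
      case (elim p)
      then have "\<bar>w\<^sub>z p\<bar> \<le> B" using B by simp
      then have "(u t p)\<^sup>2 * \<bar>w\<^sub>z p\<bar> \<le> (snd p * V p) * B" using elim by (intro mult_mono) (auto intro: order_trans[OF zero_le_power2])
      then show ?case by (simp add: abs_mult mult_ac)
    qed
  qed (use V iw in auto)
  have lim: "(\<lambda>n. LINT p|M. (u t p)\<^sup>2 * w\<^sub>z p * (?lo n p - ?up n p)) \<longlonglongrightarrow>
     - (LINT p|M. - weak_laplacian Om (\<psi>t t) p * w\<^sub>z p) - (LINT p|M. (u t p)\<^sup>2 * iter_deriv [ez] w\<^sub>z p)"
    by (rule weak_deriv_boundary_limit[OF \<psi>_eq[OF t] i _ ez_Basis smooth_w\<^sub>z]) (simp add: laplacian_integrable[OF t])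
  have "0 \<le> (- (LINT p|M. - weak_laplacian Om (\<psi>t t) p * w\<^sub>z p) - (LINT p|M. (u t p)\<^sup>2 * iter_deriv [ez] w\<^sub>z p)) - 0"
  proof (rule LIMSEQ_le_const[OF tendsto_diff[OF lim lo]], intro exI allI impI)
    fix n
    have "(LINT p|M. (u t p)\<^sup>2 * w\<^sub>z p * (?lo n p - ?up n p)) - (LINT p|M. (u t p)\<^sup>2 * w\<^sub>z p * ?lo n p)
       = - (LINT p|M. (u t p)\<^sup>2 * w\<^sub>z p * ?up n p)"
      unfolding right_diff_distrib using cut_mult_integrable[OF iw] by simp
    also have "\<dots> = (LINT p|M. - ((u t p)\<^sup>2 * w\<^sub>z p * ?up n p))" by simp
    also have "0 \<le> \<dots>"
    proof (rule integral_nonneg_AE, rule AE_I2)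
      fix p assume "p \<in> space M"
      then have "w\<^sub>z p \<le> 0" using w\<^sub>z_neg[of p] by simp
      then have "(u t p)\<^sup>2 * w\<^sub>z p * ?up n p \<le> 0" by (intro mult_nonpos_nonneg mult_nonneg_nonpos) auto
      then show "0 \<le> - ((u t p)\<^sup>2 * w\<^sub>z p * ?up n p)" by simp
    qed
    finally show "0 \<le> (LINT p|M. (u t p)\<^sup>2 * w\<^sub>z p * (?lo n p - ?up n p)) - (LINT p|M. (u t p)\<^sup>2 * w\<^sub>z p * ?lo n p)" .
  qed
  moreover have "(LINT p|M. (u t p)\<^sup>2 * iter_deriv [ez] w\<^sub>z p) = \<alpha>\<^sup>2 * (LINT p|M. (u t p)\<^sup>2 * w\<^sub>\<phi> p)"
    unfolding w\<^sub>z_deriv by (simp add: mult.left_commute)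
  ultimately show ?thesis by simp
qed

subsection \<open>The regularised entropy\<close>

definition mass :: real where "mass = (LINT p|lebesgue_on Om. w\<^sub>\<phi> p)"
definition F :: "real \<Rightarrow> real" where "F t = (LINT p|lebesgue_on Om. (u t p)\<^sup>2 * w\<^sub>\<phi> p)"
definition P :: "real \<Rightarrow> real" where "P t = 2 * (LINT p|lebesgue_on Om. D t p * w\<^sub>\<phi> p)"
definition ent :: "real \<Rightarrow> real \<Rightarrow> real" where "ent \<delta> t = (LINT p|lebesgue_on Om. ln ((u t p)\<^sup>2 + \<delta>) / 2 * w\<^sub>\<phi> p)"
text \<open>The derivative of \<open>ent\<close> after inserting the equation for \<open>ut\<close>.
  The quotient lies between 0 and 1 and tends to 1 as \<delta> tends to 0 exactly where
  \<open>u\<close> is nonzero, so \<open>u_nonzero\<close> must precede that limit.\<close>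

definition ent' :: "real \<Rightarrow> real \<Rightarrow> real" where
  "ent' \<delta> t = (LINT p|lebesgue_on Om. 2 * ((u t p)\<^sup>2 / ((u t p)\<^sup>2 + \<delta>)) * (D t p * w\<^sub>\<phi> p))"
text \<open>A majorant of \<open>ent'\<close> for all \<delta> at once, continuous in time; it
  dominates when \<delta> tends to 0 under the time integral.\<close>

definition drift :: "real \<Rightarrow> real" where "drift t = (LINT p|lebesgue_on Om. \<bar>D t p\<bar> * (2 * w\<^sub>\<phi> p))"

lemma weight_measurable: "w\<^sub>\<phi> \<in> borel_measurable M" by (rule borel_on[OF smooth_term_borel[OF smooth_w\<^sub>\<phi>]])

lemma weight_bounded: "\<exists>B. \<forall>p\<in>Om. \<bar>w\<^sub>\<phi> p\<bar> \<le> B" using smooth_bounded[OF smooth_w\<^sub>\<phi>] by blast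

lemma weight_integrable: "integrable M w\<^sub>\<phi>" by (rule L2_integrable[OF smooth_L2[OF smooth_w\<^sub>\<phi>]])

lemma mass_pos: "0 < mass"
proof -
  have "0 \<le> mass" unfolding mass_def using w\<^sub>\<phi>_pos by (intro integral_nonneg_AE AE_I2) (simp add: less_imp_le)
  moreover have "mass \<noteq> 0"
  proof
    assume "mass = 0"
    then have "AE p in M. w\<^sub>\<phi> p = 0"
      using w\<^sub>\<phi>_pos unfolding mass_def
      by (subst (asm) integral_nonneg_eq_0_iff_AE[OF weight_integrable]) (auto simp: less_imp_le)
    then have "AE p in M. False" using AE_space by eventually_elim (use w\<^sub>\<phi>_pos in force)
    then have "negligible Om" by (simp add: AE_restrict_space_iff eventually_ae_filter_negligible) (metis negligible_subset subsetI)
    then show False using open_not_negligible[of Om] a_pos b_pos by (auto simp: box_ne_empty Basis_point)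
  qed
  ultimately show ?thesis by simp
qed

lemma ent_integrable: "0 \<le> t \<Longrightarrow> 0 < \<delta> \<Longrightarrow> \<delta> \<le> 1 \<Longrightarrow> integrable M (\<lambda>p. ln ((u t p)\<^sup>2 + \<delta>) / 2 * w\<^sub>\<phi> p)"
  using weight_bounded entropy_integrable[OF L2s(1) weight_measurable] by blast

lemma D_weight_integrable: "0 \<le> t \<Longrightarrow> integrable M (\<lambda>p. D t p * w\<^sub>\<phi> p)"
  by (intro integrable_mult_smooth[OF smooth_w\<^sub>\<phi>] L2_integrable L2s(3))

lemma ent_deriv:
  assumes t: "0 \<le> t" and \<delta>: "0 < \<delta>" "\<delta> \<le> 1"
  shows "(ent \<delta> has_real_derivative ent' \<delta> t) (at t within {0..})"
proof -
  obtain B where B: "\<And>p. p \<in> Om \<Longrightarrow> \<bar>w\<^sub>\<phi> p\<bar> \<le> B" using weight_bounded by auto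
  have "(ent \<delta> has_real_derivative (LINT p|M. u t p / ((u t p)\<^sup>2 + \<delta>) * ut t p * w\<^sub>\<phi> p)) (at t within {0..})"
    using C1_curve_entropy_deriv[OF Cu _ weight_measurable B \<delta>, of t] t
    unfolding time ent_def by simp
  also have "(LINT p|M. u t p / ((u t p)\<^sup>2 + \<delta>) * ut t p * w\<^sub>\<phi> p) = ent' \<delta> t"
    unfolding ent'_def
  proof (rule integral_cong_AE)
    note [measurable] = L2_measurable[OF L2s(1)[OF t]] L2_measurable[OF L2s(2)[OF t]] L2_measurable[OF L2s(3)[OF t]] weight_measurable
    show "(\<lambda>p. u t p / ((u t p)\<^sup>2 + \<delta>) * ut t p * w\<^sub>\<phi> p) \<in> borel_measurable M"
      "(\<lambda>p. 2 * ((u t p)\<^sup>2 / ((u t p)\<^sup>2 + \<delta>)) * (D t p * w\<^sub>\<phi> p)) \<in> borel_measurable M" by measurable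
    show "AE p in M. u t p / ((u t p)\<^sup>2 + \<delta>) * ut t p * w\<^sub>\<phi> p = 2 * ((u t p)\<^sup>2 / ((u t p)\<^sup>2 + \<delta>)) * (D t p * w\<^sub>\<phi> p)"
      using u_eq[OF t] by eventually_elim (simp add: power2_eq_square)
  qed
  finally show ?thesis .
qed

lemma ent'_integrable_bound:
  assumes t: "0 \<le> t" and \<delta>: "0 < \<delta>"
  shows "AE p in M. \<bar>2 * ((u t p)\<^sup>2 / ((u t p)\<^sup>2 + \<delta>)) * (D t p * w\<^sub>\<phi> p)\<bar> \<le> \<bar>D t p\<bar> * (2 * w\<^sub>\<phi> p)"
    "integrable M (\<lambda>p. \<bar>D t p\<bar> * (2 * w\<^sub>\<phi> p))"
proof -
  show "AE p in M. \<bar>2 * ((u t p)\<^sup>2 / ((u t p)\<^sup>2 + \<delta>)) * (D t p * w\<^sub>\<phi> p)\<bar> \<le> \<bar>D t p\<bar> * (2 * w\<^sub>\<phi> p)"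
  proof (rule AE_I2)
    fix p assume "p \<in> space M"
    then have w: "0 \<le> w\<^sub>\<phi> p" using w\<^sub>\<phi>_pos[of p] by simp
    have "0 < (u t p)\<^sup>2 + \<delta>" using \<delta> by (simp add: add_nonneg_pos)
    then have "0 \<le> (u t p)\<^sup>2 / ((u t p)\<^sup>2 + \<delta>)" "(u t p)\<^sup>2 / ((u t p)\<^sup>2 + \<delta>) \<le> 1" using \<delta> by (auto simp: divide_le_eq_1)
    then have q: "\<bar>(u t p)\<^sup>2 / ((u t p)\<^sup>2 + \<delta>)\<bar> \<le> 1" by (simp only: abs_of_nonneg)
    have "\<bar>(u t p)\<^sup>2 / ((u t p)\<^sup>2 + \<delta>)\<bar> * (\<bar>D t p\<bar> * w\<^sub>\<phi> p) \<le> 1 * (\<bar>D t p\<bar> * w\<^sub>\<phi> p)"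
      by (rule mult_right_mono[OF q]) (use w in simp)
    then show "\<bar>2 * ((u t p)\<^sup>2 / ((u t p)\<^sup>2 + \<delta>)) * (D t p * w\<^sub>\<phi> p)\<bar> \<le> \<bar>D t p\<bar> * (2 * w\<^sub>\<phi> p)"
      using w by (simp add: abs_mult mult_ac)
  qed
  have "integrable M (\<lambda>p. 2 * \<bar>D t p * w\<^sub>\<phi> p\<bar>)" using D_weight_integrable[OF t] by simp
  then show "integrable M (\<lambda>p. \<bar>D t p\<bar> * (2 * w\<^sub>\<phi> p))"
    by (rule Bochner_Integration.integrable_cong[THEN iffD1, rotated -1])
      (auto simp: abs_mult w\<^sub>\<phi>_pos[THEN less_imp_le])
qed

lemma ent'_bound:
  assumes t: "0 \<le> t" and \<delta>: "0 < \<delta>"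
  shows "\<bar>ent' \<delta> t\<bar> \<le> drift t"
proof -
  note [measurable] = L2_measurable[OF L2s(1)[OF t]] L2_measurable[OF L2s(3)[OF t]] weight_measurable
  have m: "(\<lambda>p. 2 * ((u t p)\<^sup>2 / ((u t p)\<^sup>2 + \<delta>)) * (D t p * w\<^sub>\<phi> p)) \<in> borel_measurable M" by measurable
  have i: "integrable M (\<lambda>p. 2 * ((u t p)\<^sup>2 / ((u t p)\<^sup>2 + \<delta>)) * (D t p * w\<^sub>\<phi> p))"
    by (rule Bochner_Integration.integrable_bound[OF ent'_integrable_bound(2)[OF t \<delta>] m])
      (use ent'_integrable_bound(1)[OF t \<delta>] in \<open>auto elim: eventually_mono\<close>)
  show ?thesis
    unfolding ent'_def drift_def
    by (rule order_trans[OF integral_abs_bound integral_mono_AE[OF integrable_abs[OF i] ent'_integrable_bound(2)[OF t \<delta>] ent'_integrable_bound(1)[OF t \<delta>]]])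
qed

lemma drift_continuous: "continuous_on {0..} drift"
  unfolding drift_def[abs_def] time(2)[symmetric]
proof (rule C1_curve_abs_continuous[OF C\<psi> derivs_upto_point(1)])
  show "(\<lambda>p. 2 * w\<^sub>\<phi> p) \<in> L2_space Om" by (intro smooth_L2 smooth_term.mult smooth_term.const smooth_w\<^sub>\<phi>)
qed (simp add: w\<^sub>\<phi>_pos less_imp_le)

lemma P_continuous: "continuous_on {0..} P"
proof -
  have "((\<lambda>t. LINT p|M. D t p * w\<^sub>\<phi> p) has_real_derivative (LINT p|M. weak_deriv Om [ez] (\<psi>t t) p * w\<^sub>\<phi> p)) (at t within {0..})"
    if "0 \<le> t" for t
    using C1_curve_pairing_deriv[OF C\<psi> _ derivs_upto_point(1) smooth_L2[OF smooth_w\<^sub>\<phi>], of t] that unfolding time by simp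
  then have "continuous_on {0..} (\<lambda>t. LINT p|M. D t p * w\<^sub>\<phi> p)"
    by (auto simp: continuous_on_eq_continuous_within intro: DERIV_continuous)
  then show ?thesis unfolding P_def[abs_def] by (intro continuous_intros)
qed

text \<open>The fundamental theorem for the gauge integral requires only that \<open>ent'\<close> be
  the derivative, not that it be continuous in time.\<close>

lemma ent'_has_integral:
  assumes t: "0 \<le> t" and \<delta>: "0 < \<delta>" "\<delta> \<le> 1"
  shows "(ent' \<delta> has_integral (ent \<delta> t - ent \<delta> 0)) {0..t}"
proof (rule fundamental_theorem_of_calculus[OF t])
  fix s assume "s \<in> {0..t}"
  then have "(ent \<delta> has_real_derivative ent' \<delta> s) (at s within {0..t})"
    by (intro DERIV_subset[OF ent_deriv[OF _ \<delta>]]) auto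
  then show "(ent \<delta> has_vector_derivative ent' \<delta> s) (at s within {0..t})"
    by (simp add: has_real_derivative_iff_has_vector_derivative)
qed

lemma drift_integrable: "0 \<le> t \<Longrightarrow> drift integrable_on {0..t}"
  by (intro integrable_continuous_interval continuous_on_subset[OF drift_continuous]) auto

text \<open>Boundary values are prescribed for \<open>\<psi>\<close> but not for
  \<open>\<psi>t\<close>, so Green's formula is evaluated on \<open>\<psi>\<close> and this pairing
  is differentiated in time.\<close>

definition Lam :: "real \<Rightarrow> real" where "Lam t = (LINT p|lebesgue_on Om. weak_laplacian Om (\<psi> t) p * w\<^sub>z p)"

lemma Lam_deriv:
  assumes t: "0 \<le> t"
  shows "(Lam has_real_derivative (LINT p|M. weak_laplacian Om (\<psi>t t) p * w\<^sub>z p)) (at t within {0..})"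
proof -
  have eB: "e1 \<in> Basis" "e2 \<in> Basis" by (simp_all add: Basis_point)
  let ?L = "\<lambda>f. (LINT p|M. weak_deriv Om [e1, e1] f p * w\<^sub>z p)
     + (LINT p|M. weak_deriv Om [e2, e2] f p * w\<^sub>z p) + (LINT p|M. weak_deriv Om [ez, ez] f p * w\<^sub>z p)"
  have "((\<lambda>s. ?L (\<psi> s)) has_real_derivative ?L (\<psi>t t)) (at t within time_interval \<infinity>)"
    by (intro DERIV_add C1_curve_pairing_deriv[OF C\<psi>] derivs_upto_point eB ez_Basis smooth_L2 smooth_w\<^sub>z) (simp_all add: time t)
  then have 1: "((\<lambda>s. ?L (\<psi> s)) has_real_derivative ?L (\<psi>t t)) (at t within {0..})" by (simp only: time)
  show ?thesis
    unfolding laplacian_pairing[OF sob(4)[OF t]]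
  proof (rule has_field_derivative_transform_within[OF 1 zero_less_one])
    show "t \<in> {0..}" using t by simp
    show "?L (\<psi> s) = Lam s" if "s \<in> {0..}" for s
      unfolding Lam_def using laplacian_pairing[OF sob(3)] that by simp
  qed
qed

definition bottom :: "(point \<Rightarrow> real) \<Rightarrow> real" where
  "bottom G = (LINT x|lebesgue_on (Omega_x a). G (x, 0) * (sn (fst x) * sn (snd x)))"

lemma Lam_green:
  assumes t: "0 \<le> t" and G: "is_cont_rep Om (\<psi> t) G"
  shows "Lam t = \<alpha>\<^sup>2 * P t / 2 + 2 * \<alpha>\<^sup>2 * sh 0 * bottom G"
  using green[OF sob(3)[OF t] bc[OF t] G] by (simp add: Lam_def P_def bottom_def)

context
  fixes A :: real
  assumes A: "\<And>\<delta>. 0 < \<delta> \<Longrightarrow> \<delta> \<le> 1 \<Longrightarrow> A \<le> ent \<delta> 0"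
begin

text \<open>On the zero set of \<open>u\<close> the entropy density is ln \<delta> / 2, elsewhere it
  is at most the density for \<delta> = 1. As \<open>ent \<delta> t\<close> stays above
  \<open>A\<close> minus the integral of \<open>drift\<close> for every \<delta>, the zero set must
  have weighted measure zero, and the weight is positive.\<close>

lemma u_nonzero:
  assumes t: "0 \<le> t" shows "AE p in M. u t p \<noteq> 0"
proof -
  note [measurable] = L2_measurable[OF L2s(1)[OF t]] weight_measurable
  define Z where "Z = {p \<in> Om. u t p = 0}"
  have Zm: "(\<lambda>p. indicat_real Z p * w\<^sub>\<phi> p) \<in> borel_measurable M"
  proof -
    have "Z \<in> sets M"
    proof -
      have "{p \<in> space M. u t p = 0} \<in> sets M" by measurable
      then show ?thesis by (simp add: Z_def)
    qed
    then show ?thesis by measurable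
  qed
  have iZ: "integrable M (\<lambda>p. indicat_real Z p * w\<^sub>\<phi> p)"
    by (rule Bochner_Integration.integrable_bound[OF weight_integrable Zm]) (auto simp: indicator_def)
  define m where "m = (LINT p|M. indicat_real Z p * w\<^sub>\<phi> p)"
  have m0: "0 \<le> m" unfolding m_def using w\<^sub>\<phi>_pos by (intro integral_nonneg_AE AE_I2) (simp add: less_imp_le)
  let ?H = "integral {0..t} drift"
  have key: "A - ?H \<le> ln \<delta> / 2 * m + ent 1 t" if \<delta>: "0 < \<delta>" "\<delta> \<le> 1" for \<delta>
  proof -
    have "\<bar>ent \<delta> t - ent \<delta> 0\<bar> \<le> ?H"
      using integral_norm_bound_integral[OF has_integral_integrable[OF ent'_has_integral[OF t \<delta>]] drift_integrable[OF t]] ent'_bound \<delta>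
        integral_unique[OF ent'_has_integral[OF t \<delta>]] by simp
    then have "A - ?H \<le> ent \<delta> t" using A[OF \<delta>] by linarith
    also have "\<dots> \<le> (LINT p|M. ln \<delta> / 2 * (indicat_real Z p * w\<^sub>\<phi> p) + ln ((u t p)\<^sup>2 + 1) / 2 * w\<^sub>\<phi> p)"
      unfolding ent_def
    proof (rule integral_mono_AE)
      show "AE p in M. ln ((u t p)\<^sup>2 + \<delta>) / 2 * w\<^sub>\<phi> p \<le> ln \<delta> / 2 * (indicat_real Z p * w\<^sub>\<phi> p) + ln ((u t p)\<^sup>2 + 1) / 2 * w\<^sub>\<phi> p"
      proof (rule AE_I2)
        fix p assume "p \<in> space M"
        then have p: "p \<in> Om" by simp
        show "ln ((u t p)\<^sup>2 + \<delta>) / 2 * w\<^sub>\<phi> p \<le> ln \<delta> / 2 * (indicat_real Z p * w\<^sub>\<phi> p) + ln ((u t p)\<^sup>2 + 1) / 2 * w\<^sub>\<phi> p"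
        proof (cases "u t p = 0")
          case True
          then show ?thesis using p by (simp add: Z_def)
        next
          case False
          then have "ln ((u t p)\<^sup>2 + \<delta>) \<le> ln ((u t p)\<^sup>2 + 1)"
            using \<delta> by (intro ln_mono add_pos_pos) auto
          then have "ln ((u t p)\<^sup>2 + \<delta>) / 2 * w\<^sub>\<phi> p \<le> ln ((u t p)\<^sup>2 + 1) / 2 * w\<^sub>\<phi> p"
            using w\<^sub>\<phi>_pos[OF p] by (intro mult_right_mono) auto
          then show ?thesis using False by (simp add: Z_def)
        qed
      qed
    qed (use ent_integrable[OF t] \<delta> iZ in auto)
    also have "\<dots> = ln \<delta> / 2 * m + ent 1 t"
      unfolding m_def ent_def using ent_integrable[OF t, of 1] iZ by simp
    finally show ?thesis .
  qed
  have "m = 0"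
  proof (rule ccontr)
    assume "m \<noteq> 0"
    then have m: "0 < m" using m0 by simp
    \<comment> \<open>For \<delta> = exp (-X) the logarithmic term is -X m / 2, and \<open>X\<close>
      is just large enough to violate \<open>key\<close>.\<close>
    define X where "X = max 0 (2 * (ent 1 t - (A - ?H) + 1) / m)"
    have X: "0 \<le> X" "2 * (ent 1 t - (A - ?H) + 1) / m \<le> X" by (auto simp: X_def)
    have "A - ?H \<le> ln (exp (- X)) / 2 * m + ent 1 t" using X(1) by (intro key) auto
    then have "X * m \<le> 2 * (ent 1 t - (A - ?H))" by simp
    moreover have "2 * (ent 1 t - (A - ?H) + 1) \<le> X * m" using X(2) m by (simp add: divide_le_eq)
    ultimately show False by simp
  qed
  then have "AE p in M. indicat_real Z p * w\<^sub>\<phi> p = 0"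
    unfolding m_def using w\<^sub>\<phi>_pos by (subst (asm) integral_nonneg_eq_0_iff_AE[OF iZ]) (auto simp: less_imp_le)
  then show ?thesis
    using AE_space
  proof eventually_elim
    case (elim p)
    then show ?case using w\<^sub>\<phi>_pos[of p] by (auto simp: Z_def indicator_def split: if_splits)
  qed
qed

lemma ent'_tendsto:
  assumes t: "0 \<le> t"
  shows "(\<lambda>n. ent' (1 / real (Suc n)) t) \<longlonglongrightarrow> P t"
proof -
  note [measurable] = L2_measurable[OF L2s(1)[OF t]] L2_measurable[OF L2s(3)[OF t]] weight_measurable
  have "(\<lambda>n. ent' (1 / real (Suc n)) t) \<longlonglongrightarrow> (LINT p|M. 2 * (D t p * w\<^sub>\<phi> p))"
    unfolding ent'_def
  proof (rule integral_dominated_convergence[OF _ _ ent'_integrable_bound(2)[OF t zero_less_one]])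
    show "AE p in M. (\<lambda>n. 2 * ((u t p)\<^sup>2 / ((u t p)\<^sup>2 + 1 / real (Suc n))) * (D t p * w\<^sub>\<phi> p)) \<longlonglongrightarrow> 2 * (D t p * w\<^sub>\<phi> p)"
      using u_nonzero[OF t]
    proof eventually_elim
      case (elim p)
      have "(\<lambda>n. 2 * ((u t p)\<^sup>2 / ((u t p)\<^sup>2 + 1 / real (Suc n))) * (D t p * w\<^sub>\<phi> p))
          \<longlonglongrightarrow> 2 * ((u t p)\<^sup>2 / ((u t p)\<^sup>2 + 0)) * (D t p * w\<^sub>\<phi> p)"
        using elim by (intro tendsto_intros LIMSEQ_Suc[OF lim_1_over_n]) auto
      then show ?case using elim by simp
    qed
    show "AE p in M. norm (2 * ((u t p)\<^sup>2 / ((u t p)\<^sup>2 + 1 / real (Suc n))) * (D t p * w\<^sub>\<phi> p)) \<le> \<bar>D t p\<bar> * (2 * w\<^sub>\<phi> p)" for n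
      using ent'_integrable_bound(1)[OF t, of "1 / real (Suc n)"] by simp
  qed measurable
  then show ?thesis by (simp add: P_def)
qed

text \<open>The convexity used is the tangent inequality of exp at the mean, integrated against the
  weight; it is applied for each \<delta> and the limit is taken afterwards.\<close>

lemma jensen:
  assumes t: "0 \<le> t"
  shows "mass * exp (2 * (A + integral {0..t} P) / mass) \<le> F t"
proof -
  let ?\<delta> = "\<lambda>n. 1 / real (Suc n)"
  have \<delta>: "0 < ?\<delta> n" "?\<delta> n \<le> 1" for n by (simp_all add: divide_le_eq_1)
  define x where "x n = ent (?\<delta> n) t - ent (?\<delta> n) 0" for n
  have x: "x \<longlonglongrightarrow> integral {0..t} P"
  proof -
    \<comment> \<open>Pointwise convergence in time is \<open>ent'_tendsto\<close>, and
      \<open>drift\<close> is the integrable majorant.\<close>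
    have "(\<lambda>n. integral {0..t} (ent' (?\<delta> n))) \<longlonglongrightarrow> integral {0..t} P"
    proof (rule dominated_convergence(2)[OF _ drift_integrable[OF t]])
      show "ent' (?\<delta> n) integrable_on {0..t}" for n
        using ent'_has_integral[OF t \<delta>] has_integral_integrable by blast
      show "norm (ent' (?\<delta> n) s) \<le> drift s" if "s \<in> {0..t}" for n s
        using ent'_bound[of s "?\<delta> n"] that \<delta>[of n] by simp
      show "(\<lambda>n. ent' (?\<delta> n) s) \<longlonglongrightarrow> P s" if "s \<in> {0..t}" for s
        using that by (intro ent'_tendsto) simp
    qed
    moreover have "integral {0..t} (ent' (?\<delta> n)) = x n" for n
      unfolding x_def by (rule integral_unique[OF ent'_has_integral[OF t \<delta>]])
    ultimately show ?thesis by (simp only:)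
  qed
  have le: "mass * exp (2 * (A + x n) / mass) \<le> F t + ?\<delta> n * mass" for n
  proof -
    \<comment> \<open>The weighted mean of ln (\<open>u\<^sup>2\<close> + \<delta>), the point at
      which the tangent is taken; there the linear terms cancel after integration.\<close>
    define y where "y = 2 * ent (?\<delta> n) t / mass"
    have iF: "integrable M (\<lambda>p. (u t p)\<^sup>2 * w\<^sub>\<phi> p)"
      by (rule integrable_mult_smooth[OF smooth_w\<^sub>\<phi> L2_square[OF L2s(1)[OF t]]])
    have ie: "integrable M (\<lambda>p. ln ((u t p)\<^sup>2 + ?\<delta> n) / 2 * w\<^sub>\<phi> p)"
      by (rule ent_integrable[OF t \<delta>])
    have "(LINT p|M. exp y * ((1 - y) * w\<^sub>\<phi> p + 2 * (ln ((u t p)\<^sup>2 + ?\<delta> n) / 2 * w\<^sub>\<phi> p)))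
       \<le> (LINT p|M. (u t p)\<^sup>2 * w\<^sub>\<phi> p + ?\<delta> n * w\<^sub>\<phi> p)"
    proof (rule integral_mono_AE)
      show "AE p in M. exp y * ((1 - y) * w\<^sub>\<phi> p + 2 * (ln ((u t p)\<^sup>2 + ?\<delta> n) / 2 * w\<^sub>\<phi> p)) \<le> (u t p)\<^sup>2 * w\<^sub>\<phi> p + ?\<delta> n * w\<^sub>\<phi> p"
      proof (rule AE_I2)
        fix p assume "p \<in> space M"
        then have w: "0 \<le> w\<^sub>\<phi> p" using w\<^sub>\<phi>_pos[of p] by simp
        define z where "z = (u t p)\<^sup>2 + ?\<delta> n"
        have z: "0 < z" unfolding z_def using \<delta>[of n] by (intro add_nonneg_pos) auto
        have "1 + (ln z - y) \<le> exp (ln z - y)" by (rule exp_ge_add_one_self)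
        then have "exp y * (1 + (ln z - y)) \<le> exp y * exp (ln z - y)" by (intro mult_left_mono) auto
        also have "\<dots> = z" using z by (simp add: exp_diff)
        finally have "exp y * (1 + (ln z - y)) * w\<^sub>\<phi> p \<le> z * w\<^sub>\<phi> p" using w by (rule mult_right_mono)
        then show "exp y * ((1 - y) * w\<^sub>\<phi> p + 2 * (ln ((u t p)\<^sup>2 + ?\<delta> n) / 2 * w\<^sub>\<phi> p)) \<le> (u t p)\<^sup>2 * w\<^sub>\<phi> p + ?\<delta> n * w\<^sub>\<phi> p"
          unfolding z_def[symmetric] distrib_right[symmetric] by (simp add: algebra_simps)
      qed
    qed (intro Bochner_Integration.integrable_add integrable_mult_right iF ie weight_integrable)+
    also have "(LINT p|M. (u t p)\<^sup>2 * w\<^sub>\<phi> p + ?\<delta> n * w\<^sub>\<phi> p) = F t + ?\<delta> n * mass"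
      unfolding F_def mass_def using iF weight_integrable by simp
    also have "(LINT p|M. exp y * ((1 - y) * w\<^sub>\<phi> p + 2 * (ln ((u t p)\<^sup>2 + ?\<delta> n) / 2 * w\<^sub>\<phi> p)))
       = exp y * ((1 - y) * mass + 2 * ent (?\<delta> n) t)"
    proof -
      have "integrable M (\<lambda>p. (1 - y) * w\<^sub>\<phi> p)" "integrable M (\<lambda>p. 2 * (ln ((u t p)\<^sup>2 + ?\<delta> n) / 2 * w\<^sub>\<phi> p))"
        by (rule integrable_mult_right, rule weight_integrable, rule integrable_mult_right, rule ie)
      then show ?thesis
        unfolding integral_mult_right_zero ent_def mass_def
        by (subst Bochner_Integration.integral_add) (simp_all only: integral_mult_right_zero)
    qed
    also have "\<dots> = mass * exp y" using mass_pos by (simp add: y_def field_simps)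
    finally have "mass * exp y \<le> F t + ?\<delta> n * mass" .
    moreover have "2 * (A + x n) / mass \<le> y"
      unfolding y_def using A[OF \<delta>, of n] mass_pos by (intro divide_right_mono) (auto simp: x_def)
    then have "mass * exp (2 * (A + x n) / mass) \<le> mass * exp y" using mass_pos by simp
    ultimately show ?thesis by linarith
  qed
  have "(\<lambda>n. mass * exp (2 * (A + x n) / mass)) \<longlonglongrightarrow> mass * exp (2 * (A + integral {0..t} P) / mass)"
    using mass_pos by (intro tendsto_intros x) auto
  moreover have "(\<lambda>n. F t + ?\<delta> n * mass) \<longlonglongrightarrow> F t + 0 * mass"
    by (intro tendsto_intros LIMSEQ_Suc[OF lim_1_over_n])
  ultimately have "mass * exp (2 * (A + integral {0..t} P) / mass) \<le> F t + 0 * mass"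
    by (rule LIMSEQ_le) (use le in blast)
  then show ?thesis by simp
qed

text \<open>The memory term \<open>I\<close> integrates the lower bound \<open>E\<close> from
  \<open>jensen\<close> instead of \<open>F\<close>: \<open>E\<close> is continuous in time because
  \<open>P\<close> is, so \<open>I\<close> is differentiable and its derivative has the exponential
  form of \<open>exponential_memory_blowup\<close>. Both \<open>laplacian_rate\<close> and
  \<open>jensen\<close> then enter only through the monotonicity of
  \<open>Lam - \<alpha>\<^sup>2 * I\<close>.\<close>

lemma no_global_solution:
  assumes G: "\<And>t. 0 \<le> t \<Longrightarrow> is_cont_rep Om (\<psi> t) (G t)" and B: "0 < P 0"
    and r: "\<And>t. 0 \<le> t \<Longrightarrow> 4 * sh 0 * (bottom (G t) - bottom (G 0)) \<le> P 0 / 2"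
  shows False
proof -
  define Y where "Y t = A + integral {0..t} P" for t
  define E where "E t = mass * exp (2 * Y t / mass)" for t
  define I where "I t = integral {0..t} E" for t
  have Y: "(Y has_real_derivative P t) (at t within {0..})" if "0 \<le> t" for t
    unfolding Y_def using integral_has_derivative_halfline[OF P_continuous that] by (auto intro!: derivative_eq_intros)
  then have "continuous_on {0..} Y"
    by (auto simp: continuous_on_eq_continuous_within intro: DERIV_continuous)
  then have "continuous_on {0..} E" unfolding E_def using mass_pos by (intro continuous_intros) auto
  then have I: "(I has_real_derivative E t) (at t within {0..})" if "0 \<le> t" for t
    unfolding I_def using that by (rule integral_has_derivative_halfline)
  have "0 < \<alpha>\<^sup>2" using alpha_pos by simp
  have mono: "Lam 0 - \<alpha>\<^sup>2 * I 0 \<le> Lam t - \<alpha>\<^sup>2 * I t" if "0 \<le> t" for t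
  proof (rule nondecreasing_on_halfline[of "\<lambda>t. Lam t - \<alpha>\<^sup>2 * I t" "\<lambda>s. (LINT p|M. weak_laplacian Om (\<psi>t s) p * w\<^sub>z p) - \<alpha>\<^sup>2 * E s" 0])
    fix s :: real assume s: "0 \<le> s"
    show "((\<lambda>t. Lam t - \<alpha>\<^sup>2 * I t) has_real_derivative (LINT p|M. weak_laplacian Om (\<psi>t s) p * w\<^sub>z p) - \<alpha>\<^sup>2 * E s) (at s within {0..})"
      by (intro DERIV_diff DERIV_cmult Lam_deriv I s)
    have "\<alpha>\<^sup>2 * E s \<le> \<alpha>\<^sup>2 * F s"
      unfolding E_def Y_def by (intro mult_left_mono jensen s) simp
    then show "0 \<le> (LINT p|M. weak_laplacian Om (\<psi>t s) p * w\<^sub>z p) - \<alpha>\<^sup>2 * E s"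
      using laplacian_rate[OF s] unfolding F_def by linarith
  qed (use that in auto)
  have "P 0 / 2 + 2 * I t \<le> P t" if t: "0 \<le> t" for t
  proof -
    have "\<alpha>\<^sup>2 * I t \<le> Lam t - Lam 0" using mono[OF t] by (simp add: I_def)
    also have "\<dots> = \<alpha>\<^sup>2 * ((P t - P 0) / 2 + 2 * sh 0 * (bottom (G t) - bottom (G 0)))"
      unfolding Lam_green[OF t G[OF t]] Lam_green[OF order_refl G[OF order_refl]] by (simp add: field_simps)
    finally have "I t \<le> (P t - P 0) / 2 + 2 * sh 0 * (bottom (G t) - bottom (G 0))"
      using \<open>0 < \<alpha>\<^sup>2\<close> mult_le_cancel_left_pos by blast
    then show ?thesis using r[OF t] by (simp add: field_simps)
  qed
  \<comment> \<open>The constant is the half of \<open>P 0\<close> that the bound on the bottom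
    integrals leaves over.\<close>
  then show False
    using exponential_memory_blowup[OF mass_pos _ Y I[unfolded E_def], of "P 0 / 2"] B by (simp add: I_def)
qed

end
end

theorem theorem5p2:
  fixes a b :: real
    and u0 \<psi>0 :: "point \<Rightarrow> real"
    and u \<psi> :: "real \<Rightarrow> point \<Rightarrow> real"
    and Tb :: ereal
  assumes "0 < a" and "0 < b"
    and "u0 \<in> sobolev 2 (Omega a b)"
    and "vanishes_on (Omega a b) u0 (frontier (Omega a b))"
    and "\<forall>x\<in>Omega a b. 0 < cont_rep (Omega a b) u0 x"
    and "\<psi>0 \<in> sobolev 3 (Omega a b)"
    and "boundary_condition a b \<psi>0"
    and "largest_time a b u0 \<psi>0 Tb"
    and "regular_solution a b u0 \<psi>0 Tb u \<psi>"
    and "A_const a b u0 > 0"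
    and "B_const a b \<psi>0 > 0"
    and "\<forall>t\<in>time_interval Tb. r_fun a b \<psi>0 \<psi> t \<le> B_const a b \<psi>0 / 2"
  shows "finite_time_singularity a b u0 \<psi>0"
proof (rule ccontr)
  assume "\<not> finite_time_singularity a b u0 \<psi>0"
  \<comment> \<open>A largest time is given, so the absence of a singularity means that it is
    infinite.\<close>
  then have Tb: "Tb = \<infinity>" using assms(8) by (auto simp: finite_time_singularity_def)
  interpret cylinder a b by unfold_locales (rule assms)+
  have time: "t \<in> time_interval \<infinity> \<longleftrightarrow> 0 \<le> t" for t by (simp add: time_interval_def)
  obtain ut \<psi>t where sol: "C1_curve 2 Om \<infinity> u ut" "C1_curve 3 Om \<infinity> \<psi> \<psi>t"
    "\<And>t. 0 \<le> t \<Longrightarrow> AE p in M. ut t p = 2 * u t p * weak_deriv Om [ez] (\<psi> t) p"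
    "\<And>t. 0 \<le> t \<Longrightarrow> has_weak_deriv Om [ez] (\<lambda>p. (u t p)\<^sup>2) (\<lambda>p. - weak_laplacian Om (\<psi>t t) p)"
    "\<And>t. 0 \<le> t \<Longrightarrow> boundary_condition a b (\<psi> t)"
    "AE p in M. u 0 p = u0 p" "AE p in M. \<psi> 0 p = \<psi>0 p"
    using assms(9) unfolding regular_solution_def Tb time Omega_eq e_z_eq Ball_def by blast
  obtain U0 where U0: "is_cont_rep Om u0 U0" "\<forall>p\<in>frontier Om. U0 p = 0"
    using assms(4) by (auto simp: vanishes_on_def Omega_eq)
  have u0_pos: "AE p in M. 0 < u0 p"
  proof -
    have "AE p in M. u0 p = cont_rep Om u0 p" using is_cont_rep_cont_rep[OF U0(1)] by (simp add: is_cont_rep_def)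
    then show ?thesis using AE_space by eventually_elim (use assms(5) in \<open>simp add: Omega_eq\<close>)
  qed
  interpret global_solution a b u ut \<psi> \<psi>t U0
  proof unfold_locales
    show "is_cont_rep Om (u 0) U0"
      using U0(1) sol(6) unfolding is_cont_rep_def by (auto elim: eventually_elim2)
  qed (use sol U0(2) in auto)
  have zero: "0 \<in> time_interval \<infinity>" by (simp add: time)
  have A: "A_const a b u0 \<le> ent \<delta> 0" if \<delta>: "0 < \<delta>" "\<delta> \<le> 1" for \<delta>
    unfolding A_const_def ent_def Omega_eq phi_eq
  proof (rule integral_mono_AE)
    \<comment> \<open>A function that is not integrable has integral 0 by convention, so positivity
      of \<open>A_const\<close> forces integrability.\<close>
    show "integrable M (\<lambda>p. ln (u0 p) * w\<^sub>\<phi> p)"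
      using assms(10) not_integrable_integral_eq unfolding A_const_def Omega_eq phi_eq by fastforce
    show "integrable M (\<lambda>p. ln ((u 0 p)\<^sup>2 + \<delta>) / 2 * w\<^sub>\<phi> p)" by (rule ent_integrable[OF order_refl \<delta>])
    show "AE p in M. ln (u0 p) * w\<^sub>\<phi> p \<le> ln ((u 0 p)\<^sup>2 + \<delta>) / 2 * w\<^sub>\<phi> p"
      using sol(6) u0_pos AE_space
    proof eventually_elim
      case (elim p)
      \<comment> \<open>Positivity of \<open>u0\<close> turns the logarithm into half that of the
        square, and adding \<delta> only increases it; hence the bound is uniform in
        \<delta>.\<close>
      have "ln (u0 p) = ln ((u0 p)\<^sup>2) / 2" using elim by (simp add: ln_realpow)
      also have "\<dots> \<le> ln ((u 0 p)\<^sup>2 + \<delta>) / 2"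
        using elim \<delta> by (intro divide_right_mono ln_mono) auto
      finally show ?case using w\<^sub>\<phi>_pos[of p] elim by (intro mult_right_mono) auto
    qed
  qed
  have P0: "P 0 = B_const a b \<psi>0"
    unfolding P_def B_const_def Omega_eq phi_eq e_z_eq
  proof (intro arg_cong2[where f = "(*)"] refl integral_cong_AE)
    have \<psi>0: "\<psi>0 \<in> sobolev 3 Om" using assms(6) by (simp add: Omega_eq)
    have "AE p in M. \<psi>0 p = \<psi> 0 p" using sol(7) by eventually_elim simp
    from weak_deriv_cong_AE[OF \<psi>0 sobolev_L2[OF sob(3)[OF order_refl]] this derivs_upto_point(1)]
    show "AE p in M. D 0 p * w\<^sub>\<phi> p = weak_deriv Om [ez] \<psi>0 p * w\<^sub>\<phi> p" by eventually_elim simp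
    show "(\<lambda>p. D 0 p * w\<^sub>\<phi> p) \<in> borel_measurable M"
      by (rule borel_measurable_integrable[OF D_weight_integrable[OF order_refl]])
    show "(\<lambda>p. weak_deriv Om [ez] \<psi>0 p * w\<^sub>\<phi> p) \<in> borel_measurable M"
      by (intro borel_measurable_integrable integrable_mult_smooth[OF smooth_w\<^sub>\<phi>] L2_integrable weak_deriv_L2[OF \<psi>0 derivs_upto_point(1)])
  qed
  define G where "G t = cont_rep Om (\<psi> t)" for t
  have G: "is_cont_rep Om (\<psi> t) (G t)" if t: "0 \<le> t" for t
    using sol(5)[OF t] is_cont_rep_cont_rep unfolding G_def boundary_condition_def vanishes_on_def Omega_eq by blast
  have r: "r_fun a b \<psi>0 \<psi> t = 4 * sh 0 * (bottom (G t) - bottom (G 0))" if t: "0 \<le> t" for t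
  proof -
    have Gc: "continuous_on (closure Om) (G s)" if "0 \<le> s" for s using G[OF that] by (simp add: is_cont_rep_def)
    \<comment> \<open>\<open>\<psi>0\<close> and \<open>\<psi> 0\<close> agree almost everywhere, so
      this is a continuous representative of the difference; uniqueness then identifies its bottom
      values with those in \<open>r_fun\<close>.\<close>
    have "is_cont_rep Om (\<lambda>p. \<psi> t p - \<psi>0 p) (\<lambda>p. G t p - G 0 p)"
      unfolding is_cont_rep_def
    proof (intro conjI continuous_on_diff Gc t order_refl)
      have "AE p in M. \<psi> t p = G t p" "AE p in M. \<psi> 0 p = G 0 p" using G[OF t] G[OF order_refl] by (auto simp: is_cont_rep_def)
      then show "AE p in M. \<psi> t p - \<psi>0 p = G t p - G 0 p" using sol(7) by eventually_elim simp
    qed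
    from cont_rep_unique[OF is_cont_rep_cont_rep[OF this] this]
    have eq: "cont_rep Om (\<lambda>p. \<psi> t p - \<psi>0 p) (x, 0) = G t (x, 0) - G 0 (x, 0)" if "x \<in> Omega_x a" for x
      using that b_pos by (auto simp: closure_Om Omega_x_eq)
    have "pi * s / a = \<alpha> * s" for s by (simp add: alp_def)
    then have "(LINT x|lebesgue_on (Omega_x a). cont_rep Om (\<lambda>p. \<psi> t p - \<psi>0 p) (x, 0) * sin (pi * fst x / a) * sin (pi * snd x / a))
      = (LINT x|lebesgue_on (Omega_x a). G t (x, 0) * (sn (fst x) * sn (snd x)) - G 0 (x, 0) * (sn (fst x) * sn (snd x)))"
      by (intro Bochner_Integration.integral_cong refl) (simp add: eq sn_def left_diff_distrib)
    also have "\<dots> = bottom (G t) - bottom (G 0)"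
      unfolding bottom_def by (rule Bochner_Integration.integral_diff[OF bottom_integrable[OF Gc[OF t]] bottom_integrable[OF Gc[OF order_refl]]])
    finally have 1: "(LINT x|lebesgue_on (Omega_x a). cont_rep Om (\<lambda>p. \<psi> t p - \<psi>0 p) (x, 0) * sin (pi * fst x / a) * sin (pi * snd x / a))
      = bottom (G t) - bottom (G 0)" .
    \<comment> \<open>With pi / a = \<alpha> the denominator is \<alpha>^2, and the difference of
      exponentials is \<open>2 * sh 0\<close>.\<close>
    have "2 * (pi / a)\<^sup>2 * (exp (\<alpha> * b) - exp (- \<alpha> * b)) / (2 * (pi / a)\<^sup>2 - \<alpha>\<^sup>2) = 4 * sh 0"
      using alpha_pos unfolding alp_def[symmetric] by (simp add: sh_def)
    then show ?thesis unfolding r_fun_def Omega_eq 1 by (simp only:)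
  qed
  show False
  proof (rule no_global_solution[OF A G])
    show "0 < P 0" using assms(11) by (simp add: P0)
    show "4 * sh 0 * (bottom (G t) - bottom (G 0)) \<le> P 0 / 2" if "0 \<le> t" for t
      using assms(12) that unfolding Tb P0 r[OF that, symmetric] by (simp add: time)
  qed
qed

end
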